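(* Let $0<r<1$, $|x|<r$, $|y|=r$, and let $P_r(x,y)$ be the Poisson kernel of the ball $D=\{x\in\mathbb{D}^n:|x|<r\}$ for the hyperbolic Brownian motion on $\mathbb{D}^n$. Let $w_{|x|^2,r^2}$ be the inverse Laplace transform of $H_{|x|^2,r^2}$ (both described in the context). (1) If $n=4$, then $w_{|x|^2,r^2}(v)=\frac{2(1+r^2)}{1-r^2}\,e^{-\frac{2v}{1-r^2}}$ and $$P_r(x,y)=\frac{1}{2\pi^2r(1-r^2)^2}\cdot\frac{r^2-|x|^2}{|x-y|^4}\int_0^\infty\frac{\left[|x|^2(e^{-v}-1)+r^2(e^v-1)\right]^2w_{|x|^2,r^2}(v)}{|xe^{-v}-y|^2}\,dv .$$ (2) If $n=6$, then $w_{|x|^2,r^2}(v)=w^1_{|x|^2,r^2}(v)+w^2_{|x|^2,r^2}(v)$, where $$w^1_{|x|^2,r^2}(v)=3\left[1-r^2|x|^2+3(r^2-|x|^2)\right]e^{-bv}\cosh(cv),$$ $$w^2_{|x|^2,r^2}(v)=-3\left[1+|x|^2r^2+5(|x|^2+r^2)\right]\frac{e^{-bv}\sinh(cv)}{2c},$$ and $$L(x,y,v)=\left[|x|^2(e^{-v}-1)+r^2(e^v-1)\right]^2\left(2|xe^{-v/2}-ye^{v/2}|^2+|x-y|^2\right),$$ hence $$P_r(x,y)=\frac{1}{\pi^3r(1-r^2)^4}\cdot\frac{r^2-|x|^2}{|x-y|^6}\int_0^\infty\frac{L(x,y,v)\,w_{|x|^2,r^2}(v)}{|xe^{-v}-y|^4}\,dv,$$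 where $b=\frac{7-r^2}{2(1-r^2)}$ and $c=c(r)=\frac{\sqrt{r^4-14r^2+1}}{2(1-r^2)}$.
   Context: $\mathbb{D}^n=\{x\in\mathbb{R}^n:|x|<1\}$ is the ball model of real hyperbolic space with metric $ds^2=|dx|^2/(1-|x|^2)^2$. The hyperbolic Brownian motion $X(t)$ is the diffusion on $\mathbb{D}^n$ with generator the Laplace–Beltrami operator $(1-|x|^2)^2\sum_i\frac{\partial^2}{\partial x_i^2}+2(n-2)(1-|x|^2)\sum_i x_i\frac{\partial}{\partial x_i}$. With $\tau_D=\inf\{t\ge0:|X(t)|\ge r\}$, the Poisson kernel $P_r(x,\cdot)$, $x\in D$, is the density, with respect to the $(n-1)$-dimensional Euclidean spherical measure on $\{|y|=r\}$, of the distribution of $X(\tau_D)$ under $P^x$. Put $\rho=\frac{n-2}{2}$, $F_k(z)=F(k,-\rho;k+\frac n2;z)$ with $F$ the Gauss hypergeometric function, and $f_z(k)=\frac{1}{\Gamma(k+\frac n2)}F_k(z)$, an entire function of the complex variable $k$. The function $H_{|x|^2,r^2}(k)$ is defined by $$\frac{k+\rho}{\rho}\,\frac{f_{|x|^2}(k)}{f_{r^2}(k)}=\left(\frac{1-|x|^2}{1-r^2}\right)^{\rho}\left(\frac{k+\rho}{\rho}-\frac n2\,\frac{r^2-|x|^2}{(1-r^2)(1-|x|^2)}\right)+\frac{r^2-|x|^2}{(1-r^2)^{n-2}}\,H_{|x|^2,r^2}(k),$$ and its inverse Laplace transform $w_{|x|^2,r^2}$ is the function on $(0,\infty)$ with $H_{|x|^2,r^2}(k)=\int_0^\infty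 e^{-kv}w_{|x|^2,r^2}(v)\,dv$ for every complex $k$ with $\mathrm{Re}\,k\ge-\frac n2-\varepsilon$, for some $\varepsilon>0$. The number $c$ may be real, zero or purely imaginary: when $r^4-14r^2+1<0$, $c=i\tilde c$ with $\tilde c=\frac{\sqrt{|r^4-14r^2+1|}}{2(1-r^2)}$, so $\cosh(cv)=\cos(\tilde cv)$ and $\sinh(cv)/c=\sin(\tilde cv)/\tilde c$; when $c=0$, $\sinh(cv)/c$ is read as $v$.
   Formalization: In (2) the sign of w² is corrected: the formal statement has +3[1+|x|²r²+5(|x|²+r²)]e^{-bv}sinh(cv)/(2c) instead of −3[…]; with the given definition of H the printed sign is false (as x, r → 0, H → 3/(k+3), while the printed sign gives 3/(k+4)). *)

theory Defs
  imports "HOL-Probability.Probability"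
begin

section \<open>Hyperbolic Brownian motion on the unit ball\<close>

definition partial :: "'n \<Rightarrow> (real ^ 'n \<Rightarrow> real) \<Rightarrow> real ^ 'n \<Rightarrow> real" where
  "partial i f x = frechet_derivative f (at x) (axis i 1)"

definition C1 :: "(real ^ 'n \<Rightarrow> real) \<Rightarrow> bool" where
  "C1 f \<longleftrightarrow> (\<forall>x. f differentiable (at x)) \<and> (\<forall>i. continuous_on UNIV (partial i f))"

definition C2 :: "(real ^ 'n \<Rightarrow> real) \<Rightarrow> bool" where
  "C2 f \<longleftrightarrow> C1 f \<and> (\<forall>i. C1 (partial i f))"

definition test_function :: "(real ^ 'n \<Rightarrow> real) \<Rightarrow> bool" where
  "test_function f \<longleftrightarrow>
     C2 f \<and> compact (closure {x. f x \<noteq> 0}) \<and> closure {x. f x \<noteq> 0} \<subseteq> ball 0 1"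

definition hyperbolic_Laplacian :: "(real ^ 'n \<Rightarrow> real) \<Rightarrow> real ^ 'n \<Rightarrow> real" where
  "hyperbolic_Laplacian f x =
     (1 - (norm x)\<^sup>2)\<^sup>2 * (\<Sum>i\<in>UNIV. partial i (partial i f) x)
     + 2 * (real CARD('n) - 2) * (1 - (norm x)\<^sup>2) * (\<Sum>i\<in>UNIV. x $ i * partial i f x)"

definition natural_filtration ::
    "'w measure \<Rightarrow> (real \<Rightarrow> 'w \<Rightarrow> 'a :: topological_space) \<Rightarrow> real \<Rightarrow> 'w measure" where
  "natural_filtration M X t =
     sigma (space M) (\<Union>s\<in>{0..t}. {X s -` A \<inter> space M | A. A \<in> sets borel})"

definition martingale ::
    "'w measure \<Rightarrow> (real \<Rightarrow> 'w measure) \<Rightarrow> (real \<Rightarrow> 'w \<Rightarrow> real) \<Rightarrow> bool" where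
  "martingale M F N \<longleftrightarrow>
     (\<forall>t\<ge>0. N t \<in> borel_measurable (F t) \<and> integrable M (N t)) \<and>
     (\<forall>s\<ge>0. \<forall>t\<ge>s. AE \<omega> in M. real_cond_exp M (F s) (N t) \<omega> = N s \<omega>)"

text \<open>A diffusion with generator \<open>L\<close> is a process with continuous paths, governed by
  a family of laws \<open>P x\<close> (started at \<open>x\<close>), such that
  \<open>f (X t) - f (X 0) - \<integral>\<^sub>0\<^sup>t L f (X s) ds\<close> is a martingale under every
  \<open>P x\<close> for all \<open>f\<close> of class \<open>C\<^sup>2\<close> with compact support in the state space
  (Stroock--Varadhan).  Time is real; only \<open>t \<ge> 0\<close> matters.\<close>

definition hyperbolic_Brownian_motion ::
    "(real ^ 'n \<Rightarrow> 'w measure) \<Rightarrow> (real \<Rightarrow> 'w \<Rightarrow> real ^ 'n) \<Rightarrow> bool" where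
  "hyperbolic_Brownian_motion P X \<longleftrightarrow>
     (\<forall>x \<in> ball 0 1.
        prob_space (P x) \<and>
        (\<forall>t\<ge>0. X t \<in> borel_measurable (P x)) \<and>
        (\<forall>\<omega> \<in> space (P x). continuous_on {0..} (\<lambda>t. X t \<omega>) \<and> (\<forall>t\<ge>0. X t \<omega> \<in> ball 0 1)) \<and>
        (AE \<omega> in P x. X 0 \<omega> = x) \<and>
        (\<forall>f. test_function f \<longrightarrow>
           martingale (P x) (natural_filtration (P x) X)
             (\<lambda>t \<omega>. f (X t \<omega>) - f (X 0 \<omega>)
                - (LINT s:{0..t}|lborel. hyperbolic_Laplacian f (X s \<omega>)))))"


section \<open>The Poisson kernel\<close>

text \<open>The infimum is taken in \<open>ennreal\<close>, so that it is \<open>\<infinity>\<close> for a path that never leaves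
  the ball.\<close>

definition exit_time :: "real \<Rightarrow> (real \<Rightarrow> 'w \<Rightarrow> real ^ 'n) \<Rightarrow> 'w \<Rightarrow> ennreal" where
  "exit_time r X \<omega> = (INF t \<in> {t. 0 \<le> t \<and> r \<le> norm (X t \<omega>)}. ennreal t)"

text \<open>On the event \<open>exit_time = \<infinity>\<close> this is \<open>X 0\<close>, which lies off the sphere; so a law of
  \<open>exit_position\<close> carried by the sphere entails that the exit time is almost surely finite.\<close>

definition exit_position :: "real \<Rightarrow> (real \<Rightarrow> 'w \<Rightarrow> real ^ 'n) \<Rightarrow> 'w \<Rightarrow> real ^ 'n" where
  "exit_position r X \<omega> = X (enn2real (exit_time r X \<omega>)) \<omega>"

text \<open>Surface measure on the sphere of radius \<open>r\<close> in polar coordinates: the measure of a part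
  \<open>A\<close> of the sphere is \<open>n / r\<close> times the volume of the cone over \<open>A\<close> with apex \<open>0\<close>.
  It is unnormalised, of total mass \<open>n / r\<close> times the volume of the ball.\<close>

definition sphere_measure :: "real \<Rightarrow> (real ^ 'n) measure" where
  "sphere_measure r =
     distr (density lborel (\<lambda>z. ennreal (real CARD('n) / r) * indicator (ball 0 r) z)) borel
       (\<lambda>z. (r / norm z) *\<^sub>R z)"

text \<open>A density is determined only almost everywhere; the Poisson kernel is the version that is
  nonnegative and continuous on the sphere (set to \<open>0\<close> off the sphere).\<close>

definition poisson_kernel ::
    "(real ^ 'n \<Rightarrow> 'w measure) \<Rightarrow> (real \<Rightarrow> 'w \<Rightarrow> real ^ 'n) \<Rightarrow> real \<Rightarrow> real ^ 'n \<Rightarrow> real ^ 'n \<Rightarrow> real" where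
  "poisson_kernel P X r x =
     (THE p. continuous_on (sphere 0 r) p \<and> (\<forall>y \<in> sphere 0 r. 0 \<le> p y) \<and>
        (\<forall>y. y \<notin> sphere 0 r \<longrightarrow> p y = 0) \<and>
        distr (P x) borel (exit_position r X) = density (sphere_measure r) (\<lambda>y. ennreal (p y)))"


section \<open>The function \<open>H\<close> and its inverse Laplace transform\<close>

definition gauss_F :: "complex \<Rightarrow> complex \<Rightarrow> complex \<Rightarrow> complex \<Rightarrow> complex" where
  "gauss_F a b c z =
     (\<Sum>j. pochhammer a j * pochhammer b j / (pochhammer c j * fact j) * z ^ j)"

definition rho :: "nat \<Rightarrow> real" where
  "rho n = (real n - 2) / 2"

definition F_n :: "nat \<Rightarrow> complex \<Rightarrow> real \<Rightarrow> complex" where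
  "F_n n k z = gauss_F k (- of_real (rho n)) (k + of_nat n / 2) (of_real z)"

text \<open>\<open>F_n n k z / \<Gamma>(k + n/2)\<close> has removable singularities where
  \<open>k + n/2\<close> is a nonpositive integer; there the value of the entire extension is its limit.
  The point \<open>k = - n/2\<close> lies in the half-plane used for the Laplace transform below.\<close>

definition f_n :: "nat \<Rightarrow> real \<Rightarrow> complex \<Rightarrow> complex" where
  "f_n n z k =
     (if k + of_nat n / 2 \<in> \<int>\<^sub>\<le>\<^sub>0
      then Lim (at k) (\<lambda>k'. F_n n k' z / Gamma (k' + of_nat n / 2))
      else F_n n k z / Gamma (k + of_nat n / 2))"

text \<open>For \<open>q \<noteq> s\<close> this is the solution \<open>H\<close> of
  \<open>(k + \<rho>)/\<rho> * f\<^sub>q(k)/f\<^sub>s(k) =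
     ((1-q)/(1-s))\<^sup>\<rho> * ((k + \<rho>)/\<rho> - n/2 * (s-q)/((1-s)(1-q)))
     + (s-q)/(1-s)\<^sup>n\<^sup>-\<^sup>2 * H\<close>,
  where \<open>q = |x|\<^sup>2\<close> and \<open>s = r\<^sup>2\<close>.\<close>

definition H_n :: "nat \<Rightarrow> real \<Rightarrow> real \<Rightarrow> complex \<Rightarrow> complex" where
  "H_n n q s k =
     of_real ((1 - s) ^ (n - 2) / (s - q)) *
     ((k + of_real (rho n)) / of_real (rho n) * (f_n n q k / f_n n s k)
      - of_real (((1 - q) / (1 - s)) powr rho n) *
        ((k + of_real (rho n)) / of_real (rho n)
         - of_real (real n / 2 * ((s - q) / ((1 - s) * (1 - q))))))"

text \<open>As a function on \<open>(0, \<infinity>)\<close> an inverse Laplace transform is determined only almost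
  everywhere; the continuous version is meant (set to \<open>0\<close> on \<open>v \<le> 0\<close>).\<close>

definition inverse_laplace :: "real \<Rightarrow> (complex \<Rightarrow> complex) \<Rightarrow> real \<Rightarrow> real" where
  "inverse_laplace a G =
     (THE w. continuous_on {0<..} w \<and> (\<forall>v\<le>0. w v = 0) \<and>
        (\<exists>\<epsilon>>0. \<forall>k. Re k \<ge> a - \<epsilon> \<longrightarrow>
           set_integrable lborel {0<..} (\<lambda>v. exp (- k * of_real v) * of_real (w v)) \<and>
           G k = (LINT v:{0<..}|lborel. exp (- k * of_real v) * of_real (w v))))"

definition w_n :: "nat \<Rightarrow> real \<Rightarrow> real \<Rightarrow> real \<Rightarrow> real" where
  "w_n n q s = inverse_laplace (- real n / 2) (H_n n q s)"


section \<open>The explicit expressions in dimension six\<close>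

definition b6 :: "real \<Rightarrow> real" where
  "b6 r = (7 - r\<^sup>2) / (2 * (1 - r\<^sup>2))"

text \<open>\<open>csqrt\<close> of a negative real is \<open>\<i>\<close> times the real square root of its absolute value.\<close>

definition c6 :: "real \<Rightarrow> complex" where
  "c6 r = csqrt (of_real (r ^ 4 - 14 * r\<^sup>2 + 1)) / of_real (2 * (1 - r\<^sup>2))"

definition sinh_over :: "complex \<Rightarrow> real \<Rightarrow> complex" where
  "sinh_over c v = (if c = 0 then of_real v else sinh (c * of_real v) / c)"

definition w6_1 :: "real ^ 'n \<Rightarrow> real \<Rightarrow> real \<Rightarrow> complex" where
  "w6_1 x r v =
     of_real (3 * (1 - r\<^sup>2 * (norm x)\<^sup>2 + 3 * (r\<^sup>2 - (norm x)\<^sup>2)) * exp (- b6 r * v))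
     * cosh (c6 r * of_real v)"

text \<open>The source prints this summand with the opposite sign (factor \<open>-3\<close>), which is a
  misprint.  For \<open>n = 6\<close> and \<open>q = |x|\<^sup>2\<close>, \<open>s = r\<^sup>2\<close>, the definition of
  \<open>H_n\<close> gives \<open>H(k) = (\<alpha> (k + b) + \<beta>) / ((k + b)\<^sup>2 - c\<^sup>2)\<close> with
  \<open>\<alpha> = 3 (1 - s q + 3 (s - q))\<close> and \<open>\<beta> = + 3/2 (1 + s q + 5 (s + q))\<close>;
  as \<open>q, s \<rightarrow> 0\<close> this is \<open>3 / (k + 3)\<close>, whereas the printed sign would
  give \<open>3 / (k + 4)\<close>.\<close>

definition w6_2 :: "real ^ 'n \<Rightarrow> real \<Rightarrow> real \<Rightarrow> complex" where
  "w6_2 x r v =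
     of_real (3 * (1 + (norm x)\<^sup>2 * r\<^sup>2 + 5 * ((norm x)\<^sup>2 + r\<^sup>2)) * exp (- b6 r * v))
     * sinh_over (c6 r) v / 2"

definition L6 :: "real \<Rightarrow> real ^ 'n \<Rightarrow> real ^ 'n \<Rightarrow> real \<Rightarrow> real" where
  "L6 r x y v =
     ((norm x)\<^sup>2 * (exp (- v) - 1) + r\<^sup>2 * (exp v - 1))\<^sup>2
     * (2 * (norm (exp (- v / 2) *\<^sub>R x - exp (v / 2) *\<^sub>R y))\<^sup>2 + (norm (x - y))\<^sup>2)"

end

theory Submission
  imports Defs
begin

text \<open>
Write \<open>q\<close> for the squared norm of a point of the ball, \<open>s = r\<^sup>2\<close>, and \<open>E\<close> for the Euler operator
\<open>y \<bullet> \<nabla>\<close>.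

In even dimension \<open>n\<close> the parameter \<open>-\<rho>\<close> is a nonpositive integer, so \<open>F\<^sub>k\<close> is a polynomial in
its argument and, after the Gamma function is absorbed, \<open>f\<^sub>z(k)\<close> is \<open>1/\<Gamma>\<close> times a polynomial in
\<open>k\<close>: it is \<open>(1-z) k + 2\<close> for \<open>n = 4\<close> and \<open>(1-z)\<^sup>2 k\<^sup>2 + (1-z) (7-z) k + 12\<close> for \<open>n = 6\<close>
(\<open>f_n_4\<close>, \<open>f_n_6\<close>).  Hence \<open>H\<close> is rational in \<open>k\<close> and its inverse Laplace transform can be read off;
it is the only continuous one because Laplace transforms on a vertical line are Fourier transforms
(\<open>laplace_injective\<close>).

The same polynomials give harmonic functions of the hyperbolic motion.  If \<open>p\<close> is a harmonic
polynomial, homogeneous of degree \<open>k\<close>, then \<open>F\<^sub>k(q) p\<close> is annihilated by the Laplace--Beltrami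
operator, so for a Euclidean harmonic \<open>g\<close> the functions \<open>(1-q) E g + 2 g\<close> (\<open>n = 4\<close>) and
\<open>(1-q)\<^sup>2 E\<^sup>2 g + (1-q) (7-q) E g + 12 g\<close> (\<open>n = 6\<close>) are annihilated, too.  Take for \<open>g\<close> the Newton
kernel with a pole \<open>z\<close> outside the ball of radius \<open>r\<close>.  Optional stopping gives the mean of these
functions at the exit position.  On the sphere \<open>q = s\<close> is constant, and \<open>E\<close> becomes \<open>- d/dv\<close> when the
pole is dilated to \<open>exp v * z\<close>; so the means of the dilated Newton kernels under the exit law
solve a linear differential equation with constant coefficients.  It is inverted by integrating against
an exponentially decaying solution of the adjoint equation and integrating by parts
(\<open>exit_newton_transfer\<close>).  The result is a closed expression \<open>\<Psi>(z)\<close> for the integral of the Euclidean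
Poisson quotient \<open>(|z|\<^sup>2 - |y|\<^sup>2) / |y - z|\<^sup>n\<close> against the exit law (\<open>exit_poisson4\<close>,
\<open>exit_poisson6\<close>).

As \<open>z\<close> tends radially to the sphere these quotients form an approximate identity there, so the exit
law has the density \<open>\<Psi>\<close> up to a constant (\<open>sphere_density_from_poisson_integrals\<close>).  The constant
comes from the motion started at \<open>0\<close>, for which \<open>\<Psi>(z) = |z|\<^bsup>2-n\<^esup>\<close>, together with the rotation
invariance of the surface measure.  Finally, for \<open>z\<close> on the sphere a partial fraction decomposition
turns \<open>\<Psi>(z)\<close> into the integrals of the theorem (\<open>poisson4_on_sphere\<close>, \<open>poisson6_on_sphere\<close>).
\<close>

section \<open>Uniqueness of Laplace transforms\<close>

lemma set_integrable_exp_bound: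
  fixes f :: "real \<Rightarrow> 'a::euclidean_space"
  assumes "continuous_on {0<..} f" and "\<delta> > 0"
    and "\<And>v. v > 0 \<Longrightarrow> norm (f v) \<le> B * exp (- \<delta> * v)"
  shows "set_integrable lborel {0<..} f"
proof (rule set_integrable_bound)
  show "set_integrable lborel {0<..} (\<lambda>v. B * exp (- (v * \<delta>)))"
    using integrable_I0i_exp_mscale[OF assms(2)] by (rule set_integrable_mult_right)
  show "set_borel_measurable lborel {0<..} f"
    using borel_measurable_continuous_on_indicator[OF _ assms(1)]
    by (simp add: set_borel_measurable_def)
  show "AE x in lborel. x \<in> {0<..} \<longrightarrow> norm (f x) \<le> norm (B * exp (- (x * \<delta>)))"
    using assms(3) by (intro AE_I2) (force simp: mult.commute abs_le_iff intro: order_trans)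
qed

lemma FTC_Ioi:
  fixes F f :: "real \<Rightarrow> 'a::euclidean_space"
  assumes F: "\<And>v. v \<ge> 0 \<Longrightarrow> (F has_vector_derivative f v) (at v)"
    and f: "continuous_on {0<..} f" and int: "set_integrable lborel {0<..} f"
    and lim: "(F \<longlongrightarrow> 0) at_top"
  shows "(LINT v:{0<..}|lborel. f v) = - F 0"
proof -
  have eq: "einterval (ereal 0) \<infinity> = {0<..}" by (auto simp: einterval_def)
  have "isCont F 0"
    using F[of 0] has_vector_derivative_continuous by blast
  then have "(F \<longlongrightarrow> F 0) (at_right 0)"
    by (simp add: isCont_def filterlim_at_split)
  then have "(LBINT x=ereal 0..\<infinity>. f x) = 0 - F 0"
    using F f int lim
    by (intro interval_integral_FTC_integrable)
      (auto simp: ereal_tendsto_simps eq continuous_on_eq_continuous_at)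
  then show ?thesis
    by (simp add: interval_lebesgue_integral_def eq)
qed

text \<open>The positive and the negative part of \<open>g\<close> have the same mass (take \<open>t = 0\<close>).  Divided by it they
are probability densities with the same characteristic function, and Levy's uniqueness theorem
applies.\<close>

lemma fourier_injective:
  fixes g :: "real \<Rightarrow> real"
  assumes g: "integrable lborel g"
    and zero: "\<And>t. (LINT x|lborel. iexp (t * x) * complex_of_real (g x)) = 0"
  shows "AE x in lborel. g x = 0"
proof -
  \<comment> \<open>the two parts of \<open>g\<close>, both of mass \<open>c\<close>\<close>
  define gp where "gp x = max 0 (g x)" for x
  define gm where "gm x = max 0 (- g x)" for x
  have gpm: "g x = gp x - gm x" "gp x \<ge> 0" "gm x \<ge> 0" for x by (auto simp: gp_def gm_def)
  have int: "integrable lborel gp" "integrable lborel gm"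
    unfolding gp_def gm_def using g by auto
  note [measurable] = borel_measurable_integrable[OF int(1)] borel_measurable_integrable[OF int(2)]
  define c where "c = (LINT x|lborel. gp x)"
  have "complex_of_real (LINT x|lborel. g x) = 0"
    using zero[of 0] by (simp add: integral_complex_of_real)
  then have "(LINT x|lborel. g x) = 0" by simp
  moreover have "(LINT x|lborel. g x) = (LINT x|lborel. gp x) - (LINT x|lborel. gm x)"
    using int by (simp add: gpm(1))
  ultimately have cm: "c = (LINT x|lborel. gm x)" by (simp add: c_def)
  have "c \<ge> 0" by (simp add: c_def gpm)
  have conv: "integrable lborel (\<lambda>x. iexp (t * x) * complex_of_real (h x))"
    if "integrable lborel h" for t h
    by (rule Bochner_Integration.integrable_bound[OF that]) (use that in \<open>auto simp: norm_mult\<close>)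
  show ?thesis
  proof (cases "c = 0")
    case True
    have "AE x in lborel. gp x = 0"
      using True int gpm integral_nonneg_eq_0_iff_AE[of lborel gp] by (simp add: c_def)
    moreover have "AE x in lborel. gm x = 0"
      using True int gpm cm integral_nonneg_eq_0_iff_AE[of lborel gm] by simp
    ultimately show ?thesis by eventually_elim (simp add: gpm)
  next
    case False
    with \<open>c \<ge> 0\<close> have c: "c > 0" by simp
    define D where "D h = density lborel (\<lambda>x. ennreal (h x / c))" for h :: "real \<Rightarrow> real"
    have rd: "real_distribution (D h)"
      and ch: "char (D h) t = (LINT x|lborel. iexp (t * x) * complex_of_real (h x)) / c"
      if h: "integrable lborel h" "\<And>x. h x \<ge> 0" "(LINT x|lborel. h x) = c" for h t
    proof -
      note [measurable] = borel_measurable_integrable[OF h(1)]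
      have "emeasure (D h) (space (D h)) = (\<integral>\<^sup>+x. ennreal (h x / c) \<partial>lborel)"
        by (simp add: D_def emeasure_density)
      also have "\<dots> = ennreal (LINT x|lborel. h x / c)"
        using h c by (intro nn_integral_eq_integral) auto
      finally have "prob_space (D h)"
        using h c by (intro prob_spaceI) simp
      then show "real_distribution (D h)"
        by (simp add: real_distribution_def real_distribution_axioms_def D_def)
      have "char (D h) t = (LINT x|lborel. (h x / c) *\<^sub>R iexp (t * x))"
        unfolding char_def D_def using h c by (intro integral_density) auto
      also have "\<dots> = (LINT x|lborel. iexp (t * x) * complex_of_real (h x) / c)"
        by (intro Bochner_Integration.integral_cong) (auto simp: scaleR_conv_of_real)
      finally show "char (D h) t = (LINT x|lborel. iexp (t * x) * complex_of_real (h x)) / c"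
        by simp
    qed
    have "char (D gp) t = char (D gm) t" for t
    proof -
      have "(LINT x|lborel. iexp (t * x) * complex_of_real (gp x))
          - (LINT x|lborel. iexp (t * x) * complex_of_real (gm x))
          = (LINT x|lborel. iexp (t * x) * complex_of_real (g x))"
        by (subst Bochner_Integration.integral_diff[OF conv[OF int(1)] conv[OF int(2)], symmetric])
          (simp add: gpm(1) right_diff_distrib)
      then show ?thesis
        using zero[of t] ch[of gp] ch[of gm] int gpm cm by (simp add: c_def)
    qed
    then have "D gp = D gm"
      using int gpm cm by (intro Levy_uniqueness rd ext) (auto simp: c_def)
    then have "AE x in lborel. ennreal (gp x / c) = ennreal (gm x / c)"
      unfolding D_def by (intro sigma_finite_measure.density_unique[OF sigma_finite_lborel]) auto
    then show ?thesis
      by eventually_elim (use c gpm in \<open>auto simp: divide_eq_eq\<close>)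
  qed
qed

text \<open>On the line \<open>Re k = a\<close> the Laplace transform of \<open>d\<close> is the Fourier transform of
\<open>exp (- a * v) * d v\<close>; continuity turns almost everywhere into everywhere.\<close>

lemma laplace_injective:
  fixes d :: "real \<Rightarrow> real"
  assumes cont: "continuous_on {0<..} d"
    and int: "\<And>k. Re k = a \<Longrightarrow> set_integrable lborel {0<..} (\<lambda>v. exp (- k * of_real v) * of_real (d v))"
    and zero: "\<And>k. Re k = a \<Longrightarrow> (LINT v:{0<..}|lborel. exp (- k * of_real v) * of_real (d v)) = 0"
    and "v > 0"
  shows "d v = 0"
proof (rule ccontr)
  assume nz: "d v \<noteq> 0"
  define g where "g x = indicator {0<..} x * (exp (- a * x) * d x)" for x
  have "integrable lborel (\<lambda>x. complex_of_real (g x))"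
    using int[of "of_real a"]
    by (simp add: set_integrable_def g_def exp_of_real[symmetric] scaleR_conv_of_real)
  then have g: "integrable lborel g" by (simp only: complex_of_real_integrable_eq)
  have "(LINT x|lborel. iexp (t * x) * complex_of_real (g x)) = 0" for t
  proof -
    have eq: "iexp (t * x) * complex_of_real (g x)
        = indicator {0<..} x *\<^sub>R (exp (- Complex a (- t) * of_real x) * of_real (d x))" for x
    proof -
      have "iexp (t * x) * complex_of_real (exp (- a * x)) = exp (- Complex a (- t) * of_real x)"
        by (simp add: Complex_eq exp_of_real[symmetric] mult_exp_exp algebra_simps)
      then show ?thesis by (simp add: g_def indicator_def)
    qed
    show ?thesis
      unfolding eq using zero[of "Complex a (- t)"] by (simp add: set_lebesgue_integral_def)
  qed
  from fourier_injective[OF g this] have ae: "AE x in lborel. g x = 0" .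
  define U where "U = {x\<in>{0<..}. d x \<noteq> 0}"
  have "open U"
  proof -
    have "U = {0<..} \<inter> d -` (- {0})" by (auto simp: U_def)
    then show ?thesis using continuous_on_open_vimage[of "{0<..}" d] cont by (metis open_Compl closed_singleton open_greaterThan Int_commute)
  qed
  moreover have "v \<in> U" using nz \<open>v > 0\<close> by (simp add: U_def)
  ultimately obtain e where e: "e > 0" "ball v e \<subseteq> U" by (auto simp: open_contains_ball)
  have "emeasure lborel {x \<in> space lborel. x \<in> ball v e} = 0"
    by (rule emeasure_eq_0_AE) (use ae in \<open>eventually_elim, use e in \<open>auto simp: g_def U_def\<close>\<close>)
  then have "emeasure lborel (ball v e) = 0" by (simp del: mem_ball)
  moreover have "ball v e = {v - e<..<v + e}" by (auto simp: dist_real_def)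
  ultimately show False using e by simp
qed

lemma inverse_laplace_eqI:
  assumes w: "continuous_on {0<..} w" "\<And>v. v \<le> 0 \<Longrightarrow> w v = 0"
    and "\<epsilon> > 0"
    and G: "\<And>k. Re k \<ge> a - \<epsilon> \<Longrightarrow>
           set_integrable lborel {0<..} (\<lambda>v. exp (- k * of_real v) * of_real (w v)) \<and>
           G k = (LINT v:{0<..}|lborel. exp (- k * of_real v) * of_real (w v))"
  shows "inverse_laplace a G = w"
  unfolding inverse_laplace_def
proof (rule the_equality, use assms in blast, elim conjE exE)
  fix w' \<epsilon>' assume w': "continuous_on {0<..} w'" "\<forall>v\<le>0. w' v = 0" "0 < \<epsilon>'"
    and G': "\<forall>k. Re k \<ge> a - \<epsilon>' \<longrightarrow>
           set_integrable lborel {0<..} (\<lambda>v. exp (- k * of_real v) * of_real (w' v)) \<and>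
           G k = (LINT v:{0<..}|lborel. exp (- k * of_real v) * of_real (w' v))"
  have "w' v - w v = 0" if "v > 0" for v
  proof (rule laplace_injective[where a = a and d = "\<lambda>v. w' v - w v"])
    show "continuous_on {0<..} (\<lambda>v. w' v - w v)" using w w' by (intro continuous_intros)
    fix k assume k: "Re k = a"
    note GG = G[of k] G'[rule_format, of k]
    show "set_integrable lborel {0<..} (\<lambda>v. exp (- k * of_real v) * of_real (w' v - w v))"
      using GG k \<open>\<epsilon> > 0\<close> \<open>\<epsilon>' > 0\<close> by (auto simp: algebra_simps intro!: set_integral_diff)
    show "(LINT v:{0<..}|lborel. exp (- k * of_real v) * of_real (w' v - w v)) = 0"
      using GG k \<open>\<epsilon> > 0\<close> \<open>\<epsilon>' > 0\<close> by (auto simp: right_diff_distrib set_integral_diff)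
  qed fact
  then show "w' = w" using w w' by (metis eq_iff_diff_eq_0 ext not_le)
qed

section \<open>Damped hyperbolic and trigonometric functions\<close>

text \<open>These are \<open>cosh (c v)\<close> and \<open>sinh (c v) / c\<close> for \<open>c = sqrt d\<close>, written over the reals for every
sign of \<open>d\<close>: the solutions of \<open>f'' = d f\<close> with initial values \<open>(1, 0)\<close> and \<open>(0, 1)\<close>.\<close>

definition cosh_sqrt :: "real \<Rightarrow> real \<Rightarrow> real" where
  "cosh_sqrt d v = (if d \<ge> 0 then cosh (sqrt d * v) else cos (sqrt (- d) * v))"

definition sinh_sqrt :: "real \<Rightarrow> real \<Rightarrow> real" where
  "sinh_sqrt d v = (if d > 0 then sinh (sqrt d * v) / sqrt d
     else if d = 0 then v else sin (sqrt (- d) * v) / sqrt (- d))"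

lemma cosh_sqrt_0 [simp]: "cosh_sqrt d 0 = 1" "cosh_sqrt 0 v = 1"
  and sinh_sqrt_0 [simp]: "sinh_sqrt d 0 = 0"
  by (auto simp: cosh_sqrt_def sinh_sqrt_def)

lemma cosh_sqrt_deriv: "(cosh_sqrt d has_real_derivative d * sinh_sqrt d v) (at v)"
proof (cases "d \<ge> 0")
  case True
  then have "cosh_sqrt d = (\<lambda>v. cosh (sqrt d * v))" by (auto simp: cosh_sqrt_def)
  then show ?thesis using True
    by (auto intro!: derivative_eq_intros simp: sinh_sqrt_def field_simps)
next
  case False
  then have "cosh_sqrt d = (\<lambda>v. cos (sqrt (- d) * v))" by (auto simp: cosh_sqrt_def)
  moreover have "sqrt (- d) * sqrt (- d) = - d" using False by simp
  ultimately show ?thesis using False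
    by (auto intro!: derivative_eq_intros simp: sinh_sqrt_def mult.assoc divide_simps)
qed

lemma sinh_sqrt_deriv: "(sinh_sqrt d has_real_derivative cosh_sqrt d v) (at v)"
proof -
  consider "d > 0" | "d = 0" | "d < 0" by linarith
  then show ?thesis
  proof cases
    case 1
    then have "sinh_sqrt d = (\<lambda>v. sinh (sqrt d * v) / sqrt d)" by (auto simp: sinh_sqrt_def)
    then show ?thesis using 1
      by (auto intro!: derivative_eq_intros simp: cosh_sqrt_def field_simps)
  next
    case 2
    then have "sinh_sqrt d = (\<lambda>v. v)" by (auto simp: sinh_sqrt_def)
    then show ?thesis using 2
      by (auto intro!: derivative_eq_intros simp: cosh_sqrt_def)
  next
    case 3
    then have "sinh_sqrt d = (\<lambda>v. sin (sqrt (- d) * v) / sqrt (- d))" by (auto simp: sinh_sqrt_def)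
    moreover have "sqrt (- d) * sqrt (- d) = - d" using 3 by simp
    ultimately show ?thesis using 3
      by (auto intro!: derivative_eq_intros simp: cosh_sqrt_def mult.assoc)
  qed
qed

lemma continuous_on_cosh_sqrt [continuous_intros]: "continuous_on S (cosh_sqrt d)"
  and continuous_on_sinh_sqrt [continuous_intros]: "continuous_on S (sinh_sqrt d)"
  using cosh_sqrt_deriv sinh_sqrt_deriv
  by (auto intro!: continuous_at_imp_continuous_on DERIV_isCont)

lemma cosh_sqrt_bound:
  assumes "v \<ge> 0"
  shows "\<bar>cosh_sqrt d v\<bar> \<le> exp (sqrt (max d 0) * v)"
proof (cases "d \<ge> 0")
  case True
  then show ?thesis
    using assms by (auto simp: cosh_sqrt_def cosh_def mult_nonneg_nonneg)
next
  case False
  have "\<bar>cos (sqrt (- d) * v)\<bar> \<le> 1" by simp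
  then show ?thesis using False assms by (simp add: cosh_sqrt_def max_def)
qed

lemma sinh_sqrt_bound:
  assumes "v \<ge> 0"
  shows "\<bar>sinh_sqrt d v\<bar> \<le> v * exp (sqrt (max d 0) * v)"
proof (cases "v = 0")
  case False
  with assms have "v > 0" by simp
  then obtain z where z: "0 < z" "z < v"
      "sinh_sqrt d v - sinh_sqrt d 0 = (v - 0) * cosh_sqrt d z"
    using MVT2[of 0 v "sinh_sqrt d" "cosh_sqrt d"] sinh_sqrt_deriv by blast
  have "\<bar>cosh_sqrt d z\<bar> \<le> exp (sqrt (max d 0) * z)" using z by (intro cosh_sqrt_bound) auto
  also have "\<dots> \<le> exp (sqrt (max d 0) * v)" using z by (simp add: mult_left_mono)
  finally show ?thesis using z \<open>v > 0\<close> by (simp add: abs_mult)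
qed simp

text \<open>For \<open>d = 0\<close> the second function grows linearly, so half of the gap between \<open>b\<close> and the growth rate
\<open>sqrt (max d 0)\<close> is given away to absorb a factor \<open>v\<close>.\<close>

lemma damped_sqrt_bound:
  assumes "sqrt (max d 0) < b"
  obtains \<delta> B where "\<delta> > 0" "b > \<delta>"
    "\<And>v. v \<ge> 0 \<Longrightarrow> \<bar>exp (- b * v) * cosh_sqrt d v\<bar> \<le> B * exp (- \<delta> * v)"
    "\<And>v. v \<ge> 0 \<Longrightarrow> \<bar>exp (- b * v) * sinh_sqrt d v\<bar> \<le> B * exp (- \<delta> * v)"
proof -
  define g where "g = sqrt (max d 0)"
  define \<delta> where "\<delta> = (b - g) / 2"
  define B where "B = max 1 (1 / \<delta>)"
  have g: "0 \<le> g" "g < b" using assms by (auto simp: g_def)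
  have \<delta>: "\<delta> > 0" "\<delta> < b" "b = g + 2 * \<delta>" using g by (simp_all add: \<delta>_def field_simps)
  have B: "B \<ge> 1" "B \<ge> 1 / \<delta>" by (auto simp: B_def)
  have C: "\<bar>exp (- b * v) * cosh_sqrt d v\<bar> \<le> B * exp (- \<delta> * v)" if "v \<ge> 0" for v
  proof -
    have "\<bar>exp (- b * v) * cosh_sqrt d v\<bar> \<le> exp (- b * v) * exp (g * v)"
      using cosh_sqrt_bound[OF that, of d] by (simp add: abs_mult g_def)
    also have "\<dots> = exp (- (2 * \<delta>) * v)" by (simp add: mult_exp_exp \<delta>(3) algebra_simps)
    also have "\<dots> \<le> 1 * exp (- \<delta> * v)" using that \<delta> by simp
    also have "\<dots> \<le> B * exp (- \<delta> * v)" using B by (intro mult_right_mono) auto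
    finally show ?thesis .
  qed
  have S: "\<bar>exp (- b * v) * sinh_sqrt d v\<bar> \<le> B * exp (- \<delta> * v)" if "v \<ge> 0" for v
  proof -
    have "\<bar>exp (- b * v) * sinh_sqrt d v\<bar> \<le> exp (- b * v) * (v * exp (g * v))"
      using sinh_sqrt_bound[OF that, of d] by (simp add: abs_mult g_def)
    also have "\<dots> = (v * exp (- \<delta> * v)) * exp (- \<delta> * v)" by (simp add: mult_exp_exp \<delta>(3) algebra_simps)
    also have "\<dots> \<le> B * exp (- \<delta> * v)"
    proof (intro mult_right_mono)
      have "\<delta> * v \<le> exp (\<delta> * v)" using exp_ge_add_one_self[of "\<delta> * v"] by linarith
      then have "v \<le> 1 / \<delta> * exp (\<delta> * v)" using \<delta> by (simp add: field_simps)
      also have "\<dots> \<le> B * exp (\<delta> * v)" using B by (intro mult_right_mono) auto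
      finally show "v * exp (- \<delta> * v) \<le> B" by (simp add: exp_minus field_simps)
    qed simp
    finally show ?thesis .
  qed
  from that[OF \<delta>(1,2) C S] show thesis .
qed

text \<open>Both functions span a space that is closed under differentiation, so the antiderivative is found in
it by solving a two by two linear system, whose determinant is \<open>(k + b)\<^sup>2 - d\<close>.\<close>

lemma damped_sqrt_laplace:
  fixes k :: complex
  assumes k: "Re k + b > sqrt (max d 0)"
  shows "set_integrable lborel {0<..} (\<lambda>v. exp (- k * of_real v) * of_real (exp (- b * v) * cosh_sqrt d v))"
    and "set_integrable lborel {0<..} (\<lambda>v. exp (- k * of_real v) * of_real (exp (- b * v) * sinh_sqrt d v))"
    and "(k + of_real b)\<^sup>2 \<noteq> of_real d"
    and "(LINT v:{0<..}|lborel. exp (- k * of_real v) * of_real (exp (- b * v) * cosh_sqrt d v))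
         = (k + of_real b) / ((k + of_real b)\<^sup>2 - of_real d)"
    and "(LINT v:{0<..}|lborel. exp (- k * of_real v) * of_real (exp (- b * v) * sinh_sqrt d v))
         = 1 / ((k + of_real b)\<^sup>2 - of_real d)"
proof -
  define l where "l = k + of_real b"
  have ex: "exp (- k * of_real v) * of_real (exp (- b * v) * h) = exp (- l * of_real v) * of_real h"
    for v h :: real
    by (simp add: l_def exp_of_real[symmetric] mult_exp_exp algebra_simps)
  obtain \<delta> B where \<delta>: "\<delta> > 0" "Re k + b > \<delta>"
    and bC: "\<And>v. v \<ge> 0 \<Longrightarrow> \<bar>exp (- (Re k + b) * v) * cosh_sqrt d v\<bar> \<le> B * exp (- \<delta> * v)"
    and bS: "\<And>v. v \<ge> 0 \<Longrightarrow> \<bar>exp (- (Re k + b) * v) * sinh_sqrt d v\<bar> \<le> B * exp (- \<delta> * v)"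
    using damped_sqrt_bound[OF k] by blast
  have nrm: "norm (exp (- l * of_real v) * of_real h) = \<bar>exp (- (Re k + b) * v) * h\<bar>" for v h :: real
    by (simp add: norm_mult l_def abs_mult)
  show iC: "set_integrable lborel {0<..} (\<lambda>v. exp (- k * of_real v) * of_real (exp (- b * v) * cosh_sqrt d v))"
    unfolding ex using bC \<delta>
    by (intro set_integrable_exp_bound[where \<delta> = \<delta> and B = B] continuous_intros) (simp_all only: nrm less_imp_le)
  show iS: "set_integrable lborel {0<..} (\<lambda>v. exp (- k * of_real v) * of_real (exp (- b * v) * sinh_sqrt d v))"
    unfolding ex using bS \<delta>
    by (intro set_integrable_exp_bound[where \<delta> = \<delta> and B = B] continuous_intros) (simp_all only: nrm less_imp_le)
  show nz: "(k + of_real b)\<^sup>2 \<noteq> of_real d"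
  proof
    assume "(k + of_real b)\<^sup>2 = of_real d"
    then have re: "(Re k + b)\<^sup>2 - (Im k)\<^sup>2 = d" and im: "(Re k + b) * Im k = 0"
      by (auto simp: complex_eq_iff power2_eq_square)
    have pos: "Re k + b > 0" using k by (smt (verit) real_sqrt_ge_zero max.cobounded2)
    with im have "Im k = 0" by auto
    with re have "d = (Re k + b)\<^sup>2" by simp
    then have "sqrt (max d 0) = Re k + b" using pos by simp
    with k show False by simp
  qed
  have ld: "l\<^sup>2 - of_real d \<noteq> 0" using nz by (simp add: l_def)
  have dC: "((\<lambda>v. complex_of_real (cosh_sqrt d v)) has_vector_derivative of_real (d * sinh_sqrt d v)) (at v)" for v
    by (rule has_vector_derivative_of_real[OF cosh_sqrt_deriv])
  have dS: "((\<lambda>v. complex_of_real (sinh_sqrt d v)) has_vector_derivative of_real (cosh_sqrt d v)) (at v)" for v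
    by (rule has_vector_derivative_of_real[OF sinh_sqrt_deriv])
  have dE: "((\<lambda>v. exp (- l * of_real v)) has_vector_derivative (- l * exp (- l * of_real v))) (at v)" for v
  proof -
    have "((\<lambda>z. exp (- l * z)) has_field_derivative (- l * exp (- l * of_real v))) (at (of_real v))"
      by (auto intro!: derivative_eq_intros)
    then show ?thesis by (rule has_vector_derivative_real_field)
  qed
  have lim0: "((\<lambda>v. exp (- l * of_real v) * of_real (h v)) \<longlongrightarrow> (0::complex)) at_top"
    if "\<And>v. v \<ge> 0 \<Longrightarrow> \<bar>exp (- (Re k + b) * v) * h v\<bar> \<le> B * exp (- \<delta> * v)" for h
  proof (rule Lim_null_comparison)
    show "\<forall>\<^sub>F v in at_top. norm (exp (- l * of_real v) * complex_of_real (h v)) \<le> B * exp (- \<delta> * v)"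
      using eventually_ge_at_top[of 0] by eventually_elim (use that in \<open>simp only: nrm\<close>)
    show "((\<lambda>v. B * exp (- \<delta> * v)) \<longlongrightarrow> 0) at_top"
      using \<open>\<delta> > 0\<close> by real_asymp
  qed
  \<comment> \<open>an antiderivative with free coefficients \<open>a\<close> and \<open>e\<close>, to be chosen below\<close>
  have E: "(LINT v:{0<..}|lborel. exp (- l * of_real v)
      * ((e - l * a) * of_real (cosh_sqrt d v) + (a * of_real d - l * e) * of_real (sinh_sqrt d v))) = - a" for a e
  proof -
    define F where "F v = exp (- l * of_real v) * (a * of_real (cosh_sqrt d v) + e * of_real (sinh_sqrt d v))" for v
    have "(LINT v:{0<..}|lborel. exp (- l * of_real v)
      * ((e - l * a) * of_real (cosh_sqrt d v) + (a * of_real d - l * e) * of_real (sinh_sqrt d v))) = - F 0"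
    proof (rule FTC_Ioi)
      fix v :: real
      have "(F has_vector_derivative exp (- l * of_real v) * (a * of_real (d * sinh_sqrt d v) + e * of_real (cosh_sqrt d v))
          + (- l * exp (- l * of_real v)) * (a * of_real (cosh_sqrt d v) + e * of_real (sinh_sqrt d v))) (at v)"
        unfolding F_def[abs_def]
        by (intro has_vector_derivative_mult dE has_vector_derivative_add has_vector_derivative_mult_right dC dS)
      then show "(F has_vector_derivative exp (- l * of_real v)
          * ((e - l * a) * of_real (cosh_sqrt d v) + (a * of_real d - l * e) * of_real (sinh_sqrt d v))) (at v)"
        by (simp add: algebra_simps)
      show "continuous_on {0<..} (\<lambda>v. exp (- l * complex_of_real v)
          * ((e - l * a) * of_real (cosh_sqrt d v) + (a * of_real d - l * e) * of_real (sinh_sqrt d v)))"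
        by (intro continuous_intros)
      have "set_integrable lborel {0<..} (\<lambda>v. (e - l * a) * (exp (- l * of_real v) * of_real (cosh_sqrt d v))
          + (a * of_real d - l * e) * (exp (- l * of_real v) * of_real (sinh_sqrt d v)))"
        using iC iS by (intro set_integral_add(1) set_integrable_mult_right impI) (simp_all only: ex)
      then show "set_integrable lborel {0<..} (\<lambda>v. exp (- l * complex_of_real v)
          * ((e - l * a) * of_real (cosh_sqrt d v) + (a * of_real d - l * e) * of_real (sinh_sqrt d v)))"
        by (simp add: distrib_left mult.left_commute)
      have "((\<lambda>v. a * (exp (- l * of_real v) * of_real (cosh_sqrt d v))
          + e * (exp (- l * of_real v) * of_real (sinh_sqrt d v))) \<longlongrightarrow> a * 0 + e * 0) at_top"
        by (intro tendsto_intros lim0 bC bS)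
      then show "(F \<longlongrightarrow> 0) at_top"
        by (simp add: F_def[abs_def] distrib_left mult.left_commute)
    qed
    then show ?thesis by (simp add: F_def)
  qed
  show "(LINT v:{0<..}|lborel. exp (- k * of_real v) * of_real (exp (- b * v) * cosh_sqrt d v))
         = (k + of_real b) / ((k + of_real b)\<^sup>2 - of_real d)"
  proof -
    define a e where "a = - l / (l\<^sup>2 - of_real d)" and "e = - of_real d / (l\<^sup>2 - of_real d)"
    have "e - l * a = 1" "a * of_real d - l * e = 0" "- a = l / (l\<^sup>2 - of_real d)"
      using ld by (simp_all add: a_def e_def divide_simps power2_eq_square)
    with E[of e a] show ?thesis by (simp only: ex) (simp add: l_def)
  qed
  show "(LINT v:{0<..}|lborel. exp (- k * of_real v) * of_real (exp (- b * v) * sinh_sqrt d v))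
         = 1 / ((k + of_real b)\<^sup>2 - of_real d)"
  proof -
    define a e where "a = - 1 / (l\<^sup>2 - of_real d)" and "e = - l / (l\<^sup>2 - of_real d)"
    have "e - l * a = 0" "a * of_real d - l * e = 1" "- a = 1 / (l\<^sup>2 - of_real d)"
      using ld by (simp_all add: a_def e_def divide_simps power2_eq_square)
    with E[of e a] show ?thesis by (simp only: ex) (simp add: l_def)
  qed
qed

section \<open>The function H in dimensions four and six\<close>

lemma eventually_not_nonpos_Ints:
  "\<forall>\<^sub>F k' in at (k::complex). k' + c \<notin> \<int>\<^sub>\<le>\<^sub>0"
proof (cases "k + c \<in> \<int>\<^sub>\<le>\<^sub>0")
  case True
  have "k' + c \<notin> \<int>\<^sub>\<le>\<^sub>0" if "k' \<noteq> k" "dist k' k < 1" for k'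
  proof
    assume "k' + c \<in> \<int>\<^sub>\<le>\<^sub>0"
    then obtain m where m: "k' + c = of_int m" by (rule nonpos_Ints_cases)
    from True obtain n where n: "k + c = of_int n" by (rule nonpos_Ints_cases)
    have "k' - k = (k' + c) - (k + c)" by simp
    then have d: "k' - k = of_int (m - n)" by (simp only: m n of_int_diff)
    have "real_of_int \<bar>m - n\<bar> < 1"
      using that(2) unfolding dist_norm d norm_of_int of_int_abs .
    then have "m = n" by linarith
    with d that(1) show False by simp
  qed
  then show ?thesis unfolding eventually_at by (intro exI[of _ 1]) auto
next
  case False
  have "open (- \<int>\<^sub>\<le>\<^sub>0 :: complex set)" by (intro open_Compl closed_nonpos_Ints)
  moreover have "((\<lambda>k'. k' + c) \<longlongrightarrow> k + c) (at k)" by (intro tendsto_intros)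
  ultimately show ?thesis
    using False topological_tendstoD[of "\<lambda>k'. k' + c" "k + c" "at k" "- \<int>\<^sub>\<le>\<^sub>0"] by auto
qed

text \<open>The reciprocal of the Gamma function is entire.  A continuous function that agrees with
\<open>F_n / \<Gamma>\<close> off the poles therefore gives the limit at the poles as well.\<close>

lemma f_n_eqI:
  assumes "\<And>k. k + of_nat n / 2 \<notin> \<int>\<^sub>\<le>\<^sub>0 \<Longrightarrow> F_n n k z * rGamma (k + of_nat n / 2) = g k"
    and "isCont g k"
  shows "f_n n z k = g k"
proof (cases "k + of_nat n / 2 \<in> \<int>\<^sub>\<le>\<^sub>0")
  case True
  have "((\<lambda>k'. F_n n k' z / Gamma (k' + of_nat n / 2)) \<longlongrightarrow> g k) (at k)"
  proof (rule Lim_transform_eventually)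
    show "(g \<longlongrightarrow> g k) (at k)" using assms(2) by (simp add: isCont_def)
    show "\<forall>\<^sub>F k' in at k. g k' = F_n n k' z / Gamma (k' + of_nat n / 2)"
      using eventually_not_nonpos_Ints[of "of_nat n / 2" k]
      by eventually_elim (simp only: assms(1)[symmetric] rGamma_inverse_Gamma divide_inverse not_False_eq_True)
  qed
  then show ?thesis using True by (simp add: f_n_def tendsto_Lim)
next
  case False
  then show ?thesis
    unfolding assms(1)[OF False, symmetric] by (simp only: f_n_def rGamma_inverse_Gamma divide_inverse if_False)
qed

text \<open>The hypergeometric series stops after the linear term, since its second parameter is \<open>-1\<close>.\<close>

lemma F_n_4:
  assumes "k + 2 \<noteq> 0"
  shows "F_n 4 k z = (k * (1 - of_real z) + 2) / (k + 2)"
proof -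
  have "F_n 4 k z = (\<Sum>j<2. pochhammer k j * pochhammer (-1) j / (pochhammer (k + 2) j * fact j) * of_real z ^ j)"
    unfolding F_n_def gauss_F_def rho_def
    by (subst suminf_finite[of "{..<2}"])
      (auto simp: pochhammer_of_nat_eq_0_lemma[of 1, simplified])
  also have "\<dots> = 1 - k * of_real z / (k + 2)"
    by (simp add: numeral_2_eq_2)
  also have "\<dots> = (k * (1 - of_real z) + 2) / (k + 2)"
    using assms by (simp add: diff_divide_eq_iff algebra_simps)
  finally show ?thesis .
qed

lemma rGamma_plus2: "rGamma (k + 2) = (k + 2) * rGamma (k + 3)" for k :: complex
  using rGamma_plus1[of "k + 2"] by (simp add: add.commute add.left_commute)

text \<open>The denominator \<open>k + 2\<close> of \<open>F_n\<close> is absorbed by \<open>\<Gamma>(k + 3) = (k + 2) \<Gamma>(k + 2)\<close>.\<close>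

lemma f_n_4: "f_n 4 z k = (k * (1 - of_real z) + 2) * rGamma (k + 3)"
proof -
  have cont: "isCont (\<lambda>k. (k * (1 - of_real z) + 2) * rGamma (k + 3)) k"
    by (intro isCont_mult isCont_add isCont_rGamma isCont_diff continuous_ident continuous_const)
  have h: "of_nat 4 / 2 = (2::complex)" by simp
  have eq: "F_n 4 k z * rGamma (k + of_nat 4 / 2) = (k * (1 - of_real z) + 2) * rGamma (k + 3)"
    if "k + of_nat 4 / 2 \<notin> \<int>\<^sub>\<le>\<^sub>0" for k
  proof -
    have nz: "k + 2 \<noteq> 0"
    proof
      assume "k + 2 = 0"
      with that show False unfolding h by (simp only: zero_in_nonpos_Ints not_True_eq_False)
    qed
    have clear: "A / u * (u * R) = A * R" if "u \<noteq> 0" for A u R :: complex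
      using that by simp
    show ?thesis
      unfolding F_n_4[OF nz] h rGamma_plus2 by (rule clear[OF nz])
  qed
  show ?thesis
    by (rule f_n_eqI[where n = 4 and z = z and g = "\<lambda>k. (k * (1 - of_real z) + 2) * rGamma (k + 3)", OF eq cont])
qed

lemma F_n_6:
  assumes nz: "k + 3 \<noteq> 0" "k + 4 \<noteq> 0"
  shows "F_n 6 k z * ((k + 3) * (k + 4))
      = (1 - of_real z)\<^sup>2 * k\<^sup>2 + (1 - of_real z) * (7 - of_real z) * k + 12"
proof -
  have "F_n 6 k z = (\<Sum>j<3. pochhammer k j * pochhammer (-2) j / (pochhammer (k + 3) j * fact j) * of_real z ^ j)"
    unfolding F_n_def gauss_F_def rho_def
    by (subst suminf_finite[of "{..<3}"])
      (auto simp: pochhammer_of_nat_eq_0_lemma[of 2, simplified])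
  also have "\<dots> = 1 - 2 * k * of_real z / (k + 3) + k * (k + 1) * of_real z ^ 2 / ((k + 3) * (k + 4))"
  proof -
    have p: "pochhammer a 2 = a * (a + 1)" for a :: complex
      by (simp add: numeral_2_eq_2 pochhammer_Suc)
    have four: "k + 3 + 1 = k + 4" by simp
    have two: "pochhammer (- 2) 2 = (2 :: complex)" by (simp add: p)
    have half: "A * 2 / (B * 2) * C = A * C / B" for A B C :: complex by simp
    have "(\<Sum>j<3. g j) = g 0 + g 1 + g 2" for g :: "nat \<Rightarrow> complex"
      by (simp add: numeral_3_eq_3 numeral_2_eq_2)
    then show ?thesis by (simp only: p two four fact_2 half) simp
  qed
  finally have F: "F_n 6 k z = 1 - 2 * k * of_real z / (k + 3) + k * (k + 1) * of_real z ^ 2 / ((k + 3) * (k + 4))" .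
  have clear: "(1 - A / u + B / (u * v)) * (u * v) = u * v - A * v + B"
    if "u \<noteq> 0" "v \<noteq> 0" for A B u v :: complex
    using that by (simp add: field_simps)
  show ?thesis
    unfolding F clear[OF nz] by (simp add: algebra_simps power2_eq_square)
qed

lemma f_n_6: "f_n 6 z k =
  ((1 - of_real z)\<^sup>2 * k\<^sup>2 + (1 - of_real z) * (7 - of_real z) * k + 12) * rGamma (k + 5)"
proof -
  have cont: "isCont (\<lambda>k. ((1 - of_real z)\<^sup>2 * k\<^sup>2 + (1 - of_real z) * (7 - of_real z) * k + 12) * rGamma (k + 5)) k"
    by (intro isCont_mult isCont_add isCont_rGamma isCont_diff isCont_power continuous_ident continuous_const)
  have h: "of_nat 6 / 2 = (3::complex)" by simp
  have eq: "F_n 6 k z * rGamma (k + of_nat 6 / 2) =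
    ((1 - of_real z)\<^sup>2 * k\<^sup>2 + (1 - of_real z) * (7 - of_real z) * k + 12) * rGamma (k + 5)"
    if "k + of_nat 6 / 2 \<notin> \<int>\<^sub>\<le>\<^sub>0" for k
  proof -
    have nz: "k + 3 \<noteq> 0"
      using that unfolding h by (metis zero_in_nonpos_Ints)
    have nz': "k + 4 \<noteq> 0"
    proof
      assume "k + 4 = 0"
      then have "k + 3 = - of_nat 1" by (simp add: eq_neg_iff_add_eq_0 add.assoc)
      then have "k + 3 \<in> \<int>\<^sub>\<le>\<^sub>0" by (simp only: minus_of_nat_in_nonpos_Ints)
      with that show False unfolding h by blast
    qed
    have "rGamma (k + 3) = ((k + 3) * (k + 4)) * rGamma (k + 5)"
    proof -
      have "k + 3 + 1 = k + 4" "k + 4 + 1 = k + 5" by simp_all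
      then show ?thesis using rGamma_plus1[of "k + 3"] rGamma_plus1[of "k + 4"] by (simp only: mult.assoc)
    qed
    then show ?thesis
      unfolding h F_n_6[OF nz nz', symmetric] by (simp only: mult.assoc)
  qed
  show ?thesis
    by (rule f_n_eqI[where n = 6 and z = z and g = "\<lambda>k. ((1 - of_real z)\<^sup>2 * k\<^sup>2 + (1 - of_real z) * (7 - of_real z) * k + 12) * rGamma (k + 5)", OF eq cont])
qed

lemma rGamma_nonzero_Re_pos: "Re z > 0 \<Longrightarrow> rGamma z \<noteq> 0"
  by (auto simp: rGamma_eq_zero_iff elim!: nonpos_Ints_cases)

text \<open>For \<open>Re k > -3\<close> the factors \<open>1/\<Gamma>(k + 3)\<close> cancel in \<open>f_n 4 q k / f_n 4 s k\<close>.  The terms that are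
subtracted in the definition of \<open>H\<close> are the part of this rational function that does not vanish as
\<open>k\<close> tends to infinity, so a constant over a linear function remains.\<close>

lemma H_n_4:
  assumes "q < s" "s < 1" "Re k > -3" "k + of_real (2 / (1 - s)) \<noteq> 0"
  shows "H_n 4 q s k = of_real (2 * (1 + s) / (1 - s)) / (k + of_real (2 / (1 - s)))"
proof -
  define u w e where "u = complex_of_real (1 - s)" and "w = complex_of_real (1 - q)"
    and "e = complex_of_real (s - q)"
  have nz: "u \<noteq> 0" "w \<noteq> 0" "e \<noteq> 0"
    using assms(1,2) unfolding u_def w_def e_def of_real_eq_0_iff by linarith+
  have ew: "e = w - u" by (simp add: e_def w_def u_def)
  define M N where "M = k * w + 2" and "N = k * u + 2"
  have ku: "k + of_real (2 / (1 - s)) = N / u"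
  proof -
    have "complex_of_real (2 / (1 - s)) = 2 / u" by (simp add: u_def)
    then show ?thesis using nz(1) by (simp add: N_def add_divide_distrib)
  qed
  have N: "N \<noteq> 0" using assms(4) nz(1) unfolding ku by (metis div_0)
  have "rGamma (k + 3) \<noteq> 0" using assms by (intro rGamma_nonzero_Re_pos) simp
  then have f: "f_n 4 q k / f_n 4 s k = M / N"
    by (simp add: f_n_4 M_def N_def u_def w_def)
  have "rho 4 = 1" by (simp add: rho_def)
  then have "H_n 4 q s k = u\<^sup>2 / e * ((k + 1) * (M / N) - w / u * (k + 1 - 2 * (e / (u * w))))"
    unfolding H_n_def f using assms by (simp add: u_def w_def e_def)
  also have "\<dots> = (u\<^sup>2 * (k + 1) * M - (w * u * (k + 1) - 2 * e) * N) / (e * N)"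
    using nz N by (simp add: field_simps power2_eq_square)
  also have "u\<^sup>2 * (k + 1) * M - (w * u * (k + 1) - 2 * e) * N = e * (2 * (2 - u))"
    unfolding M_def N_def ew by (simp add: algebra_simps power2_eq_square)
  also have "e * (2 * (2 - u)) / (e * N) = (2 * (2 - u) / u) / (N / u)"
    using nz by simp
  also have "2 * (2 - u) / u = of_real (2 * (1 + s) / (1 - s))"
    by (simp add: u_def)
  finally show ?thesis unfolding ku .
qed

text \<open>As in dimension four; the denominator is the quadratic \<open>(1-s)\<^sup>2 k\<^sup>2 + (1-s) (7-s) k + 12\<close>, written
as \<open>(1-s)\<^sup>2 ((k + b)\<^sup>2 - d)\<close>.\<close>

lemma H_n_6:
  fixes q s :: real
  defines "b \<equiv> (7 - s) / (2 * (1 - s))" and "d \<equiv> (s\<^sup>2 - 14 * s + 1) / (4 * (1 - s)\<^sup>2)"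
  assumes "q < s" "s < 1" "Re k > -5" "(k + of_real b)\<^sup>2 \<noteq> of_real d"
  shows "H_n 6 q s k = (of_real (3 * (1 - s * q + 3 * (s - q))) * (k + of_real b)
      + of_real (3 / 2 * (1 + s * q + 5 * (s + q)))) / ((k + of_real b)\<^sup>2 - of_real d)"
proof -
  define u w e where "u = complex_of_real (1 - s)" and "w = complex_of_real (1 - q)"
    and "e = complex_of_real (s - q)"
  have nz: "u \<noteq> 0" "w \<noteq> 0" "e \<noteq> 0"
    using assms(3,4) unfolding u_def w_def e_def of_real_eq_0_iff by linarith+
  have ew: "e = w - u" by (simp add: e_def w_def u_def)
  define M N where "M = w\<^sup>2 * k\<^sup>2 + w * (6 + w) * k + 12" and "N = u\<^sup>2 * k\<^sup>2 + u * (6 + u) * k + 12"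
  have b: "of_real b = (6 + u) / (2 * u)" by (simp add: b_def u_def)
  have d: "of_real d = (u\<^sup>2 + 12 * u - 12) / (4 * u\<^sup>2)"
    by (simp add: d_def u_def power2_eq_square algebra_simps)
  have den: "(k + of_real b)\<^sup>2 - of_real d = N / u\<^sup>2"
    unfolding b d N_def using nz(1) by (simp add: field_simps power2_eq_square)
  have N: "N \<noteq> 0" using assms(6) den by auto
  have "rGamma (k + 5) \<noteq> 0" using assms by (intro rGamma_nonzero_Re_pos) simp
  then have f: "f_n 6 q k / f_n 6 s k = M / N"
    by (simp add: f_n_6 M_def N_def u_def w_def)
  have "rho 6 = 2" by (simp add: rho_def)
  then have "H_n 6 q s k = u ^ 4 / e * ((k + 2) / 2 * (M / N)
      - (w / u)\<^sup>2 * ((k + 2) / 2 - 3 * (e / (u * w))))"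
    unfolding H_n_def f using assms(3,4) by (simp add: u_def w_def e_def)
  also have "\<dots> = (u ^ 4 * (k + 2) * M - (w * u * (w * u * (k + 2) - 6 * e)) * N) / (2 * e * N)"
    using nz N by (simp add: field_simps eval_nat_numeral)
  also have "u ^ 4 * (k + 2) * M - (w * u * (w * u * (k + 2) - 6 * e)) * N
    = e * (u * (3 * (4 * w - 2 * u - u * w) * (2 * u * k + 6 + u)
        + 3 * u * (12 - 6 * u - 6 * w + u * w)))"
    unfolding M_def N_def ew by algebra
  also have "e * (u * (3 * (4 * w - 2 * u - u * w) * (2 * u * k + 6 + u)
        + 3 * u * (12 - 6 * u - 6 * w + u * w))) / (2 * e * N)
    = (3 * (4 * w - 2 * u - u * w) * (k + (6 + u) / (2 * u)) + 3 / 2 * (12 - 6 * u - 6 * w + u * w)) / (N / u\<^sup>2)"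
    using nz N by (simp add: field_simps power2_eq_square)
  also have "4 * w - 2 * u - u * w = of_real (1 - s * q + 3 * (s - q))"
    by (simp add: u_def w_def algebra_simps)
  also have "12 - 6 * u - 6 * w + u * w = of_real (1 + s * q + 5 * (s + q))"
    by (simp add: u_def w_def algebra_simps)
  finally show ?thesis unfolding den by (simp add: b)
qed

lemma w_n_4:
  assumes "q < s" "0 < s" "s < 1" "v > 0"
  shows "w_n 4 q s v = 2 * (1 + s) / (1 - s) * exp (- (2 * v / (1 - s)))"
proof -
  define a where "a = 2 / (1 - s)"
  define \<alpha> where "\<alpha> = 2 * (1 + s) / (1 - s)"
  define w where "w v = (if v > 0 then \<alpha> * (exp (- a * v) * cosh_sqrt 0 v) else 0)" for v
  have a: "a > 2" using assms by (simp add: a_def field_simps)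
  have "inverse_laplace (- real 4 / 2) (H_n 4 q s) = w"
  proof (rule inverse_laplace_eqI)
    have "continuous_on {0<..} (\<lambda>v. \<alpha> * (exp (- a * v) * cosh_sqrt 0 v))"
      by (intro continuous_intros)
    then show "continuous_on {0<..} w"
      by (rule continuous_on_eq) (simp add: w_def)
    \<comment> \<open>small enough to stay to the right of the pole \<open>- a\<close> and of \<open>-3\<close>, where \<open>1/\<Gamma>(k + 3)\<close> vanishes\<close>
    show "min 1 (a - 2) / 2 > 0" using a by simp
    fix k :: complex assume k: "Re k \<ge> - real 4 / 2 - min 1 (a - 2) / 2"
    from k have "Re k \<ge> - 2 - min 1 (a - 2) / 2" by simp
    moreover have "min 1 (a - 2) \<le> 1" "min 1 (a - 2) \<le> a - 2" by simp_all
    ultimately have ka: "Re k + a > 0" "Re k > -3"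
      using a by (auto simp: field_simps)
    note L = damped_sqrt_laplace[of 0 k a]
    have ww: "indicator {0<..} v *\<^sub>R (exp (- k * of_real v) * of_real (w v)) = indicator {0<..} v *\<^sub>R
       (of_real \<alpha> * (exp (- k * of_real v) * of_real (exp (- a * v) * cosh_sqrt 0 v)))" for v
      by (auto simp: w_def indicator_def)
    have "k + of_real a \<noteq> 0" using ka by (auto simp: complex_eq_iff)
    then have "H_n 4 q s k = of_real \<alpha> / (k + of_real a)"
      using ka assms unfolding a_def \<alpha>_def by (intro H_n_4) auto
    moreover have "set_integrable lborel {0<..} (\<lambda>v. exp (- k * of_real v) * of_real (w v))"
      unfolding set_integrable_def ww using ka
      by (intro set_integrable_mult_right[unfolded set_integrable_def] impI L(1)[unfolded set_integrable_def]) simp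
    moreover have "(LINT v:{0<..}|lborel. exp (- k * of_real v) * of_real (w v)) = of_real \<alpha> / (k + of_real a)"
      unfolding set_lebesgue_integral_def ww
      using L(4) ka unfolding set_lebesgue_integral_def[symmetric] by (simp add: power2_eq_square)
    ultimately show "set_integrable lborel {0<..} (\<lambda>v. exp (- k * of_real v) * of_real (w v)) \<and>
        H_n 4 q s k = (LINT v:{0<..}|lborel. exp (- k * of_real v) * of_real (w v))" by simp
  qed (simp add: w_def)
  then show ?thesis using assms by (simp add: w_n_def w_def a_def \<alpha>_def)
qed

text \<open>The square of \<open>c6\<close>, which is real even where \<open>c6\<close> is imaginary.\<close>

definition d6 :: "real \<Rightarrow> real" where "d6 r = (r ^ 4 - 14 * r\<^sup>2 + 1) / (4 * (1 - r\<^sup>2)\<^sup>2)"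

text \<open>The rightmost pole of \<open>H_n 6\<close> lies strictly to the left of \<open>-3\<close>.  So the Laplace integral converges on a
half-plane beyond \<open>Re k = -3\<close>, and \<open>w6\<close> can later be integrated against \<open>exp (3 * v)\<close>.\<close>

lemma sqrt_d6_less:
  assumes "0 < r" "r < 1"
  shows "sqrt (max (d6 r) 0) < b6 r - 3"
proof -
  have r: "0 < r\<^sup>2" "r\<^sup>2 < 1" using assms by (auto simp: power_less_one_iff)
  have b: "b6 r - 3 = (1 + 5 * r\<^sup>2) / (2 * (1 - r\<^sup>2))" using r by (simp add: b6_def field_simps)
  have pos: "b6 r - 3 > 0" unfolding b using r by (intro divide_pos_pos) (linarith, simp)
  have "(b6 r - 3)\<^sup>2 - d6 r = (24 * r\<^sup>2 + 24 * r^4) / (4 * (1 - r\<^sup>2)\<^sup>2)"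
  proof -
    have num: "24 * r\<^sup>2 + 24 * r ^ 4 = (1 + 5 * r\<^sup>2)\<^sup>2 - (r ^ 4 - 14 * r\<^sup>2 + 1)"
      by (simp add: power2_eq_square algebra_simps eval_nat_numeral)
    have four: "(2 * (1 - r\<^sup>2))\<^sup>2 = 4 * (1 - r\<^sup>2)\<^sup>2" unfolding power_mult_distrib by simp
    show ?thesis unfolding b d6_def num by (simp only: power_divide four diff_divide_distrib)
  qed
  also have "\<dots> > 0" using r by (auto intro!: divide_pos_pos add_pos_pos)
  finally have "max (d6 r) 0 < (b6 r - 3)\<^sup>2" using pos by simp
  then show ?thesis using pos by (simp add: real_less_lsqrt)
qed

lemma b6_d6:
  assumes "r\<^sup>2 < 1"
  shows "b6 r = 3 / (1 - r\<^sup>2) + 1 / 2" "(b6 r)\<^sup>2 - d6 r = 12 / (1 - r\<^sup>2)\<^sup>2"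
proof -
  define u where "u = 1 - r\<^sup>2"
  have u: "u > 0" and r2: "r\<^sup>2 = 1 - u" using assms by (simp_all add: u_def)
  show b: "b6 r = 3 / (1 - r\<^sup>2) + 1 / 2"
    unfolding b6_def r2 using u by (simp add: field_simps)
  have "r ^ 4 = (r\<^sup>2)\<^sup>2" by simp
  then have "r ^ 4 - 14 * r\<^sup>2 + 1 = u\<^sup>2 + 12 * u - 12"
    unfolding r2 by (simp add: power2_eq_square algebra_simps)
  then have "d6 r = (u\<^sup>2 + 12 * u - 12) / (4 * u\<^sup>2)" unfolding d6_def u_def[symmetric] by simp
  also have "\<dots> = (3 / u + 1 / 2)\<^sup>2 - 12 / u\<^sup>2" using u by (simp add: field_simps power2_eq_square)
  finally show "(b6 r)\<^sup>2 - d6 r = 12 / (1 - r\<^sup>2)\<^sup>2" unfolding b u_def by simp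
qed

lemma sqrt_d6_less_b6: "0 < r \<Longrightarrow> r < 1 \<Longrightarrow> sqrt (max (d6 r) 0) < b6 r"
  using sqrt_d6_less[of r] by linarith

definition w6 :: "real \<Rightarrow> real \<Rightarrow> real \<Rightarrow> real" where
  "w6 q r v = 3 * (1 - r\<^sup>2 * q + 3 * (r\<^sup>2 - q)) * (exp (- b6 r * v) * cosh_sqrt (d6 r) v)
     + 3 / 2 * (1 + r\<^sup>2 * q + 5 * (r\<^sup>2 + q)) * (exp (- b6 r * v) * sinh_sqrt (d6 r) v)"

lemma w6_laplace:
  fixes k :: complex
  assumes "0 < r" "r < 1" "Re k + b6 r > sqrt (max (d6 r) 0)"
  shows "set_integrable lborel {0<..} (\<lambda>v. exp (- k * of_real v) * of_real (w6 q r v))" (is ?A)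
    and "(LINT v:{0<..}|lborel. exp (- k * of_real v) * of_real (w6 q r v))
      = (of_real (3 * (1 - r\<^sup>2 * q + 3 * (r\<^sup>2 - q))) * (k + of_real (b6 r))
      + of_real (3 / 2 * (1 + r\<^sup>2 * q + 5 * (r\<^sup>2 + q)))) / ((k + of_real (b6 r))\<^sup>2 - of_real (d6 r))" (is ?B)
proof -
  define \<alpha> \<beta> where "\<alpha> = 3 * (1 - r\<^sup>2 * q + 3 * (r\<^sup>2 - q))" and "\<beta> = 3 / 2 * (1 + r\<^sup>2 * q + 5 * (r\<^sup>2 + q))"
  note L = damped_sqrt_laplace[OF assms(3)]
  have eq: "exp (- k * of_real v) * of_real (w6 q r v)
     = of_real \<alpha> * (exp (- k * of_real v) * of_real (exp (- b6 r * v) * cosh_sqrt (d6 r) v))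
     + of_real \<beta> * (exp (- k * of_real v) * of_real (exp (- b6 r * v) * sinh_sqrt (d6 r) v))" for v
    unfolding w6_def \<alpha>_def[symmetric] \<beta>_def[symmetric] by (simp add: algebra_simps)
  show ?A unfolding eq by (intro set_integral_add(1) set_integrable_mult_right impI L)
  have "(LINT v:{0<..}|lborel. exp (- k * of_real v) * of_real (w6 q r v))
    = of_real \<alpha> * ((k + of_real (b6 r)) / ((k + of_real (b6 r))\<^sup>2 - of_real (d6 r)))
    + of_real \<beta> * (1 / ((k + of_real (b6 r))\<^sup>2 - of_real (d6 r)))"
    unfolding eq L(4,5)[symmetric] set_integral_mult_right[symmetric]
    by (intro set_integral_add(2) set_integrable_mult_right impI L)
  then show ?B unfolding \<alpha>_def[symmetric] \<beta>_def[symmetric]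
    by (simp only: times_divide_eq_right mult_1_right add_divide_distrib[symmetric])
qed

lemma w_n_6:
  assumes "0 < r" "r < 1" "q < r\<^sup>2" "v > 0"
  shows "w_n 6 q (r\<^sup>2) v = w6 q r v"
proof -
  define w where "w v = (if v > 0 then w6 q r v else 0)" for v
  define e where "e = min 1 (b6 r - 3 - sqrt (max (d6 r) 0)) / 2"
  have r: "0 < r\<^sup>2" "r\<^sup>2 < 1" using assms by (auto simp: power_less_one_iff)
  have "inverse_laplace (- real 6 / 2) (H_n 6 q (r\<^sup>2)) = w"
  proof (rule inverse_laplace_eqI)
    have "continuous_on {0<..} (w6 q r)"
      unfolding w6_def by (intro continuous_intros)
    then show "continuous_on {0<..} w"
      by (rule continuous_on_eq) (simp add: w_def)
    show e: "e > 0" using sqrt_d6_less[OF assms(1,2)] by (simp add: e_def)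
    fix k :: complex assume "Re k \<ge> - real 6 / 2 - e"
    then have "Re k \<ge> - 3 - e" by simp
    moreover have "2 * e \<le> 1" "2 * e \<le> b6 r - 3 - sqrt (max (d6 r) 0)" by (simp_all add: e_def)
    ultimately have k: "Re k + b6 r > sqrt (max (d6 r) 0)" "Re k > -5"
      using e by (auto simp: field_simps)
    note L = w6_laplace[OF assms(1,2) k(1), of q]
    have ww: "indicator {0<..} v *\<^sub>R (exp (- k * of_real v) * of_real (w v))
       = indicator {0<..} v *\<^sub>R (exp (- k * of_real v) * of_real (w6 q r v))" for v
      by (auto simp: w_def indicator_def)
    have "H_n 6 q (r\<^sup>2) k = (of_real (3 * (1 - r\<^sup>2 * q + 3 * (r\<^sup>2 - q))) * (k + of_real (b6 r))
      + of_real (3 / 2 * (1 + r\<^sup>2 * q + 5 * (r\<^sup>2 + q)))) / ((k + of_real (b6 r))\<^sup>2 - of_real (d6 r))"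
      using H_n_6[of q "r\<^sup>2" k] damped_sqrt_laplace(3)[OF k(1)] assms r k
      by (simp add: b6_def d6_def)
    then show "set_integrable lborel {0<..} (\<lambda>v. exp (- k * of_real v) * of_real (w v)) \<and>
        H_n 6 q (r\<^sup>2) k = (LINT v:{0<..}|lborel. exp (- k * of_real v) * of_real (w v))"
      using L unfolding set_integrable_def set_lebesgue_integral_def ww by simp
  qed (simp add: w_def)
  then show ?thesis using assms by (simp add: w_n_def w_def)
qed

lemma w6_eq_w6_1_w6_2:
  assumes "r\<^sup>2 < 1"
  shows "complex_of_real (w6 ((norm x)\<^sup>2) r v) = w6_1 x r v + w6_2 x r v"
proof -
  define t where "t = r ^ 4 - 14 * r\<^sup>2 + 1"
  define u where "u = 2 * (1 - r\<^sup>2)"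
  have u: "u > 0" using assms by (simp add: u_def)
  have d: "d6 r = t / u\<^sup>2" unfolding d6_def t_def u_def power_mult_distrib by simp
  have c: "c6 r = (if t \<ge> 0 then of_real (sqrt t / u) else \<i> * of_real (sqrt (- t) / u))"
    unfolding c6_def t_def[symmetric] u_def[symmetric] csqrt_of_real' by simp
  have e: "exp (\<i> * complex_of_real y) + exp (- (\<i> * complex_of_real y)) = 2 * of_real (cos y)"
    "exp (\<i> * complex_of_real y) - exp (- (\<i> * complex_of_real y)) = 2 * \<i> * of_real (sin y)" for y
    by (auto simp: complex_eq_iff Re_exp Im_exp)
  have co: "cosh (complex_of_real y) = of_real (cosh y)" "sinh (complex_of_real y) = of_real (sinh y)"
    "cosh (\<i> * complex_of_real y) = of_real (cos y)" "sinh (\<i> * complex_of_real y) = \<i> * of_real (sin y)" for y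
    using e by (simp_all add: cosh_def sinh_def exp_of_real[symmetric] scaleR_conv_of_real)
  have sq: "sqrt (d6 r) = sqrt t / u" "sqrt (- d6 r) = sqrt (- t) / u"
    unfolding d minus_divide_left using u by (simp_all only: real_sqrt_divide real_sqrt_abs abs_of_pos)
  have t: "d6 r \<ge> 0 \<longleftrightarrow> t \<ge> 0" "d6 r > 0 \<longleftrightarrow> t > 0" "d6 r = 0 \<longleftrightarrow> t = 0"
    unfolding d using u by (simp_all add: zero_le_divide_iff zero_less_divide_iff)
  have C: "cosh (c6 r * of_real v) = of_real (cosh_sqrt (d6 r) v)"
  proof (cases "t \<ge> 0")
    case True
    then have "c6 r * of_real v = of_real (sqrt t / u * v)" by (simp add: c)
    then show ?thesis using True by (simp only: co cosh_sqrt_def t sq if_True)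
  next
    case False
    then have "c6 r * of_real v = \<i> * of_real (sqrt (- t) / u * v)" by (simp add: c)
    then show ?thesis using False by (simp only: co cosh_sqrt_def t sq if_False)
  qed
  have S: "sinh_over (c6 r) v = of_real (sinh_sqrt (d6 r) v)"
  proof -
    consider "t > 0" | "t = 0" | "t < 0" by linarith
    then show ?thesis
    proof cases
      case 1
      then have "c6 r = of_real (sqrt t / u)" "sqrt t / u \<noteq> 0" using u by (simp_all add: c)
      moreover from this have "c6 r * of_real v = of_real (sqrt t / u * v)" "c6 r \<noteq> 0"
        by (simp_all only: of_real_mult of_real_eq_0_iff not_False_eq_True)
      ultimately show ?thesis
        using 1 by (simp only: sinh_over_def sinh_sqrt_def t sq if_True if_False co of_real_divide)
    next
      case 2
      then show ?thesis by (simp add: c sinh_over_def sinh_sqrt_def t)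
    next
      case 3
      then have "c6 r = \<i> * of_real (sqrt (- t) / u)" "sqrt (- t) / u \<noteq> 0" using u by (simp_all add: c)
      moreover from this have "c6 r * of_real v = \<i> * of_real (sqrt (- t) / u * v)" "c6 r \<noteq> 0"
        by simp_all
      moreover have "\<not> t > 0" "t \<noteq> 0" using 3 by auto
      moreover have "\<i> * A / (\<i> * B) = A / B" for A B by simp
      ultimately show ?thesis
        by (simp only: sinh_over_def sinh_sqrt_def t sq if_False co of_real_divide)
    qed
  qed
  show ?thesis
    by (simp add: w6_def w6_1_def w6_2_def C S algebra_simps)
qed

section \<open>Test functions that depend on two distances\<close>

lemma C2_gradient:
  fixes f :: "real ^ 'n \<Rightarrow> real"
  assumes f: "\<And>x. (f has_derivative (\<lambda>h. G x \<bullet> h)) (at x)"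
    and G: "\<And>x i. ((\<lambda>x. G x $ i) has_derivative (\<lambda>h. H x i \<bullet> h)) (at x)"
    and H: "\<And>i. continuous_on UNIV (\<lambda>x. H x i)"
  shows "C2 f" and "partial i f x = G x $ i" and "partial j (partial i f) x = H x i $ j"
proof -
  have p: "partial i f = (\<lambda>x. G x $ i)" for i
    unfolding partial_def using frechet_derivative_at[OF f, symmetric] by (simp add: inner_axis)
  have p2: "partial j (partial i f) = (\<lambda>x. H x i $ j)" for i j
    unfolding p unfolding partial_def using frechet_derivative_at[OF G, symmetric] by (simp add: inner_axis)
  show "partial i f x = G x $ i" "partial j (partial i f) x = H x i $ j" by (simp add: p, simp only: p2)
  have "continuous_on UNIV (\<lambda>x. G x $ i)" for i
    using G by (auto intro!: continuous_at_imp_continuous_on has_derivative_continuous)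
  then have "continuous_on UNIV (partial i f)" for i by (simp add: p)
  moreover have "f differentiable (at x)" "partial i f differentiable (at x)" for i x
    unfolding p differentiable_def using f G by blast+
  moreover have "continuous_on UNIV (partial j (partial i f))" for i j
    unfolding p2 using H by (intro continuous_intros)
  ultimately show "C2 f" unfolding C2_def C1_def by blast
qed

text \<open>Truncated powers are the building blocks of a cutoff function of class \<open>C\<^sup>2\<close>.\<close>

lemma max_power_deriv:
  "((\<lambda>t::real. max 0 t ^ (n + 2)) has_real_derivative real (n + 2) * max 0 t ^ (n + 1)) (at t)"
proof -
  consider "t > 0" | "t < 0" | "t = 0" by linarith
  then show ?thesis
  proof cases
    case 1
    have "((\<lambda>t::real. t ^ (n + 2)) has_real_derivative real (n + 2) * t ^ (n + 1)) (at t)"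
      using DERIV_pow[of "n + 2" t UNIV] by simp
    then have "((\<lambda>t::real. max 0 t ^ (n + 2)) has_real_derivative real (n + 2) * t ^ (n + 1)) (at t)"
      by (rule has_field_derivative_transform_within_open[where S = "{0<..}"]) (use 1 in auto)
    then show ?thesis using 1 by simp
  next
    case 2
    have "((\<lambda>t::real. 0) has_real_derivative 0) (at t)" by simp
    then have "((\<lambda>t::real. max 0 t ^ (n + 2)) has_real_derivative 0) (at t)"
      by (rule has_field_derivative_transform_within_open[where S = "{..<0}"]) (use 2 in auto)
    then show ?thesis using 2 by simp
  next
    case 3
    have "((\<lambda>h. max 0 h ^ (n + 2) / h) \<longlongrightarrow> 0) (at (0::real))"
    proof (rule Lim_null_comparison)
      show "((\<lambda>h::real. \<bar>h\<bar> ^ (n + 1)) \<longlongrightarrow> 0) (at 0)" by (auto intro!: tendsto_eq_intros)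
      have "norm (max 0 h ^ (n + 2) / h) \<le> \<bar>h\<bar> ^ (n + 1)" if "h \<noteq> 0" for h :: real
        using that by (cases "h > 0") (auto simp: power_add power2_eq_square mult_nonpos_nonneg)
      then show "\<forall>\<^sub>F h in at 0. norm (max 0 h ^ (n + 2) / h) \<le> \<bar>h\<bar> ^ (n + 1)"
        by (auto simp: eventually_at_filter)
    qed
    then show ?thesis using 3 by (simp add: DERIV_def)
  qed
qed

text \<open>The function \<open>1 - (1 - l\<^sup>3)\<^sub>+\<^sup>3\<close>, where \<open>l\<close> is the positive part of the affine function with values
\<open>1\<close> at \<open>a\<close> and \<open>0\<close> at \<open>b\<close>, is of class \<open>C\<^sup>2\<close> on account of the cubes.\<close>

lemma smooth_cutoff:
  fixes a b :: real
  assumes "a < b"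
  obtains bump bump1 bump2 where
    "\<forall>q. (bump has_real_derivative bump1 q) (at q)" "\<forall>q. (bump1 has_real_derivative bump2 q) (at q)"
    "continuous_on UNIV bump2" "\<forall>q\<le>a. bump q = 1 \<and> bump1 q = 0 \<and> bump2 q = 0"
    "\<forall>q\<ge>b. bump q = 0 \<and> bump1 q = 0 \<and> bump2 q = 0"
proof -
  define k where "k = - 1 / (b - a)"
  define l where "l q = (b - q) / (b - a)" for q
  define p where "p q = max 0 (l q) ^ 3" for q
  define p1 where "p1 q = 3 * k * max 0 (l q) ^ 2" for q
  define p2 where "p2 q = 6 * k\<^sup>2 * max 0 (l q)" for q
  define bump where "bump q = 1 - max 0 (1 - p q) ^ 3" for q
  define bump1 where "bump1 q = 3 * max 0 (1 - p q) ^ 2 * p1 q" for q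
  define bump2 where "bump2 q = - 6 * max 0 (1 - p q) * (p1 q)\<^sup>2 + 3 * max 0 (1 - p q) ^ 2 * p2 q" for q
  have m3: "((\<lambda>t::real. max 0 t ^ 3) has_real_derivative 3 * max 0 t ^ 2) (at t)"
    and m2: "((\<lambda>t::real. max 0 t ^ 2) has_real_derivative 2 * max 0 t) (at t)" for t
    using max_power_deriv[of 1 t] max_power_deriv[of 0 t] by (simp_all add: numeral_3_eq_3 numeral_2_eq_2)
  have l: "(l has_real_derivative k) (at q)" for q
    unfolding l_def[abs_def] k_def
    using DERIV_cdivide[OF DERIV_diff[OF DERIV_const DERIV_ident]]
    by (metis diff_0)
  have p: "(p has_real_derivative p1 q) (at q)" for q
    unfolding p_def[abs_def] p1_def using DERIV_chain2[OF m3 l] by (simp add: ac_simps)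
  have p1: "(p1 has_real_derivative p2 q) (at q)" for q
    unfolding p1_def[abs_def] p2_def using DERIV_cmult[OF DERIV_chain2[OF m2 l], of "3 * k" q]
    by (simp add: ac_simps power2_eq_square)
  have np: "((\<lambda>q. 1 - p q) has_real_derivative - p1 q) (at q)" for q
    using DERIV_diff[OF DERIV_const p] by simp
  have "(bump has_real_derivative bump1 q) (at q)" for q
      unfolding bump_def[abs_def] bump1_def using DERIV_diff[OF DERIV_const DERIV_chain2[OF m3 np]] by simp
  moreover have "(bump1 has_real_derivative bump2 q) (at q)" for q
      unfolding bump1_def[abs_def] bump2_def
      using DERIV_mult[OF DERIV_cmult[OF DERIV_chain2[OF m2 np], of 3 q] p1]
      by (simp add: algebra_simps power2_eq_square)
  moreover have "continuous_on UNIV bump2"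
  proof -
    have "continuous_on UNIV l" unfolding l_def[abs_def] using assms by (intro continuous_intros) auto
    then show ?thesis
      unfolding bump2_def[abs_def] p_def p1_def p2_def by (intro continuous_intros)
  qed
  moreover have "bump q = 1 \<and> bump1 q = 0 \<and> bump2 q = 0" if "q \<le> a" for q
    proof -
      have "l q \<ge> 1" using that assms by (simp add: l_def field_simps)
      then have "p q \<ge> 1" by (simp add: p_def one_le_power)
      then have "max 0 (1 - p q) = 0" by simp
      then show ?thesis by (simp add: bump_def bump1_def bump2_def)
    qed
  moreover have "bump q = 0 \<and> bump1 q = 0 \<and> bump2 q = 0" if "q \<ge> b" for q
    proof -
      have "l q \<le> 0" using that assms by (simp add: l_def field_simps)
      then have "max 0 (l q) = 0" by simp
      then show ?thesis by (simp add: bump_def bump1_def bump2_def p_def p1_def p2_def)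
    qed
  ultimately show thesis by (intro that[of bump bump1 bump2]) blast+
qed

text \<open>Total differentiability in the two variables, with both partial derivatives named; second partial
derivatives are then expressed by the same predicate.\<close>

definition has_partials :: "(real \<Rightarrow> real \<Rightarrow> real) \<Rightarrow> real \<Rightarrow> real \<Rightarrow> real \<Rightarrow> real \<Rightarrow> bool" where
  "has_partials \<Phi> a b q D \<longleftrightarrow>
     ((\<lambda>p. \<Phi> (fst p) (snd p)) has_derivative (\<lambda>h. a * fst h + b * snd h)) (at (q, D))"

lemma has_partials_two_distances:
  fixes x z :: "'a::real_inner"
  assumes "has_partials \<Phi> a b (x \<bullet> x) ((x - z) \<bullet> (x - z))"
  shows "((\<lambda>x. \<Phi> (x \<bullet> x) ((x - z) \<bullet> (x - z))) has_derivative
    (\<lambda>h. ((2 * a) *\<^sub>R x + (2 * b) *\<^sub>R (x - z)) \<bullet> h)) (at x)"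
proof -
  have "((\<lambda>x. (x \<bullet> x, (x - z) \<bullet> (x - z))) has_derivative (\<lambda>h. (2 * (x \<bullet> h), 2 * ((x - z) \<bullet> h)))) (at x)"
    by (auto intro!: derivative_eq_intros simp: inner_commute)
  from has_derivative_compose[OF this assms[unfolded has_partials_def]] show ?thesis
    by (simp add: inner_add_left algebra_simps)
qed

lemma has_partials_mult_left:
  assumes "(bump has_real_derivative bump1) (at q)" and "has_partials \<Phi> a b q D"
  shows "has_partials (\<lambda>q D. bump q * \<Phi> q D) (bump1 * \<Phi> q D + bump q * a) (bump q * b) q D"
proof -
  have "((\<lambda>p. bump (fst p)) has_derivative (\<lambda>h. bump1 * fst h)) (at (q, D))"
    using has_derivative_compose[of fst fst "(q, D)" UNIV bump "\<lambda>h. bump1 * h"] assms(1)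
    by (auto simp: has_field_derivative_def has_derivative_fst)
  from has_derivative_mult[OF this assms(2)[unfolded has_partials_def]] show ?thesis
    unfolding has_partials_def by (simp add: algebra_simps)
qed

lemma has_partials_add:
  assumes "has_partials \<Phi> a b q D" "has_partials \<Psi> c d q D"
  shows "has_partials (\<lambda>q D. \<Phi> q D + \<Psi> q D) (a + c) (b + d) q D"
  using has_derivative_add[OF assms[unfolded has_partials_def]]
  unfolding has_partials_def by (simp add: algebra_simps)

text \<open>A function of \<open>q = |x|\<^sup>2\<close> and \<open>D = |x - z|\<^sup>2\<close> has the gradient \<open>2 \<Phi>\<^sub>q x + 2 \<Phi>\<^sub>D (x - z)\<close>, which
reduces the Laplace--Beltrami operator to the partial derivatives of \<open>\<Phi>\<close>.  A cutoff factor in \<open>q\<close>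
that is \<open>1\<close> for \<open>|x| \<le> r\<close> and \<open>0\<close> before \<open>z\<close> and the unit sphere are reached makes it a test
function without changing it on the ball of radius \<open>r\<close>.\<close>

lemma two_distances_test_function:
  fixes z :: "real ^ 'n"
  assumes r: "0 < r" "r < 1" "r < norm z"
    and \<Phi>: "\<And>q D. D > 0 \<Longrightarrow> has_partials \<Phi> (\<Phi>q q D) (\<Phi>D q D) q D"
    and \<Phi>q: "\<And>q D. D > 0 \<Longrightarrow> has_partials \<Phi>q (\<Phi>qq q D) (\<Phi>qD q D) q D"
    and \<Phi>D: "\<And>q D. D > 0 \<Longrightarrow> has_partials \<Phi>D (\<Phi>qD q D) (\<Phi>DD q D) q D"
    and cont: "continuous_on {p. snd p > 0} (\<lambda>p. \<Phi>qq (fst p) (snd p))"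
      "continuous_on {p. snd p > 0} (\<lambda>p. \<Phi>qD (fst p) (snd p))"
      "continuous_on {p. snd p > 0} (\<lambda>p. \<Phi>DD (fst p) (snd p))"
  shows "\<exists>f. test_function f \<and> (\<forall>x. norm x \<le> r \<longrightarrow> f x = \<Phi> (x \<bullet> x) ((x - z) \<bullet> (x - z))) \<and>
     (\<forall>x q D. norm x \<le> r \<longrightarrow> q = x \<bullet> x \<longrightarrow> D = (x - z) \<bullet> (x - z) \<longrightarrow> hyperbolic_Laplacian f x =
       (1 - q)\<^sup>2 * (4 * q * \<Phi>qq q D + 4 * (q + D - z \<bullet> z) * \<Phi>qD q D + 4 * D * \<Phi>DD q D
          + 2 * real CARD('n) * (\<Phi>q q D + \<Phi>D q D))
       + 2 * (real CARD('n) - 2) * (1 - q) * (2 * q * \<Phi>q q D + (q + D - z \<bullet> z) * \<Phi>D q D))"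
proof -
  define m where "m = min 1 (norm z)"
  have m: "r < m" "m \<le> 1" "m \<le> norm z" using r by (auto simp: m_def)
  \<comment> \<open>two radii between \<open>r\<close> and the obstacles \<open>1\<close> and \<open>norm z\<close>; the cutoff happens between them\<close>
  define \<rho>1 where "\<rho>1 = (2 * r + m) / 3"
  define \<rho>2 where "\<rho>2 = (r + 2 * m) / 3"
  have \<rho>: "r < \<rho>1" "\<rho>1 < \<rho>2" "\<rho>2 < m" using m r by (auto simp: \<rho>1_def \<rho>2_def)
  have \<rho>pos: "0 < \<rho>1" "0 < \<rho>2" using \<rho> r by auto
  have "\<rho>1\<^sup>2 < \<rho>2\<^sup>2" using \<rho> \<rho>pos by (intro power_strict_mono) auto
  then obtain bump bump1 bump2 where
    b: "\<forall>q. (bump has_real_derivative bump1 q) (at q)" "\<forall>q. (bump1 has_real_derivative bump2 q) (at q)"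
    "continuous_on UNIV bump2" "\<forall>q\<le>\<rho>1\<^sup>2. bump q = 1 \<and> bump1 q = 0 \<and> bump2 q = 0"
    "\<forall>q\<ge>\<rho>2\<^sup>2. bump q = 0 \<and> bump1 q = 0 \<and> bump2 q = 0"
    by (rule smooth_cutoff)
  note bump = b(1)[rule_format] b(2)[rule_format] b(3)
    and bump_one = b(4)[rule_format] and bump_zero = b(5)[rule_format]
  define F where "F q D = bump q * \<Phi> q D" for q D
  define Fq where "Fq q D = bump1 q * \<Phi> q D + bump q * \<Phi>q q D" for q D
  define FD where "FD q D = bump q * \<Phi>D q D" for q D
  define Fqq where "Fqq q D = (bump2 q * \<Phi> q D + bump1 q * \<Phi>q q D) + (bump1 q * \<Phi>q q D + bump q * \<Phi>qq q D)" for q D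
  define FqD where "FqD q D = bump1 q * \<Phi>D q D + bump q * \<Phi>qD q D" for q D
  define FDD where "FDD q D = bump q * \<Phi>DD q D" for q D
  have F: "has_partials F (Fq q D) (FD q D) q D" if "D > 0" for q D
    unfolding F_def[abs_def] Fq_def FD_def by (intro has_partials_mult_left bump \<Phi> that)
  have Fq: "has_partials Fq (Fqq q D) (FqD q D) q D" if "D > 0" for q D
    unfolding Fq_def[abs_def] Fqq_def FqD_def
    by (intro has_partials_add has_partials_mult_left bump \<Phi> \<Phi>q that)
  have FD: "has_partials FD (FqD q D) (FDD q D) q D" if "D > 0" for q D
    unfolding FD_def[abs_def] FqD_def FDD_def by (intro has_partials_mult_left bump \<Phi>D that)
  define f where "f x = F (x \<bullet> x) ((x - z) \<bullet> (x - z))" for x :: "real ^ 'n"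
  define gq where "gq x = Fq (x \<bullet> x) ((x - z) \<bullet> (x - z))" for x :: "real ^ 'n"
  define gD where "gD x = FD (x \<bullet> x) ((x - z) \<bullet> (x - z))" for x :: "real ^ 'n"
  define gqq where "gqq x = Fqq (x \<bullet> x) ((x - z) \<bullet> (x - z))" for x :: "real ^ 'n"
  define gqD where "gqD x = FqD (x \<bullet> x) ((x - z) \<bullet> (x - z))" for x :: "real ^ 'n"
  define gDD where "gDD x = FDD (x \<bullet> x) ((x - z) \<bullet> (x - z))" for x :: "real ^ 'n"
  define G where "G x = (2 * gq x) *\<^sub>R x + (2 * gD x) *\<^sub>R (x - z)" for x
  define H where "H x i = (2 * (x $ i)) *\<^sub>R ((2 * gqq x) *\<^sub>R x + (2 * gqD x) *\<^sub>R (x - z)) + (2 * gq x) *\<^sub>R axis i 1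
       + ((2 * ((x - z) $ i)) *\<^sub>R ((2 * gqD x) *\<^sub>R x + (2 * gDD x) *\<^sub>R (x - z)) + (2 * gD x) *\<^sub>R axis i 1)" for x i
  have Dpos: "(x - z) \<bullet> (x - z) > 0" if "norm x < m" for x
    using that m by auto
  have out: "f x = 0 \<and> gq x = 0 \<and> gD x = 0 \<and> gqq x = 0 \<and> gqD x = 0 \<and> gDD x = 0" if "norm x \<ge> \<rho>2" for x
  proof -
    have "x \<bullet> x \<ge> \<rho>2\<^sup>2" using that \<rho>pos by (simp add: power2_norm_eq_inner[symmetric] power_mono)
    from bump_zero[OF this] show ?thesis
      by (simp add: f_def gq_def gD_def gqq_def gqD_def gDD_def F_def Fq_def FD_def Fqq_def FqD_def FDD_def)
  qed
  have cover: "norm x < m \<or> norm x > \<rho>2" for x :: "real ^ 'n" using \<rho> by linarith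
  have locally_zero: "(h has_derivative (\<lambda>_. 0)) (at x)"
    if "norm x > \<rho>2" "\<And>x. norm x \<ge> \<rho>2 \<Longrightarrow> h x = 0" for x :: "real ^ 'n" and h :: "real ^ 'n \<Rightarrow> real"
  proof (rule has_derivative_transform_within_open)
    show "((\<lambda>_. 0) has_derivative (\<lambda>_. 0)) (at x)" by simp
    show "open {x::real ^ 'n. \<rho>2 < norm x}" by (intro open_Collect_less continuous_intros)
  qed (use that in auto)
  have df: "(f has_derivative (\<lambda>h. G x \<bullet> h)) (at x)" for x
    using cover[of x]
  proof
    assume "norm x < m"
    from has_partials_two_distances[OF F[OF Dpos[OF this]]] show ?thesis
      unfolding f_def[abs_def] G_def gq_def gD_def .
  next
    assume *: "norm x > \<rho>2"
    then show ?thesis using locally_zero[OF *, of f] out[of x] out by (simp add: G_def)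
  qed
  have dG: "((\<lambda>x. G x $ i) has_derivative (\<lambda>h. H x i \<bullet> h)) (at x)" for x i
    using cover[of x]
  proof
    assume m': "norm x < m"
    have q: "(gq has_derivative (\<lambda>h. ((2 * gqq x) *\<^sub>R x + (2 * gqD x) *\<^sub>R (x - z)) \<bullet> h)) (at x)"
      using has_partials_two_distances[OF Fq[OF Dpos[OF m']]]
      unfolding gq_def[abs_def] gqq_def gqD_def .
    have d: "(gD has_derivative (\<lambda>h. ((2 * gqD x) *\<^sub>R x + (2 * gDD x) *\<^sub>R (x - z)) \<bullet> h)) (at x)"
      using has_partials_two_distances[OF FD[OF Dpos[OF m']]]
      unfolding gD_def[abs_def] gqD_def gDD_def .
    have c: "((\<lambda>x. x $ i) has_derivative (\<lambda>h. h $ i)) (at x)"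
      by (rule bounded_linear.has_derivative[OF bounded_linear_vec_nth has_derivative_ident])
    have cz: "((\<lambda>x. (x - z) $ i) has_derivative (\<lambda>h. h $ i)) (at x)"
      using has_derivative_diff[OF c has_derivative_const[of "z $ i"]] by simp
    have "((\<lambda>x. 2 * (gq x * x $ i) + 2 * (gD x * (x - z) $ i)) has_derivative
      (\<lambda>h. 2 * (gq x * h $ i + (((2 * gqq x) *\<^sub>R x + (2 * gqD x) *\<^sub>R (x - z)) \<bullet> h) * x $ i)
        + 2 * (gD x * h $ i + (((2 * gqD x) *\<^sub>R x + (2 * gDD x) *\<^sub>R (x - z)) \<bullet> h) * (x - z) $ i))) (at x)"
      by (intro has_derivative_add has_derivative_mult_right has_derivative_mult q d c cz)
    moreover have "G x $ i = 2 * (gq x * x $ i) + 2 * (gD x * (x - z) $ i)" for x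
      by (simp add: G_def)
    moreover have "H x i \<bullet> h = 2 * (gq x * h $ i + (((2 * gqq x) *\<^sub>R x + (2 * gqD x) *\<^sub>R (x - z)) \<bullet> h) * x $ i)
        + 2 * (gD x * h $ i + (((2 * gqD x) *\<^sub>R x + (2 * gDD x) *\<^sub>R (x - z)) \<bullet> h) * (x - z) $ i)" for h
      unfolding H_def inner_add_left inner_scaleR_left inner_axis'
      by (simp add: algebra_simps)
    ultimately show ?thesis by simp
  next
    assume *: "norm x > \<rho>2"
    then show ?thesis using locally_zero[OF *, of "\<lambda>x. G x $ i"] out[of x] out by (simp add: G_def H_def)
  qed
  have cH: "continuous_on UNIV (\<lambda>x. H x i)" for i
  proof -
    have *: "continuous_on {x. norm x < m} (\<lambda>x. P (x \<bullet> x) ((x - z) \<bullet> (x - z)))"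
      if "continuous_on {p. snd p > 0} (\<lambda>p. P (fst p) (snd p))" for P :: "real \<Rightarrow> real \<Rightarrow> real"
    proof -
      have "continuous_on {x. norm x < m} (\<lambda>x. (x \<bullet> x, (x - z) \<bullet> (x - z)))"
        by (intro continuous_intros)
      moreover have "(\<lambda>x. (x \<bullet> x, (x - z) \<bullet> (x - z))) ` {x. norm x < m} \<subseteq> {p. 0 < snd p}"
        by (rule image_subsetI) (simp only: mem_Collect_eq snd_conv Dpos)
      ultimately show ?thesis using continuous_on_compose2[OF that] by fastforce
    qed
    have pc: "continuous_on {p. snd p > 0} (\<lambda>p. P (fst p) (snd p))"
      if "\<And>q D. D > 0 \<Longrightarrow> has_partials P (A q D) (B q D) q D" for P A B
      using that unfolding has_partials_def
      by (auto intro!: continuous_at_imp_continuous_on has_derivative_continuous)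
    have c_bump: "continuous_on S (\<lambda>x. bump (g x))" "continuous_on S (\<lambda>x. bump1 (g x))" "continuous_on S (\<lambda>x. bump2 (g x))"
      if "continuous_on S g" for g :: "real \<times> real \<Rightarrow> real" and S
    proof -
      have "continuous_on UNIV bump" "continuous_on UNIV bump1"
        using bump by (auto intro!: continuous_at_imp_continuous_on DERIV_isCont)
      then show "continuous_on S (\<lambda>x. bump (g x))" "continuous_on S (\<lambda>x. bump1 (g x))" "continuous_on S (\<lambda>x. bump2 (g x))"
        using bump(3) that by (auto intro: continuous_on_compose2)
    qed
    have "continuous_on {p. snd p > 0} (\<lambda>p. \<Phi> (fst p) (snd p))"
      "continuous_on {p. snd p > 0} (\<lambda>p. \<Phi>q (fst p) (snd p))"
      "continuous_on {p. snd p > 0} (\<lambda>p. \<Phi>D (fst p) (snd p))"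
      by (rule pc, erule \<Phi>) (rule pc, erule \<Phi>q, rule pc, erule \<Phi>D)
    note cs = this cont
    have "continuous_on {x. norm x < m} gq" "continuous_on {x. norm x < m} gD"
      unfolding gq_def[abs_def] gD_def[abs_def]
      by (intro *, rule pc, erule Fq) (intro *, rule pc, erule FD)
    moreover have "continuous_on {x. norm x < m} gqq" "continuous_on {x. norm x < m} gqD" "continuous_on {x. norm x < m} gDD"
      unfolding gqq_def[abs_def] gqD_def[abs_def] gDD_def[abs_def]
      by (intro *; unfold Fqq_def FqD_def FDD_def; intro continuous_intros c_bump cs)+
    ultimately have 1: "continuous_on {x. norm x < m} (\<lambda>x. H x i)"
      unfolding H_def by (intro continuous_intros)
    have 2: "continuous_on {x. norm x > \<rho>2} (\<lambda>x. H x i)"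
      by (rule continuous_on_eq[of _ "\<lambda>_. 0"]) (use out in \<open>auto simp: H_def\<close>)
    have "open {x::real ^ 'n. norm x < m}" "open {x::real ^ 'n. \<rho>2 < norm x}"
      by (intro open_Collect_less continuous_intros)+
    from continuous_on_open_Un[OF this 1 2] show ?thesis
      using cover by (simp add: Un_def Collect_disj_eq[symmetric])
  qed
  note C = C2_gradient[OF df dG cH]
  have "{x. f x \<noteq> 0} \<subseteq> cball 0 \<rho>2" using out by (force simp: not_le[symmetric])
  then have cl: "closure {x. f x \<noteq> 0} \<subseteq> cball 0 \<rho>2" by (simp add: closure_minimal)
  then have "compact (closure {x. f x \<noteq> 0})"
    by (meson bounded_cball bounded_subset closed_closure compact_eq_bounded_closed)
  moreover have "closure {x. f x \<noteq> 0} \<subseteq> ball 0 1" using cl \<rho> m by (force simp: subset_iff)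
  ultimately have tf: "test_function f" using C(1) by (simp add: test_function_def)
  have main: "f x = \<Phi> (x \<bullet> x) ((x - z) \<bullet> (x - z))"
    "q = x \<bullet> x \<Longrightarrow> D = (x - z) \<bullet> (x - z) \<Longrightarrow> hyperbolic_Laplacian f x =
       (1 - q)\<^sup>2 * (4 * q * \<Phi>qq q D + 4 * (q + D - z \<bullet> z) * \<Phi>qD q D + 4 * D * \<Phi>DD q D
          + 2 * real CARD('n) * (\<Phi>q q D + \<Phi>D q D))
       + 2 * (real CARD('n) - 2) * (1 - q) * (2 * q * \<Phi>q q D + (q + D - z \<bullet> z) * \<Phi>D q D)"
    if "norm x \<le> r" for x q D
  proof -
    have "norm x < \<rho>1" using \<rho> that by simp
    then have "x \<bullet> x \<le> \<rho>1\<^sup>2" by (simp add: power2_norm_eq_inner[symmetric] power_mono)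
    from bump_one[OF this] show fx: "f x = \<Phi> (x \<bullet> x) ((x - z) \<bullet> (x - z))" by (simp add: f_def F_def)
    assume q: "q = x \<bullet> x" and D: "D = (x - z) \<bullet> (x - z)"
    note one = bump_one[OF \<open>x \<bullet> x \<le> \<rho>1\<^sup>2\<close>]
    have g: "gq x = \<Phi>q q D" "gD x = \<Phi>D q D" "gqq x = \<Phi>qq q D" "gqD x = \<Phi>qD q D" "gDD x = \<Phi>DD q D"
      using one unfolding gq_def gD_def gqq_def gqD_def gDD_def Fq_def FD_def Fqq_def FqD_def FDD_def q D by auto
    have M: "2 * (x \<bullet> (x - z)) = q + D - z \<bullet> z"
      unfolding q D by (simp add: inner_diff inner_commute)
    have S: "(\<Sum>i\<in>UNIV. (u $ i) * (v $ i)) = u \<bullet> v" for u v :: "real ^ 'n"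
      by (simp add: inner_vec_def)
    have "(\<Sum>i\<in>UNIV. H x i $ i) = (\<Sum>i\<in>UNIV. 4 * gqq x * (x $ i * x $ i) + 8 * gqD x * (x $ i * (x - z) $ i)
         + 4 * gDD x * ((x - z) $ i * (x - z) $ i) + 2 * (gq x + gD x))"
      by (intro sum.cong refl) (simp add: H_def algebra_simps)
    also have "\<dots> = 4 * gqq x * q + 8 * gqD x * (x \<bullet> (x - z)) + 4 * gDD x * D + real CARD('n) * (2 * (gq x + gD x))"
      by (simp add: sum.distrib sum_distrib_left[symmetric] S q D del: vector_minus_component)
    finally have 1: "(\<Sum>i\<in>UNIV. partial i (partial i f) x) = 4 * q * \<Phi>qq q D + 4 * (q + D - z \<bullet> z) * \<Phi>qD q D + 4 * D * \<Phi>DD q D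
          + 2 * real CARD('n) * (\<Phi>q q D + \<Phi>D q D)"
      unfolding C(3) g M[symmetric] by (simp add: algebra_simps)
    have "(\<Sum>i\<in>UNIV. x $ i * partial i f x) = x \<bullet> G x"
      unfolding C(2) by (simp add: S)
    also have "\<dots> = 2 * q * \<Phi>q q D + (q + D - z \<bullet> z) * \<Phi>D q D"
      unfolding G_def M[symmetric] g by (simp add: inner_add_right q)
    finally have 2: "(\<Sum>i\<in>UNIV. x $ i * partial i f x) = 2 * q * \<Phi>q q D + (q + D - z \<bullet> z) * \<Phi>D q D" .
    have "(norm x)\<^sup>2 = q" by (simp add: q power2_norm_eq_inner)
    then show "hyperbolic_Laplacian f x = (1 - q)\<^sup>2 * (4 * q * \<Phi>qq q D + 4 * (q + D - z \<bullet> z) * \<Phi>qD q D + 4 * D * \<Phi>DD q D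
          + 2 * real CARD('n) * (\<Phi>q q D + \<Phi>D q D))
       + 2 * (real CARD('n) - 2) * (1 - q) * (2 * q * \<Phi>q q D + (q + D - z \<bullet> z) * \<Phi>D q D)"
      unfolding hyperbolic_Laplacian_def 1 2 by simp
  qed
  show ?thesis using tf main by blast
qed

section \<open>Hyperbolic harmonic functions\<close>

lemma inverse_power_deriv:
  assumes "D \<noteq> (0::real)"
  shows "((\<lambda>D. 1 / D ^ k) has_real_derivative - real k / D ^ (k + 1)) (at D)"
proof -
  have "((\<lambda>D. inverse D ^ k) has_real_derivative real k * (- (inverse D ^ 2)) * inverse D ^ (k - 1)) (at D)"
    using assms DERIV_power[OF DERIV_inverse, of D k, where s = UNIV] by (simp add: numeral_2_eq_2 mult.assoc)
  moreover have "real k * (- (inverse D ^ 2)) * inverse D ^ (k - 1) = - real k / D ^ (k + 1)"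
    by (cases k) (simp_all add: divide_inverse power_inverse power2_eq_square algebra_simps)
  moreover have "inverse D ^ k = 1 / D ^ k" for D :: real by (simp add: power_inverse divide_inverse)
  ultimately show ?thesis by simp
qed

lemma has_partials_laurent_term:
  assumes "(A has_real_derivative A') (at q)" "D > 0"
  shows "has_partials (\<lambda>q D. A q / D ^ k) (A' / D ^ k) (- real k * A q / D ^ (k + 1)) q D"
proof -
  have "((\<lambda>D. 1 / D ^ k) has_real_derivative - real k / D ^ (k + 1)) (at D)"
    by (rule inverse_power_deriv) (use assms(2) in simp)
  then have "((\<lambda>D. 1 / D ^ k) has_derivative (\<lambda>h. - real k / D ^ (k + 1) * h)) (at (snd (q, D)))"
    by (simp only: has_field_derivative_def snd_conv)
  from has_derivative_compose[OF has_derivative_snd[OF has_derivative_ident] this]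
  have "has_partials (\<lambda>q D. 1 / D ^ k) 0 (- real k / D ^ (k + 1)) q D"
    by (simp add: has_partials_def)
  from has_partials_mult_left[OF assms(1) this] show ?thesis by (simp add: mult.commute)
qed

lemma has_partials_laurent:
  fixes A A' :: "nat \<Rightarrow> real \<Rightarrow> real" and N :: nat
  assumes "\<And>j. (A j has_real_derivative A' j q) (at q)" "D > 0"
  shows "has_partials (\<lambda>q D. \<Sum>j\<le>N. A j q / D ^ e j) (\<Sum>j\<le>N. A' j q / D ^ e j)
    (\<Sum>j\<le>N. - real (e j) * A j q / D ^ (e j + 1)) q D"
proof (induction N)
  case 0
  then show ?case using has_partials_laurent_term[OF assms(1)[of 0] assms(2)] by simp
next
  case (Suc N)
  show ?case
    unfolding sum.atMost_Suc by (intro has_partials_add[OF Suc.IH] has_partials_laurent_term assms)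
qed

text \<open>The hyperbolic harmonic functions below are polynomials in \<open>1/D\<close> whose coefficients depend on \<open>q\<close>.\<close>

lemma laurent_test_function:
  fixes z :: "real ^ 'n" and A A1 A2 :: "nat \<Rightarrow> real \<Rightarrow> real" and N :: nat
  assumes r: "0 < r" "r < 1" "r < norm z"
    and A: "\<And>j q. (A j has_real_derivative A1 j q) (at q)" "\<And>j q. (A1 j has_real_derivative A2 j q) (at q)"
    and cA: "\<And>j. continuous_on UNIV (A2 j)"
  shows "\<exists>f. test_function f \<and>
    (\<forall>x. norm x \<le> r \<longrightarrow> f x = (\<Sum>j\<le>N. A j (x \<bullet> x) / ((x - z) \<bullet> (x - z)) ^ j)) \<and>
    (\<forall>x q D. norm x \<le> r \<longrightarrow> q = x \<bullet> x \<longrightarrow> D = (x - z) \<bullet> (x - z) \<longrightarrow> hyperbolic_Laplacian f x =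
       (1 - q)\<^sup>2 * (4 * q * (\<Sum>j\<le>N. A2 j q / D ^ j)
          + 4 * (q + D - z \<bullet> z) * (\<Sum>j\<le>N. - real j * A1 j q / D ^ (j + 1))
          + 4 * D * (\<Sum>j\<le>N. - real (j + 1) * (- real j * A j q) / D ^ (j + 1 + 1))
          + 2 * real CARD('n) * ((\<Sum>j\<le>N. A1 j q / D ^ j) + (\<Sum>j\<le>N. - real j * A j q / D ^ (j + 1))))
       + 2 * (real CARD('n) - 2) * (1 - q) * (2 * q * (\<Sum>j\<le>N. A1 j q / D ^ j)
          + (q + D - z \<bullet> z) * (\<Sum>j\<le>N. - real j * A j q / D ^ (j + 1))))"
proof (rule two_distances_test_function[OF r])
  have cA1: "continuous_on UNIV (A1 j)" "continuous_on UNIV (A j)" for j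
    using A by (auto intro!: continuous_at_imp_continuous_on DERIV_isCont)
  have D: "((\<lambda>q. - real j * A j q) has_real_derivative - real j * A1 j q) (at q)" for j q
    using DERIV_cmult[OF A(1)] .
  fix q D :: real assume "D > 0"
  show "has_partials (\<lambda>q D. \<Sum>j\<le>N. A j q / D ^ j) (\<Sum>j\<le>N. A1 j q / D ^ j) (\<Sum>j\<le>N. - real j * A j q / D ^ (j + 1)) q D"
    by (intro has_partials_laurent A \<open>D > 0\<close>)
  show "has_partials (\<lambda>q D. \<Sum>j\<le>N. A1 j q / D ^ j) (\<Sum>j\<le>N. A2 j q / D ^ j) (\<Sum>j\<le>N. - real j * A1 j q / D ^ (j + 1)) q D"
    by (intro has_partials_laurent A \<open>D > 0\<close>)
  show "has_partials (\<lambda>q D. \<Sum>j\<le>N. - real j * A j q / D ^ (j + 1)) (\<Sum>j\<le>N. - real j * A1 j q / D ^ (j + 1))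
      (\<Sum>j\<le>N. - real (j + 1) * (- real j * A j q) / D ^ (j + 1 + 1)) q D"
    by (intro has_partials_laurent D \<open>D > 0\<close>)
next
  have cA1: "continuous_on UNIV (A1 j)" "continuous_on UNIV (A j)" for j
    using A by (auto intro!: continuous_at_imp_continuous_on DERIV_isCont)
  have c: "continuous_on S (\<lambda>p::real \<times> real. A2 j (fst p))" "continuous_on S (\<lambda>p::real \<times> real. A1 j (fst p))"
    "continuous_on S (\<lambda>p::real \<times> real. A j (fst p))" for j S
    using cA cA1 by (auto intro!: continuous_on_compose2[where f = fst] continuous_intros)
  show "continuous_on {p. 0 < snd p} (\<lambda>p. \<Sum>j\<le>N. A2 j (fst p) / snd p ^ j)"
    "continuous_on {p. 0 < snd p} (\<lambda>p. \<Sum>j\<le>N. - real j * A1 j (fst p) / snd p ^ (j + 1))"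
    "continuous_on {p. 0 < snd p} (\<lambda>p. \<Sum>j\<le>N. - real (j + 1) * (- real j * A j (fst p)) / snd p ^ (j + 1 + 1))"
    by (intro continuous_intros c; simp)+
qed

text \<open>With \<open>D = |x - z|\<^sup>2\<close> and \<open>R2 = |z|\<^sup>2\<close> one has \<open>E D = D + q - R2\<close>.  So this is \<open>(1 - q) E g + 2 g\<close>
for \<open>g = 1 / D\<close>.\<close>

definition harm4 :: "real \<Rightarrow> real \<Rightarrow> real \<Rightarrow> real" where
  "harm4 R2 q D = (1 + q) / D + (1 - q) * (R2 - q) / D\<^sup>2"

text \<open>This is \<open>(1 - q)\<^sup>2 E\<^sup>2 g + (1 - q) (7 - q) E g + 12 g\<close> for \<open>g = 1 / D\<^sup>2\<close>.\<close>

definition harm6 :: "real \<Rightarrow> real \<Rightarrow> real \<Rightarrow> real" where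
  "harm6 R2 q D = (2 + 8 * q + 2 * q\<^sup>2) / D\<^sup>2
     + (1 - q) * (4 * (R2 - q) + 8 * q * (R2 - q) - 4 * q * (1 - q)) / D ^ 3
     + 6 * (1 - q)\<^sup>2 * (R2 - q)\<^sup>2 / D ^ 4"

lemma sum_upto_2: "(\<Sum>j\<le>2. g j) = g 0 + g 1 + g 2" for g :: "nat \<Rightarrow> real"
  by (simp add: numeral_2_eq_2)

lemma sum_upto_4: "(\<Sum>j\<le>4. g j) = g 0 + g 1 + g 2 + g 3 + g 4" for g :: "nat \<Rightarrow> real"
  by (simp add: eval_nat_numeral)

text \<open>The function \<open>|x|\<^sup>2\<close> is strictly subharmonic; this forces the motion out of every ball of radius \<open>r < 1\<close>.\<close>

lemma square_test_function:
  fixes r :: real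
  assumes "0 < r" "r < 1"
  shows "\<exists>f. test_function (f :: real ^ 'n \<Rightarrow> real) \<and> (\<forall>x. norm x \<le> r \<longrightarrow> f x = x \<bullet> x) \<and>
    (\<forall>x. norm x \<le> r \<longrightarrow> hyperbolic_Laplacian f x =
       (1 - x \<bullet> x)\<^sup>2 * (2 * real CARD('n)) + 2 * (real CARD('n) - 2) * (1 - x \<bullet> x) * (2 * (x \<bullet> x)))"
proof -
  \<comment> \<open>a function of \<open>q\<close> alone is smooth at every \<open>z\<close>, so any point outside the ball may serve as pole\<close>
  define z :: "real ^ 'n" where "z = axis undefined 1"
  have z: "r < norm z" using assms by (simp add: z_def)
  define A where "A j q = (if j = 0 then q else 0)" for j :: nat and q :: real
  define A1 :: "nat \<Rightarrow> real \<Rightarrow> real" where "A1 j q = (if j = 0 then 1 else 0)" for j q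
  have A: "(A j has_real_derivative A1 j q) (at q)" "(A1 j has_real_derivative 0) (at q)" for j q
    unfolding A_def[abs_def] A1_def[abs_def] by (auto intro!: derivative_eq_intros)
  from laurent_test_function[where A = A and ?A1.0 = A1 and ?A2.0 = "\<lambda>_ _. 0" and N = 0, OF assms z A]
  show ?thesis by (simp add: A_def A1_def)
qed

lemma harm4_test_function:
  fixes z :: "real ^ 'n"
  assumes n: "CARD('n) = 4" and r: "0 < r" "r < 1" "r < norm z"
  shows "\<exists>f. test_function f \<and>
    (\<forall>x. norm x \<le> r \<longrightarrow> f x = harm4 (z \<bullet> z) (x \<bullet> x) ((x - z) \<bullet> (x - z))) \<and>
    (\<forall>x. norm x \<le> r \<longrightarrow> hyperbolic_Laplacian f x = 0)"
proof -
  define S where "S = z \<bullet> z"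
  define A where "A j q = (if j = 1 then 1 + q else if j = 2 then (1 - q) * (S - q) else 0)" for j :: nat and q :: real
  define A1 where "A1 j q = (if j = 1 then 1 else if j = 2 then 2 * q - 1 - S else 0)" for j :: nat and q :: real
  define A2 :: "nat \<Rightarrow> real \<Rightarrow> real" where "A2 j q = (if j = 2 then 2 else 0)" for j q
  have A: "(A j has_real_derivative A1 j q) (at q)" "(A1 j has_real_derivative A2 j q) (at q)" for j q
    unfolding A_def[abs_def] A1_def[abs_def] A2_def
    by (cases "j = 1"; cases "j = 2"; auto intro!: derivative_eq_intros)+
  have cA: "continuous_on UNIV (A2 j)" for j unfolding A2_def[abs_def] by (intro continuous_intros)
  from laurent_test_function[where A = A and ?A1.0 = A1 and ?A2.0 = A2 and N = 2, OF r A cA]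
  obtain f where f: "test_function f"
     "\<forall>x. norm x \<le> r \<longrightarrow> f x = (\<Sum>j\<le>2. A j (x \<bullet> x) / ((x - z) \<bullet> (x - z)) ^ j)"
    and L: "\<forall>x q D. norm x \<le> r \<longrightarrow> q = x \<bullet> x \<longrightarrow> D = (x - z) \<bullet> (x - z) \<longrightarrow> hyperbolic_Laplacian f x =
       (1 - q)\<^sup>2 * (4 * q * (\<Sum>j\<le>2. A2 j q / D ^ j)
          + 4 * (q + D - z \<bullet> z) * (\<Sum>j\<le>2. - real j * A1 j q / D ^ (j + 1))
          + 4 * D * (\<Sum>j\<le>2. - real (j + 1) * (- real j * A j q) / D ^ (j + 1 + 1))
          + 2 * real CARD('n) * ((\<Sum>j\<le>2. A1 j q / D ^ j) + (\<Sum>j\<le>2. - real j * A j q / D ^ (j + 1))))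
       + 2 * (real CARD('n) - 2) * (1 - q) * (2 * q * (\<Sum>j\<le>2. A1 j q / D ^ j)
          + (q + D - z \<bullet> z) * (\<Sum>j\<le>2. - real j * A j q / D ^ (j + 1)))"
    by blast
  have "f x = harm4 (z \<bullet> z) (x \<bullet> x) ((x - z) \<bullet> (x - z))" if "norm x \<le> r" for x
    using f(2) that unfolding sum_upto_2 by (simp add: A_def harm4_def S_def)
  moreover have "hyperbolic_Laplacian f x = 0" if x: "norm x \<le> r" for x
  proof -
    define q D where "q = x \<bullet> x" and "D = (x - z) \<bullet> (x - z)"
    have "x \<noteq> z" using x r by auto
    then have "D \<noteq> 0" by (simp add: D_def)
    define t where "t = 1 / D"
    have t: "D * t = 1" using \<open>D \<noteq> 0\<close> by (simp add: t_def)
    have p: "c / D ^ k = c * t ^ k" for c k by (simp add: t_def power_divide)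
    have "hyperbolic_Laplacian f x =
       (1 - q)\<^sup>2 * (4 * q * (2 * t^2)
          + 4 * (q + D - S) * (- (1 * t^2) - 2 * (2 * q - 1 - S) * t^3)
          + 4 * D * (2 * (1 + q) * t^3 + 6 * ((1 - q) * (S - q)) * t^4)
          + 8 * ((t + (2 * q - 1 - S) * t^2) + (- (1 + q) * t^2 - 2 * ((1 - q) * (S - q)) * t^3)))
       + 4 * (1 - q) * (2 * q * (t + (2 * q - 1 - S) * t^2)
          + (q + D - S) * (- (1 + q) * t^2 - 2 * ((1 - q) * (S - q)) * t^3))"
      using L[rule_format, OF x q_def D_def] unfolding sum_upto_2 p n
      by (simp add: A_def A1_def A2_def S_def power2_eq_square power3_eq_cube power4_eq_xxxx algebra_simps)
    also have "\<dots> = 0" using t by algebra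
    finally show ?thesis .
  qed
  ultimately show ?thesis using f(1) by blast
qed

lemma harm6_test_function:
  fixes z :: "real ^ 'n"
  assumes n: "CARD('n) = 6" and r: "0 < r" "r < 1" "r < norm z"
  shows "\<exists>f. test_function f \<and>
    (\<forall>x. norm x \<le> r \<longrightarrow> f x = harm6 (z \<bullet> z) (x \<bullet> x) ((x - z) \<bullet> (x - z))) \<and>
    (\<forall>x. norm x \<le> r \<longrightarrow> hyperbolic_Laplacian f x = 0)"
proof -
  define S where "S = z \<bullet> z"
  define a b c where "a q = 2 + 8 * q + 2 * q\<^sup>2"
    and "b q = (1 - q) * (4 * (S - q) + 8 * q * (S - q) - 4 * q * (1 - q))"
    and "c q = 6 * (1 - q)\<^sup>2 * (S - q)\<^sup>2" for q :: real
  define a1 b1 c1 where "a1 q = 8 + 4 * q"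
    and "b1 q = - (4 * (S - q) + 8 * q * (S - q) - 4 * q * (1 - q)) + (1 - q) * (8 * S - 8 - 8 * q)"
    and "c1 q = - 12 * (1 - q) * (S - q) * (S + 1 - 2 * q)" for q :: real
  define b2 c2 where "b2 q = - 2 * (8 * S - 8 - 8 * q) - 8 * (1 - q)"
    and "c2 q = 12 * ((S - q)\<^sup>2 + 4 * (1 - q) * (S - q) + (1 - q)\<^sup>2)" for q :: real
  define A where "A j = (if j = 2 then a else if j = 3 then b else if j = 4 then c else (\<lambda>_. 0))" for j :: nat
  define A1 where "A1 j = (if j = 2 then a1 else if j = 3 then b1 else if j = 4 then c1 else (\<lambda>_. 0))" for j :: nat
  define A2 where "A2 j = (if j = 2 then (\<lambda>_. 4) else if j = 3 then b2 else if j = 4 then c2 else (\<lambda>_. 0))" for j :: nat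
  have abc: "(a has_real_derivative a1 q) (at q)" "(a1 has_real_derivative 4) (at q)"
    "(b has_real_derivative b1 q) (at q)" "(b1 has_real_derivative b2 q) (at q)"
    "(c has_real_derivative c1 q) (at q)" "(c1 has_real_derivative c2 q) (at q)" for q
    unfolding a_def[abs_def] b_def[abs_def] c_def[abs_def] a1_def[abs_def] b1_def[abs_def] c1_def[abs_def] b2_def c2_def
    by (auto intro!: derivative_eq_intros simp: algebra_simps power2_eq_square)
  have A: "(A j has_real_derivative A1 j q) (at q)" "(A1 j has_real_derivative A2 j q) (at q)" for j q
    unfolding A_def A1_def A2_def using abc by auto
  have cA: "continuous_on UNIV (A2 j)" for j
    unfolding A2_def b2_def[abs_def] c2_def[abs_def] by (auto intro!: continuous_intros)
  from laurent_test_function[where A = A and ?A1.0 = A1 and ?A2.0 = A2 and N = 4, OF r A cA]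
  obtain f where f: "test_function f"
     "\<forall>x. norm x \<le> r \<longrightarrow> f x = (\<Sum>j\<le>4. A j (x \<bullet> x) / ((x - z) \<bullet> (x - z)) ^ j)"
    and L: "\<forall>x q D. norm x \<le> r \<longrightarrow> q = x \<bullet> x \<longrightarrow> D = (x - z) \<bullet> (x - z) \<longrightarrow> hyperbolic_Laplacian f x =
       (1 - q)\<^sup>2 * (4 * q * (\<Sum>j\<le>4. A2 j q / D ^ j)
          + 4 * (q + D - z \<bullet> z) * (\<Sum>j\<le>4. - real j * A1 j q / D ^ (j + 1))
          + 4 * D * (\<Sum>j\<le>4. - real (j + 1) * (- real j * A j q) / D ^ (j + 1 + 1))
          + 2 * real CARD('n) * ((\<Sum>j\<le>4. A1 j q / D ^ j) + (\<Sum>j\<le>4. - real j * A j q / D ^ (j + 1))))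
       + 2 * (real CARD('n) - 2) * (1 - q) * (2 * q * (\<Sum>j\<le>4. A1 j q / D ^ j)
          + (q + D - z \<bullet> z) * (\<Sum>j\<le>4. - real j * A j q / D ^ (j + 1)))"
    by blast
  have "f x = harm6 (z \<bullet> z) (x \<bullet> x) ((x - z) \<bullet> (x - z))" if "norm x \<le> r" for x
    using f(2) that unfolding sum_upto_4 by (simp add: A_def harm6_def S_def a_def b_def c_def)
  moreover have "hyperbolic_Laplacian f x = 0" if x: "norm x \<le> r" for x
  proof -
    define q D where "q = x \<bullet> x" and "D = (x - z) \<bullet> (x - z)"
    have "x \<noteq> z" using x r by auto
    then have "D \<noteq> 0" by (simp add: D_def)
    define t where "t = 1 / D"
    have t: "D * t = 1" using \<open>D \<noteq> 0\<close> by (simp add: t_def)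
    have p: "c / D ^ k = c * t ^ k" for c k by (simp add: t_def power_divide)
    have "hyperbolic_Laplacian f x =
       (1 - q)\<^sup>2 * (4 * q * (4 * t^2 + b2 q * t^3 + c2 q * t^4)
          + 4 * (q + D - S) * (- 2 * a1 q * t^3 - 3 * b1 q * t^4 - 4 * c1 q * t^5)
          + 4 * D * (6 * a q * t^4 + 12 * b q * t^5 + 20 * c q * t^6)
          + 12 * ((a1 q * t^2 + b1 q * t^3 + c1 q * t^4) + (- 2 * a q * t^3 - 3 * b q * t^4 - 4 * c q * t^5)))
       + 8 * (1 - q) * (2 * q * (a1 q * t^2 + b1 q * t^3 + c1 q * t^4)
          + (q + D - S) * (- 2 * a q * t^3 - 3 * b q * t^4 - 4 * c q * t^5))"
      using L[rule_format, OF x q_def D_def] unfolding sum_upto_4 p n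
      by (simp add: A_def A1_def A2_def S_def)
    also have "\<dots> = 0"
      unfolding a_def b_def c_def a1_def b1_def c1_def b2_def c2_def using t by algebra
    finally show ?thesis .
  qed
  ultimately show ?thesis using f(1) by blast
qed

section \<open>Optional stopping\<close>

lemma martingale_increment:
  assumes M: "prob_space M" and sub: "\<And>u. u \<ge> 0 \<Longrightarrow> subalgebra M (F u)" and mart: "martingale M F N"
    and ab: "0 \<le> a" "a \<le> b" and A: "A \<in> sets (F a)"
  shows "integrable M (\<lambda>\<omega>. (N b \<omega> - N a \<omega>) * indicator A \<omega>)"
    and "(\<integral>\<omega>. (N b \<omega> - N a \<omega>) * indicator A \<omega> \<partial>M) = 0"
proof -
  interpret prob_space M by fact
  interpret finite_measure_subalgebra M "F a"
    by unfold_locales (rule sub[OF ab(1)])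
  have int: "integrable M (N a)" "integrable M (N b)" using mart ab by (auto simp: martingale_def)
  have AM: "A \<in> sets M" using A subalg by (auto simp: subalgebra_def)
  have i: "integrable M (\<lambda>\<omega>. N u \<omega> * indicator A \<omega>)" if "integrable M (N u)" for u
    using integrable_mult_indicator[OF AM that] by (simp add: mult.commute)
  show "integrable M (\<lambda>\<omega>. (N b \<omega> - N a \<omega>) * indicator A \<omega>)"
    using i[OF int(1)] i[OF int(2)] by (simp add: left_diff_distrib)
  have "AE \<omega> in M. real_cond_exp M (F a) (N b) \<omega> = N a \<omega>"
    using mart ab by (auto simp: martingale_def)
  then have "(\<integral>\<omega>\<in>A. real_cond_exp M (F a) (N b) \<omega> \<partial>M) = (\<integral>\<omega>\<in>A. N a \<omega> \<partial>M)"
    using int AM by (intro set_lebesgue_integral_cong_AE) auto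
  then have "(\<integral>\<omega>\<in>A. N b \<omega> \<partial>M) = (\<integral>\<omega>\<in>A. N a \<omega> \<partial>M)"
    using real_cond_exp_intA[OF int(2) A] by simp
  then show "(\<integral>\<omega>. (N b \<omega> - N a \<omega>) * indicator A \<omega> \<partial>M) = 0"
    using i[OF int(1)] i[OF int(2)] by (simp add: algebra_simps set_lebesgue_integral_def)
qed

text \<open>The stopping time is approximated from above by times with values in an equidistant grid.  For these
the stopped value minus the initial value is a finite sum of martingale increments over events of the past.  The bound on
the paths allows to pass to the limit.\<close>

lemma optional_stopping:
  assumes M: "prob_space M" and sub: "\<And>u. u \<ge> 0 \<Longrightarrow> subalgebra M (F u)" and mart: "martingale M F N"
    and T: "\<And>\<omega>. \<omega> \<in> space M \<Longrightarrow> 0 \<le> T \<omega> \<and> T \<omega> \<le> t"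
      "\<And>u. 0 \<le> u \<Longrightarrow> {\<omega> \<in> space M. T \<omega> \<le> u} \<in> sets (F u)" and t: "t > 0"
    and cont: "\<And>\<omega>. \<omega> \<in> space M \<Longrightarrow> continuous_on {0..t} (\<lambda>u. N u \<omega>)"
    and bd: "\<And>\<omega> u. \<omega> \<in> space M \<Longrightarrow> 0 \<le> u \<Longrightarrow> u \<le> t \<Longrightarrow> \<bar>N u \<omega>\<bar> \<le> C"
  shows "integrable M (\<lambda>\<omega>. N (T \<omega>) \<omega>)" and "(\<integral>\<omega>. N (T \<omega>) \<omega> \<partial>M) = (\<integral>\<omega>. N 0 \<omega> \<partial>M)"
proof -
  interpret prob_space M by fact
  define s where "s n j = t * real j / real (Suc n)" for n j :: nat
  have s: "0 \<le> s n j" "s n j \<le> s n (Suc j)" "s n 0 = 0" for n j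
    using t by (auto simp: s_def divide_right_mono)
  define A where "A n j = {\<omega> \<in> space M. s n j < T \<omega>}" for n j
  have A: "A n j \<in> sets (F (s n j))" for n j
  proof -
    have "A n j = space (F (s n j)) - {\<omega> \<in> space M. T \<omega> \<le> s n j}"
      using sub[OF s(1)] by (auto simp: A_def subalgebra_def)
    then show ?thesis using T(2)[OF s(1)] by simp
  qed
  define S where "S n \<omega> = (\<Sum>j<Suc n. (N (s n (Suc j)) \<omega> - N (s n j) \<omega>) * indicator (A n j) \<omega>)" for n \<omega>
  have S: "integrable M (S n)" "(\<integral>\<omega>. S n \<omega> \<partial>M) = 0" for n
  proof -
    have inc: "integrable M (\<lambda>\<omega>. (N (s n (Suc j)) \<omega> - N (s n j) \<omega>) * indicator (A n j) \<omega>)"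
      "(\<integral>\<omega>. (N (s n (Suc j)) \<omega> - N (s n j) \<omega>) * indicator (A n j) \<omega> \<partial>M) = 0" for j
      using martingale_increment[OF M sub mart s(1) s(2) A] by blast+
    show "integrable M (S n)" unfolding S_def[abs_def] by (intro Bochner_Integration.integrable_sum inc(1))
    show "(\<integral>\<omega>. S n \<omega> \<partial>M) = 0"
      unfolding S_def by (subst Bochner_Integration.integral_sum[OF inc(1)]) (rule sum.neutral, use inc(2) in blast)
  qed
  \<comment> \<open>index of the first grid point not before \<open>T \<omega>\<close>\<close>
  define J where "J n \<omega> = nat \<lceil>T \<omega> * real (Suc n) / t\<rceil>" for n \<omega>
  have J: "s n j < T \<omega> \<longleftrightarrow> j < J n \<omega>" "J n \<omega> \<le> Suc n" "T \<omega> \<le> s n (J n \<omega>)" "s n (J n \<omega>) \<le> T \<omega> + t / real (Suc n)"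
    "s n (J n \<omega>) \<le> t"
    if w: "\<omega> \<in> space M" for n j \<omega>
  proof -
    define m where "m = real (Suc n)"
    have m: "m > 0" by (simp add: m_def)
    define v where "v = T \<omega> * m / t"
    have v: "0 \<le> v" "v \<le> m" using T(1)[OF w] t m by (auto simp: v_def field_simps)
    have Jv: "J n \<omega> = nat \<lceil>v\<rceil>" by (simp add: J_def v_def m_def)
    have Tv: "T \<omega> = t * v / m" using t m by (simp add: v_def)
    have sj: "s n j = t * real j / m" for j by (simp add: s_def m_def)
    have "s n j < T \<omega> \<longleftrightarrow> real j < v" unfolding Tv sj using t m by (simp add: divide_less_cancel)
    also have "\<dots> \<longleftrightarrow> j < J n \<omega>" unfolding Jv by linarith
    finally show "s n j < T \<omega> \<longleftrightarrow> j < J n \<omega>" .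
    have "\<lceil>v\<rceil> \<le> int (Suc n)" using v(2) unfolding ceiling_le_iff m_def by simp
    then show Jm: "J n \<omega> \<le> Suc n" unfolding Jv by linarith
    have le: "v \<le> real (J n \<omega>)" "real (J n \<omega>) \<le> v + 1" unfolding Jv using v by linarith+
    show "T \<omega> \<le> s n (J n \<omega>)" unfolding Tv sj using le t m by (simp add: divide_right_mono)
    have "s n (J n \<omega>) \<le> t * (v + 1) / m" unfolding sj using le t m by (intro divide_right_mono mult_left_mono) auto
    then show "s n (J n \<omega>) \<le> T \<omega> + t / real (Suc n)" unfolding Tv m_def by (simp add: add_divide_distrib distrib_left)
    have "s n (J n \<omega>) \<le> t * m / m" unfolding sj using Jm t m by (intro divide_right_mono mult_left_mono) (auto simp: m_def)
    then show "s n (J n \<omega>) \<le> t" using m by simp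
  qed
  have SJ: "S n \<omega> = N (s n (J n \<omega>)) \<omega> - N 0 \<omega>" if w: "\<omega> \<in> space M" for n \<omega>
  proof -
    have "S n \<omega> = (\<Sum>j<Suc n. if j < J n \<omega> then N (s n (Suc j)) \<omega> - N (s n j) \<omega> else 0)"
      unfolding S_def by (intro sum.cong refl) (use J(1)[OF w] w in \<open>auto simp: A_def\<close>)
    also have "\<dots> = (\<Sum>j\<in>{..<Suc n} \<inter> {j. j < J n \<omega>}. N (s n (Suc j)) \<omega> - N (s n j) \<omega>)"
      by (rule sum.inter_restrict[symmetric, where B = "{j. j < J n \<omega>}", simplified]) simp
    also have "{..<Suc n} \<inter> {j. j < J n \<omega>} = {..<J n \<omega>}" using J(2)[OF w, of n] by auto
    also have "(\<Sum>j<J n \<omega>. N (s n (Suc j)) \<omega> - N (s n j) \<omega>) = N (s n (J n \<omega>)) \<omega> - N (s n 0) \<omega>"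
      by (rule sum_lessThan_telescope)
    finally show ?thesis by (simp add: s)
  qed
  have lim: "(\<lambda>n. S n \<omega>) \<longlonglongrightarrow> N (T \<omega>) \<omega> - N 0 \<omega>" if w: "\<omega> \<in> space M" for \<omega>
  proof -
    have "(\<lambda>n. s n (J n \<omega>)) \<longlonglongrightarrow> T \<omega>"
    proof (rule tendsto_sandwich)
      show "\<forall>\<^sub>F n in sequentially. T \<omega> \<le> s n (J n \<omega>)" "\<forall>\<^sub>F n in sequentially. s n (J n \<omega>) \<le> T \<omega> + t / real (Suc n)"
        using J(3,4)[OF w] by auto
      have "(\<lambda>n. T \<omega> + t * inverse (real (Suc n))) \<longlonglongrightarrow> T \<omega> + t * 0"
        by (intro tendsto_intros LIMSEQ_inverse_real_of_nat)
      then show "(\<lambda>n. T \<omega> + t / real (Suc n)) \<longlonglongrightarrow> T \<omega>" by (simp add: divide_inverse)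
    qed simp
    moreover have "\<forall>\<^sub>F n in sequentially. s n (J n \<omega>) \<in> {0..t}" using J(5)[OF w] s by auto
    ultimately have "(\<lambda>n. N (s n (J n \<omega>)) \<omega>) \<longlonglongrightarrow> N (T \<omega>) \<omega>"
      using continuous_on_tendsto_compose[OF cont[OF w], of "\<lambda>n. s n (J n \<omega>)" "T \<omega>"] T(1)[OF w] by auto
    then show ?thesis unfolding SJ[OF w] by (intro tendsto_intros)
  qed
  have bS: "norm (S n \<omega>) \<le> 2 * C" if w: "\<omega> \<in> space M" for n \<omega>
    unfolding SJ[OF w] using bd[OF w s(1) J(5)[OF w], of n] bd[OF w, of 0] t by auto
  have meas: "(\<lambda>\<omega>. N (T \<omega>) \<omega> - N 0 \<omega>) \<in> borel_measurable M"
    by (rule borel_measurable_LIMSEQ_metric[where f = S, OF borel_measurable_integrable[OF S(1)] lim])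
  have AElim: "AE \<omega> in M. (\<lambda>n. S n \<omega>) \<longlonglongrightarrow> N (T \<omega>) \<omega> - N 0 \<omega>"
    and AEb: "AE \<omega> in M. norm (S n \<omega>) \<le> 2 * C" for n
    by (rule AE_I2, erule lim) (rule AE_I2, erule bS)
  have "integrable M (\<lambda>\<omega>. N (T \<omega>) \<omega> - N 0 \<omega>)"
    by (rule integrable_dominated_convergence[OF meas borel_measurable_integrable[OF S(1)] _ AElim AEb]) simp
  moreover have i0: "integrable M (N 0)" using mart by (auto simp: martingale_def)
  ultimately have iT: "integrable M (\<lambda>\<omega>. (N (T \<omega>) \<omega> - N 0 \<omega>) + N 0 \<omega>)" by (rule Bochner_Integration.integrable_add)
  then show iT': "integrable M (\<lambda>\<omega>. N (T \<omega>) \<omega>)" by simp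
  have "(\<lambda>n. \<integral>\<omega>. S n \<omega> \<partial>M) \<longlonglongrightarrow> (\<integral>\<omega>. N (T \<omega>) \<omega> - N 0 \<omega> \<partial>M)"
    by (rule integral_dominated_convergence[OF meas borel_measurable_integrable[OF S(1)] _ AElim AEb]) simp
  then have "(\<integral>\<omega>. N (T \<omega>) \<omega> - N 0 \<omega> \<partial>M) = 0"
    unfolding S(2) by (simp add: LIMSEQ_const_iff)
  then show "(\<integral>\<omega>. N (T \<omega>) \<omega> \<partial>M) = (\<integral>\<omega>. N 0 \<omega> \<partial>M)" using iT' i0 by simp
qed

text \<open>Continuous paths may be sampled along a grid that approximates the random time from above.\<close>

lemma random_time_measurable:
  fixes X :: "real \<Rightarrow> 'w \<Rightarrow> 'b::metric_space"
  assumes X: "\<And>t. t \<ge> 0 \<Longrightarrow> X t \<in> borel_measurable M"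
    and cont: "\<And>\<omega>. \<omega> \<in> space M \<Longrightarrow> continuous_on {0..} (\<lambda>t. X t \<omega>)"
    and T: "T \<in> borel_measurable M" "\<And>\<omega>. \<omega> \<in> space M \<Longrightarrow> 0 \<le> (T \<omega> :: real)"
  shows "(\<lambda>\<omega>. X (T \<omega>) \<omega>) \<in> borel_measurable M"
proof (rule borel_measurable_LIMSEQ_metric)
  define J where "J n \<omega> = nat \<lceil>T \<omega> * real (Suc n)\<rceil>" for n \<omega>
  have "J n \<in> measurable M (count_space UNIV)" for n
    unfolding J_def[abs_def] using T(1) by measurable
  then show "(\<lambda>\<omega>. X (real (J n \<omega>) / real (Suc n)) \<omega>) \<in> borel_measurable M" for n
    by (intro measurable_compose_countable[where f = "\<lambda>j. X (real j / real (Suc n))" and g = "J n"] X) auto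
  fix \<omega> assume w: "\<omega> \<in> space M"
  have "(\<lambda>n. real (J n \<omega>) / real (Suc n)) \<longlonglongrightarrow> T \<omega>"
  proof (rule tendsto_sandwich)
    have *: "T \<omega> * real (Suc n) \<le> real (J n \<omega>)" "real (J n \<omega>) \<le> T \<omega> * real (Suc n) + 1" for n
    proof -
      have "0 \<le> T \<omega> * real (Suc n)" using T(2)[OF w] by simp
      then show "T \<omega> * real (Suc n) \<le> real (J n \<omega>)" "real (J n \<omega>) \<le> T \<omega> * real (Suc n) + 1"
        unfolding J_def by linarith+
    qed
    show "\<forall>\<^sub>F n in sequentially. T \<omega> \<le> real (J n \<omega>) / real (Suc n)"
      using *(1) by (auto simp: pos_le_divide_eq)
    show "\<forall>\<^sub>F n in sequentially. real (J n \<omega>) / real (Suc n) \<le> T \<omega> + inverse (real (Suc n))"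
      using *(2) by (auto simp: pos_divide_le_eq distrib_right simp del: of_nat_Suc)
    have "(\<lambda>n. T \<omega> + inverse (real (Suc n))) \<longlonglongrightarrow> T \<omega> + 0"
      by (intro tendsto_intros LIMSEQ_inverse_real_of_nat)
    then show "(\<lambda>n. T \<omega> + inverse (real (Suc n))) \<longlonglongrightarrow> T \<omega>" by simp
  qed simp
  then show "(\<lambda>n. X (real (J n \<omega>) / real (Suc n)) \<omega>) \<longlonglongrightarrow> X (T \<omega>) \<omega>"
    using continuous_on_tendsto_compose[OF cont[OF w], of "\<lambda>n. real (J n \<omega>) / real (Suc n)" "T \<omega>"] T(2)[OF w] by auto
qed

lemma natural_filtration_subalgebra:
  fixes X :: "real \<Rightarrow> 'w \<Rightarrow> 'a::topological_space"
  assumes "\<And>t. t \<ge> 0 \<Longrightarrow> X t \<in> borel_measurable M"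
  shows "subalgebra M (natural_filtration M X t)"
proof -
  let ?G = "\<Union>s\<in>{0..t}. {X s -` A \<inter> space M |A. A \<in> sets borel}"
  have "?G \<subseteq> Pow (space M)" by auto
  moreover have "?G \<subseteq> sets M" using assms by (auto intro: measurable_sets)
  ultimately show ?thesis
    unfolding subalgebra_def natural_filtration_def by (simp add: sets.sigma_sets_subset)
qed

lemma natural_filtration_measurable:
  fixes X :: "real \<Rightarrow> 'w \<Rightarrow> 'a::topological_space"
  assumes "0 \<le> s" "s \<le> t"
  shows "X s \<in> borel_measurable (natural_filtration M X t)"
proof (rule measurableI)
  let ?G = "\<Union>s\<in>{0..t}. {X s -` A \<inter> space M |A. A \<in> sets borel}"
  fix A :: "'a set" assume "A \<in> sets borel"
  then have "X s -` A \<inter> space M \<in> ?G"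
    by (intro UN_I[of s]) (use assms in auto)
  moreover have "?G \<subseteq> Pow (space M)" by auto
  ultimately show "X s -` A \<inter> space (natural_filtration M X t) \<in> sets (natural_filtration M X t)"
    unfolding natural_filtration_def by (simp add: sigma_sets.Basic)
qed simp

section \<open>Exit from a ball\<close>

text \<open>The times at which a continuous path is outside the open ball form a closed set, so the infimum is
attained.\<close>

lemma exit_time_cases:
  fixes X :: "real \<Rightarrow> 'w \<Rightarrow> real ^ 'n"
  assumes cont: "continuous_on {0..} (\<lambda>t. X t \<omega>)"
  obtains (infinite) "exit_time r X \<omega> = \<infinity>" "\<forall>t\<ge>0. norm (X t \<omega>) < r"
  | (finite) s where "0 \<le> s" "exit_time r X \<omega> = ennreal s" "r \<le> norm (X s \<omega>)" "\<forall>t\<in>{0..<s}. norm (X t \<omega>) < r"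
proof (cases "\<exists>t\<ge>0. r \<le> norm (X t \<omega>)")
  case False
  then have "{t. 0 \<le> t \<and> r \<le> norm (X t \<omega>)} = {}" by auto
  then have "exit_time r X \<omega> = \<infinity>" by (simp add: exit_time_def)
  then show thesis using False infinite by (meson not_le)
next
  case True
  define Z where "Z = {t\<in>{0..}. r \<le> norm (X t \<omega>)}"
  have "closed ({0..} \<inter> (\<lambda>t. norm (X t \<omega>)) -` {r..})"
    by (intro continuous_closed_preimage continuous_intros cont closed_atLeast)
  moreover have "Z = {0..} \<inter> (\<lambda>t. norm (X t \<omega>)) -` {r..}" by (auto simp: Z_def)
  ultimately have Z: "closed Z" "Z \<noteq> {}" "bdd_below Z" using True by (auto simp: Z_def intro: bdd_belowI[of _ 0])
  define s where "s = Inf Z"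
  have sZ: "s \<in> Z" unfolding s_def by (rule closed_contains_Inf[OF Z(2,3,1)])
  have le: "s \<le> t" if "t \<in> Z" for t unfolding s_def by (rule cInf_lower[OF that Z(3)])
  have "exit_time r X \<omega> = ennreal s"
    unfolding exit_time_def
  proof (rule antisym)
    show "(INF t\<in>{t. 0 \<le> t \<and> r \<le> norm (X t \<omega>)}. ennreal t) \<le> ennreal s"
      using sZ by (intro INF_lower) (auto simp: Z_def)
    show "ennreal s \<le> (INF t\<in>{t. 0 \<le> t \<and> r \<le> norm (X t \<omega>)}. ennreal t)"
      using le by (intro INF_greatest ennreal_leI) (auto simp: Z_def)
  qed
  moreover have "norm (X t \<omega>) < r" if "t \<in> {0..<s}" for t
    using le[of t] that by (force simp: Z_def)
  ultimately show thesis using sZ finite[of s] by (auto simp: Z_def)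
qed

lemma exit_time_le_iff:
  assumes cont: "continuous_on {0..} (\<lambda>t. X t \<omega>)" and "u \<ge> 0"
  shows "exit_time r X \<omega> \<le> ennreal u \<longleftrightarrow> (\<exists>s\<in>{0..u}. r \<le> norm (X s \<omega>))"
  using cont
proof (cases rule: exit_time_cases[of X \<omega> r])
  case infinite
  from infinite(1) have "\<not> exit_time r X \<omega> \<le> ennreal u" by (simp add: top_unique)
  moreover have "\<not> (\<exists>s\<in>{0..u}. r \<le> norm (X s \<omega>))" using infinite(2) by fastforce
  ultimately show ?thesis by blast
next
  case (finite s)
  have "exit_time r X \<omega> \<le> ennreal u \<longleftrightarrow> s \<le> u" using finite(1,2) \<open>u \<ge> 0\<close> by (simp add: ennreal_le_iff)
  moreover have "s \<le> u" if "t \<in> {0..u}" "r \<le> norm (X t \<omega>)" for t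
    using finite(4) that by (meson atLeastAtMost_iff atLeastLessThan_iff not_le order_trans)
  ultimately show ?thesis using finite(1,3) by (metis atLeastAtMost_iff)
qed

text \<open>The filtration is neither completed nor made right-continuous, so membership in the sigma-algebra of
time \<open>u\<close> itself has to be shown.  By compactness the path reaches the radius \<open>r\<close> before \<open>u\<close> if and only if
its norm at some grid point of \<open>[0, u]\<close> comes arbitrarily close to \<open>r\<close>.\<close>

lemma hitting_set_measurable:
  fixes X :: "real \<Rightarrow> 'w \<Rightarrow> real ^ 'n"
  assumes cont: "\<And>\<omega>. \<omega> \<in> space M \<Longrightarrow> continuous_on {0..} (\<lambda>t. X t \<omega>)"
    and u: "u \<ge> 0"
  shows "{\<omega>\<in>space M. exit_time r X \<omega> \<le> ennreal u} \<in> sets (natural_filtration M X u)"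
proof -
  define \<theta> where "\<theta> n i = u * real i / real (Suc n)" for n i :: nat
  have \<theta>: "0 \<le> \<theta> n i" "\<theta> n i \<le> u" if "i \<le> Suc n" for n i
    using that u by (auto simp: \<theta>_def field_simps mult_left_mono simp del: of_nat_Suc)
  let ?B = "\<lambda>k n i. {\<omega>\<in>space (natural_filtration M X u). r - inverse (real (Suc k)) < norm (X (\<theta> n i) \<omega>)}"
  have sp: "space (natural_filtration M X u) = space M" by (simp add: natural_filtration_def space_measure_of_conv)
  have main: "(\<exists>s\<in>{0..u}. r \<le> norm (X s \<omega>)) \<longleftrightarrow> (\<forall>k. \<exists>n. \<exists>i\<le>Suc n. r - inverse (real (Suc k)) < norm (X (\<theta> n i) \<omega>))"
    if w: "\<omega> \<in> space M" for \<omega>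
  proof
    have c: "continuous_on {0..u} (\<lambda>s. norm (X s \<omega>))"
      using continuous_on_subset[OF cont[OF w], of "{0..u}"] by (intro continuous_intros) auto
    {
      assume "\<exists>s\<in>{0..u}. r \<le> norm (X s \<omega>)"
      then obtain s where s: "0 \<le> s" "s \<le> u" "r \<le> norm (X s \<omega>)" by auto
      define i where "i n = nat \<lfloor>s * real (Suc n) / u\<rfloor>" for n
      have i: "i n \<le> Suc n" "\<bar>\<theta> n (i n) - s\<bar> \<le> u * inverse (real (Suc n))" for n
      proof -
        define m where "m = real (Suc n)"
        have m: "m > 0" by (simp add: m_def)
        have "i n \<le> Suc n \<and> \<bar>\<theta> n (i n) - s\<bar> \<le> u * inverse m"
        proof (cases "u = 0")
          case True
          then show ?thesis using s by (simp add: i_def \<theta>_def)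
        next
          case False
          then have u: "u > 0" using u by simp
          define v where "v = s * m / u"
          have v: "0 \<le> v" "v \<le> m" "s = u * v / m" using s u m by (auto simp: v_def field_simps)
          have iv: "i n = nat \<lfloor>v\<rfloor>" by (simp add: i_def v_def m_def)
          have le: "real (i n) \<le> v" "v \<le> real (i n) + 1" using v(1) unfolding iv by linarith+
          have "real (i n) \<le> real (Suc n)" using le v unfolding m_def by linarith
          then have 1: "i n \<le> Suc n" by simp
          have "\<theta> n (i n) - s = - (u / m) * (v - real (i n))"
            unfolding v(3) \<theta>_def m_def[symmetric] using m by (simp add: field_simps)
          then have "\<bar>\<theta> n (i n) - s\<bar> = (u / m) * (v - real (i n))" using u m le by (simp add: abs_mult)
          also have "\<dots> \<le> (u / m) * 1" using u m le by (intro mult_left_mono) auto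
          finally show ?thesis using 1 by (simp add: divide_inverse)
        qed
        then show "i n \<le> Suc n" "\<bar>\<theta> n (i n) - s\<bar> \<le> u * inverse (real (Suc n))" by (simp_all add: m_def)
      qed
      have "(\<lambda>n. \<theta> n (i n) - s) \<longlonglongrightarrow> 0"
      proof (rule Lim_null_comparison)
        show "\<forall>\<^sub>F n in sequentially. norm (\<theta> n (i n) - s) \<le> u * inverse (real (Suc n))" using i(2) by simp
        show "(\<lambda>n. u * inverse (real (Suc n))) \<longlonglongrightarrow> 0"
          using tendsto_mult_right_zero[OF LIMSEQ_inverse_real_of_nat] by simp
      qed
      then have "(\<lambda>n. \<theta> n (i n)) \<longlonglongrightarrow> s" by (simp add: LIM_zero_iff)
      then have lim: "(\<lambda>n. norm (X (\<theta> n (i n)) \<omega>)) \<longlonglongrightarrow> norm (X s \<omega>)"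
        using continuous_on_tendsto_compose[OF c, of "\<lambda>n. \<theta> n (i n)" s] \<theta> i s by auto
      show "\<forall>k. \<exists>n. \<exists>i\<le>Suc n. r - inverse (real (Suc k)) < norm (X (\<theta> n i) \<omega>)"
      proof
        fix k
        have "r - inverse (real (Suc k)) < norm (X s \<omega>)" using s(3) by (simp add: less_le_trans[of _ r])
        from order_tendstoD(1)[OF lim this] show "\<exists>n. \<exists>i\<le>Suc n. r - inverse (real (Suc k)) < norm (X (\<theta> n i) \<omega>)"
          using i(1) by (auto simp: eventually_sequentially)
      qed
    next
      assume *: "\<forall>k. \<exists>n. \<exists>i\<le>Suc n. r - inverse (real (Suc k)) < norm (X (\<theta> n i) \<omega>)"
      obtain s where s: "s \<in> {0..u}" "\<forall>y\<in>{0..u}. norm (X y \<omega>) \<le> norm (X s \<omega>)"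
        using continuous_attains_sup[OF compact_Icc _ c] u by auto
      have "r - inverse (real (Suc k)) \<le> norm (X s \<omega>)" for k
      proof -
        obtain n i where "i \<le> Suc n" "r - inverse (real (Suc k)) < norm (X (\<theta> n i) \<omega>)" using * by blast
        moreover from this have "norm (X (\<theta> n i) \<omega>) \<le> norm (X s \<omega>)" using s(2) \<theta>[of i n] by simp
        ultimately show ?thesis by linarith
      qed
      moreover have "(\<lambda>k. r - inverse (real (Suc k))) \<longlonglongrightarrow> r - 0"
        by (intro tendsto_intros LIMSEQ_inverse_real_of_nat)
      ultimately have "r \<le> norm (X s \<omega>)" by (intro LIMSEQ_le_const2[of _ r]) auto
      then show "\<exists>s\<in>{0..u}. r \<le> norm (X s \<omega>)" using s(1) by blast
    }
  qed
  have "exit_time r X \<omega> \<le> ennreal u \<longleftrightarrow> (\<forall>k. \<exists>n. \<exists>i\<in>{..Suc n}. r - inverse (real (Suc k)) < norm (X (\<theta> n i) \<omega>))"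
    if w: "\<omega> \<in> space M" for \<omega>
    unfolding exit_time_le_iff[where X = X and \<omega> = \<omega> and u = u and r = r, OF cont[OF w] u] main[OF w]
    by (simp only: Bex_def atMost_iff)
  then have "{\<omega>\<in>space M. exit_time r X \<omega> \<le> ennreal u} = (\<Inter>k. \<Union>n. \<Union>i\<in>{..Suc n}. ?B k n i)"
    unfolding sp by (auto simp del: of_nat_Suc)
  moreover have "?B k n i \<in> sets (natural_filtration M X u)" if "i \<le> Suc n" for k n i
  proof -
    have [measurable]: "X (\<theta> n i) \<in> borel_measurable (natural_filtration M X u)"
      using \<theta>[OF that] by (rule natural_filtration_measurable)
    show ?thesis by measurable
  qed
  ultimately show ?thesis by (auto intro!: sets.countable_INT'' sets.finite_UN)
qed

text \<open>A single member \<open>P x\<close> of the family of laws of a hyperbolic Brownian motion.\<close>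

locale hyperbolic_motion = prob_space M
  for M :: "'w measure" and X :: "real \<Rightarrow> 'w \<Rightarrow> real ^ 'n" and x :: "real ^ 'n" +
  assumes X_measurable: "t \<ge> 0 \<Longrightarrow> X t \<in> borel_measurable M"
    and X_continuous: "\<omega> \<in> space M \<Longrightarrow> continuous_on {0..} (\<lambda>t. X t \<omega>)"
    and X_in_ball: "\<omega> \<in> space M \<Longrightarrow> t \<ge> 0 \<Longrightarrow> norm (X t \<omega>) < 1"
    and X_start: "AE \<omega> in M. X 0 \<omega> = x"
    and X_martingale: "test_function f \<Longrightarrow> martingale M (natural_filtration M X)
             (\<lambda>t \<omega>. f (X t \<omega>) - f (X 0 \<omega>)
                - (LINT s:{0..t}|lborel. hyperbolic_Laplacian f (X s \<omega>)))"

lemma hyperbolic_motionI: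
  assumes "hyperbolic_Brownian_motion P X" "norm x < 1"
  shows "hyperbolic_motion (P x) X x"
  using assms unfolding hyperbolic_Brownian_motion_def hyperbolic_motion_def hyperbolic_motion_axioms_def
  by (auto simp: dist_norm)

lemma continuous_on_hyperbolic_Laplacian:
  fixes f :: "real ^ 'n \<Rightarrow> real"
  assumes "test_function f"
  shows "continuous_on UNIV f" "continuous_on UNIV (hyperbolic_Laplacian f)"
proof -
  have C: "\<And>x. f differentiable (at x)" "\<And>i. continuous_on UNIV (partial i f)"
     "\<And>i j. continuous_on UNIV (partial j (partial i f))"
    using assms unfolding test_function_def C2_def C1_def by blast+
  show "continuous_on UNIV f"
    using C(1) by (auto intro!: continuous_at_imp_continuous_on differentiable_imp_continuous_within)
  show "continuous_on UNIV (hyperbolic_Laplacian f)"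
    unfolding hyperbolic_Laplacian_def[abs_def] by (intro continuous_intros C)
qed

lemma bounded_on_unit_ball:
  fixes g :: "real ^ 'n \<Rightarrow> real"
  assumes "continuous_on UNIV g"
  shows "\<exists>B\<ge>0. \<forall>y. norm y < 1 \<longrightarrow> \<bar>g y\<bar> \<le> B"
proof -
  have "compact (g ` cball 0 1)"
    by (intro compact_continuous_image continuous_on_subset[OF assms]) auto
  then obtain B where "\<forall>v\<in>g ` cball 0 1. norm v \<le> B"
    using compact_imp_bounded bounded_iff by metis
  then have "\<bar>g y\<bar> \<le> \<bar>B\<bar>" if "norm y < 1" for y
    using that by (auto intro: order_trans[OF _ abs_ge_self])
  then show ?thesis by (intro exI[of _ "\<bar>B\<bar>"]) simp
qed

lemma test_function_uminus:
  fixes f :: "real ^ 'n \<Rightarrow> real"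
  assumes f: "test_function f"
  shows "test_function (\<lambda>y. - f y)" and "hyperbolic_Laplacian (\<lambda>y. - f y) y = - hyperbolic_Laplacian f y"
proof -
  have d: "f differentiable (at x)" "partial i f differentiable (at x)" for x i
    using f unfolding test_function_def C2_def C1_def by blast+
  have c: "continuous_on UNIV (partial i f)" "continuous_on UNIV (partial j (partial i f))" for i j
    using f unfolding test_function_def C2_def C1_def by blast+
  have p: "partial i (\<lambda>y. - g y) = (\<lambda>y. - partial i g y)"
    if "\<And>x. g differentiable (at x)" for g :: "real ^ 'n \<Rightarrow> real" and i
  proof
    fix y
    have "(g has_derivative frechet_derivative g (at y)) (at y)" using that frechet_derivative_works by blast
    from frechet_derivative_at[OF has_derivative_minus[OF this], symmetric]
    show "partial i (\<lambda>y. - g y) y = - partial i g y" by (simp add: partial_def)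
  qed
  note pp = p[of f, OF d(1)] p[OF d(2)]
  have "C1 (\<lambda>y. - f y)" unfolding C1_def pp using d c by (blast intro: continuous_on_minus differentiable_minus)
  moreover have "C1 (partial i (\<lambda>y. - f y))" for i
    unfolding C1_def pp using d c by (blast intro: continuous_on_minus differentiable_minus)
  ultimately have "C2 (\<lambda>y. - f y)" unfolding C2_def by blast
  moreover have "{x. - f x \<noteq> 0} = {x. f x \<noteq> 0}" by simp
  ultimately show "test_function (\<lambda>y. - f y)" using f unfolding test_function_def by simp
  show "hyperbolic_Laplacian (\<lambda>y. - f y) y = - hyperbolic_Laplacian f y"
    unfolding hyperbolic_Laplacian_def pp by (simp add: sum_negf)
qed

context hyperbolic_motion
begin

text \<open>The exit time truncated at \<open>t\<close>, as a real number.\<close>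

definition stop :: "real \<Rightarrow> real \<Rightarrow> 'w \<Rightarrow> real" where
  "stop r t \<omega> = enn2real (min (exit_time r X \<omega>) (ennreal t))"

lemma stop_bounds: "0 \<le> stop r t \<omega>" "t \<ge> 0 \<Longrightarrow> stop r t \<omega> \<le> t"
proof -
  show "0 \<le> stop r t \<omega>" by (simp add: stop_def)
  assume "t \<ge> 0"
  have "stop r t \<omega> \<le> enn2real (ennreal t)"
    unfolding stop_def by (intro enn2real_mono) auto
  then show "stop r t \<omega> \<le> t" using \<open>t \<ge> 0\<close> by simp
qed

lemma stop_le_iff:
  assumes "0 \<le> u" "u < t"
  shows "stop r t \<omega> \<le> u \<longleftrightarrow> exit_time r X \<omega> \<le> ennreal u"
proof -
  define m where "m = min (exit_time r X \<omega>) (ennreal t)"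
  have "m < top" by (simp add: m_def min_less_iff_disj)
  then have "ennreal (enn2real m) = m" by simp
  then have "enn2real m \<le> u \<longleftrightarrow> m \<le> ennreal u"
    using ennreal_leI[of "enn2real m" u] enn2real_leI[OF \<open>0 \<le> u\<close>, of m] by auto
  then have "stop r t \<omega> \<le> u \<longleftrightarrow> min (exit_time r X \<omega>) (ennreal t) \<le> ennreal u"
    unfolding stop_def m_def .
  also have "\<dots> \<longleftrightarrow> exit_time r X \<omega> \<le> ennreal u"
    using assms by (simp add: min_le_iff_disj ennreal_le_iff)
  finally show ?thesis .
qed

lemma stop_le_measurable:
  assumes "t > 0" "u \<ge> 0"
  shows "{\<omega>\<in>space M. stop r t \<omega> \<le> u} \<in> sets (natural_filtration M X u)"
proof (cases "u < t")
  case True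
  then show ?thesis
    using hitting_set_measurable[OF X_continuous assms(2), where r = r] stop_le_iff[OF assms(2) True] by simp
next
  case False
  then have "{\<omega>\<in>space M. stop r t \<omega> \<le> u} = space M"
    using assms by (auto simp: not_less intro: order_trans[OF stop_bounds(2)])
  moreover have "space M = space (natural_filtration M X u)" by (simp add: natural_filtration_def space_measure_of_conv)
  ultimately show ?thesis by (simp only: sets.top)
qed

lemma exit_time_measurable [measurable]: "exit_time r X \<in> borel_measurable M"
proof (rule borel_measurableI_le)
  fix y :: ennreal
  show "{\<omega> \<in> space M. exit_time r X \<omega> \<le> y} \<in> sets M"
  proof (cases y)
    case (real u)
    have "{\<omega> \<in> space M. exit_time r X \<omega> \<le> ennreal u} \<in> sets (natural_filtration M X u)"
      by (rule hitting_set_measurable) (use X_continuous real in auto)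
    moreover have "subalgebra M (natural_filtration M X u)"
      by (rule natural_filtration_subalgebra) (rule X_measurable)
    ultimately show ?thesis unfolding real by (auto simp: subalgebra_def)
  qed simp
qed

lemma stop_measurable [measurable]: "stop r t \<in> borel_measurable M"
  unfolding stop_def[abs_def] by measurable

lemma stopped_measurable [measurable]: "(\<lambda>\<omega>. X (stop r t \<omega>) \<omega>) \<in> borel_measurable M"
  by (rule random_time_measurable[OF X_measurable X_continuous stop_measurable stop_bounds(1)])

lemma exit_position_measurable [measurable]: "exit_position r X \<in> borel_measurable M"
  unfolding exit_position_def[abs_def]
  by (rule random_time_measurable[OF X_measurable X_continuous]) auto

lemma before_stop:
  assumes "\<omega> \<in> space M" "0 \<le> s" "s < stop r t \<omega>"
  shows "norm (X s \<omega>) < r"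
proof -
  have "stop r t \<omega> \<le> s" if "exit_time r X \<omega> \<le> ennreal s"
  proof -
    have "min (exit_time r X \<omega>) (ennreal t) \<le> ennreal s" using that by (simp add: min_le_iff_disj)
    then show ?thesis unfolding stop_def using assms(2) by (simp add: enn2real_leI)
  qed
  then have "\<not> exit_time r X \<omega> \<le> ennreal s" using assms(3) by auto
  then show ?thesis
    using exit_time_le_iff[where X = X and \<omega> = \<omega> and u = s and r = r, OF X_continuous[OF assms(1)] assms(2)] assms(2) by (auto simp: not_le)
qed

text \<open>Optional stopping for the martingale of \<open>f\<close>.  A lower bound \<open>\<kappa>\<close> of the Laplacian inside the ball serves two purposes: with
\<open>\<kappa> > 0\<close> it bounds the mean exit time, and with \<open>\<kappa> = 0\<close>, applied to \<open>f\<close> and \<open>- f\<close>, it gives an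
equality for harmonic functions.\<close>

lemma dynkin_inequality:
  assumes f: "test_function f" and L: "\<And>y. norm y < r \<Longrightarrow> \<kappa> \<le> hyperbolic_Laplacian f y" and t: "t > 0"
  shows "f x + \<kappa> * (\<integral>\<omega>. stop r t \<omega> \<partial>M) \<le> (\<integral>\<omega>. f (X (stop r t \<omega>) \<omega>) \<partial>M)"
proof -
  note cf = continuous_on_hyperbolic_Laplacian[OF f]
  obtain B where B: "B \<ge> 0" "\<And>y. norm y < 1 \<Longrightarrow> \<bar>f y\<bar> \<le> B" using bounded_on_unit_ball[OF cf(1)] by blast
  obtain B' where B': "B' \<ge> 0" "\<And>y. norm y < 1 \<Longrightarrow> \<bar>hyperbolic_Laplacian f y\<bar> \<le> B'"
    using bounded_on_unit_ball[OF cf(2)] by blast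
  define g where "g \<omega> s = hyperbolic_Laplacian f (X s \<omega>)" for \<omega> s
  define N where "N u \<omega> = f (X u \<omega>) - f (X 0 \<omega>) - (LINT s:{0..u}|lborel. g \<omega> s)" for u \<omega>
  have N: "martingale M (natural_filtration M X) N"
    using X_martingale[OF f] unfolding N_def[abs_def] g_def .
  have sub: "subalgebra M (natural_filtration M X u)" for u
    by (rule natural_filtration_subalgebra[OF X_measurable])
  have cX: "continuous_on {0..u} (\<lambda>s. X s \<omega>)" if "\<omega> \<in> space M" for \<omega> u
    by (rule continuous_on_subset[OF X_continuous[OF that]]) auto
  have cg: "continuous_on {0..u} (g \<omega>)" if "\<omega> \<in> space M" for \<omega> u
    unfolding g_def[abs_def] by (rule continuous_on_compose2[OF cf(2) cX[OF that]]) auto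
  have I: "(LINT s:{0..u}|lborel. g \<omega> s) = integral {0..u} (g \<omega>)" if "\<omega> \<in> space M" for \<omega> u
    by (rule set_borel_integral_eq_integral(2)[OF borel_integrable_atLeastAtMost'[OF cg[OF that]]])
  have gi: "g \<omega> integrable_on {0..u}" if "\<omega> \<in> space M" for \<omega> u
    by (rule integrable_continuous_interval[OF cg[OF that]])
  have cN: "continuous_on {0..t} (\<lambda>u. N u \<omega>)" if w: "\<omega> \<in> space M" for \<omega>
    unfolding N_def I[OF w]
    by (intro continuous_intros indefinite_integral_continuous_1 gi[OF w] continuous_on_compose2[OF cf(1) cX[OF w]]) auto
  have bN: "\<bar>N u \<omega>\<bar> \<le> 2 * B + t * B'" if w: "\<omega> \<in> space M" and u: "0 \<le> u" "u \<le> t" for \<omega> u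
  proof -
    have "norm (integral {0..u} (g \<omega>)) \<le> B' * (u - 0)"
      by (rule integral_bound[OF u(1) cg[OF w]]) (use B'(2) X_in_ball[OF w] in \<open>auto simp: g_def\<close>)
    also have "\<dots> \<le> t * B'" using u B'(1) by (simp add: mult.commute mult_left_mono)
    finally have "\<bar>integral {0..u} (g \<omega>)\<bar> \<le> t * B'" by simp
    then show ?thesis
      unfolding N_def I[OF w] using B(2)[OF X_in_ball[OF w u(1)]] B(2)[OF X_in_ball[OF w, of 0]] by auto
  qed
  note os = optional_stopping[OF prob_space_axioms sub N _ stop_le_measurable[OF t, of _ r] t cN bN]
  have iN: "integrable M (\<lambda>\<omega>. N (stop r t \<omega>) \<omega>)"
    and eN: "(\<integral>\<omega>. N (stop r t \<omega>) \<omega> \<partial>M) = (\<integral>\<omega>. N 0 \<omega> \<partial>M)"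
    using os stop_bounds t by auto
  have "N 0 \<omega> = 0" if "\<omega> \<in> space M" for \<omega> unfolding N_def I[OF that] by simp
  then have "(\<integral>\<omega>. N 0 \<omega> \<partial>M) = 0"
    using Bochner_Integration.integral_cong[OF refl, of M "N 0" "\<lambda>_. 0"] by simp
  with eN have eN: "(\<integral>\<omega>. N (stop r t \<omega>) \<omega> \<partial>M) = 0" by simp
  have Lx: "\<kappa> * stop r t \<omega> \<le> integral {0..stop r t \<omega>} (g \<omega>)" if w: "\<omega> \<in> space M" for \<omega>
  proof (cases "stop r t \<omega> = 0")
    case False
    define T where "T = stop r t \<omega>"
    have T: "T > 0" using False stop_bounds(1)[of r t \<omega>] by (simp add: T_def)
    have cl: "closure {0..<T} = {0..T}" using T by simp
    have "\<kappa> \<le> g \<omega> s" if s: "s \<in> {0..T}" for s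
    proof (rule continuous_ge_on_closure[where S = "{0..<T}" and f = "g \<omega>"])
      show "continuous_on (closure {0..<T}) (g \<omega>)" unfolding cl by (rule cg[OF w])
      show "s \<in> closure {0..<T}" using s cl by simp
      show "\<kappa> \<le> g \<omega> u" if "u \<in> {0..<T}" for u
        unfolding g_def using that before_stop[OF w, of u r t] by (intro L) (auto simp: T_def)
    qed
    then have "integral {0..T} (\<lambda>_. \<kappa>) \<le> integral {0..T} (g \<omega>)"
      by (intro integral_le gi[OF w]) auto
    then show ?thesis using T by (simp add: T_def mult.commute)
  qed simp
  have meas: "(\<lambda>\<omega>. f (X u \<omega>)) \<in> borel_measurable M" if "u \<ge> 0" for u
    by (rule measurable_compose[OF X_measurable[OF that] borel_measurable_continuous_onI[OF cf(1)]])
  have meas': "(\<lambda>\<omega>. f (X (stop r t \<omega>) \<omega>)) \<in> borel_measurable M"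
    by (rule measurable_compose[OF stopped_measurable borel_measurable_continuous_onI[OF cf(1)]])
  have if0: "integrable M (\<lambda>\<omega>. f (X 0 \<omega>))"
    by (rule integrable_const_bound[where B = B]) (use B(2) X_in_ball meas in \<open>auto intro!: AE_I2\<close>)
  have ifT: "integrable M (\<lambda>\<omega>. f (X (stop r t \<omega>) \<omega>))"
    by (rule integrable_const_bound[where B = B]) (use B(2) X_in_ball stop_bounds meas' in \<open>auto intro!: AE_I2\<close>)
  have iT: "integrable M (\<lambda>\<omega>. stop r t \<omega>)"
    by (rule integrable_const_bound[where B = t]) (use stop_bounds t in \<open>auto intro!: AE_I2\<close>)
  have "(\<integral>\<omega>. f (X 0 \<omega>) \<partial>M) = (\<integral>\<omega>. f x \<partial>M)"
    using X_start meas by (intro integral_cong_AE) (auto elim!: eventually_mono)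
  then have fx: "(\<integral>\<omega>. f (X 0 \<omega>) \<partial>M) = f x" by (simp add: prob_space)
  have "(\<integral>\<omega>. N (stop r t \<omega>) \<omega> + f (X 0 \<omega>) + \<kappa> * stop r t \<omega> \<partial>M) \<le> (\<integral>\<omega>. f (X (stop r t \<omega>) \<omega>) \<partial>M)"
  proof (rule integral_mono)
    show "integrable M (\<lambda>\<omega>. N (stop r t \<omega>) \<omega> + f (X 0 \<omega>) + \<kappa> * stop r t \<omega>)"
      by (intro Bochner_Integration.integrable_add integrable_mult_right iN if0 iT)
    show "N (stop r t \<omega>) \<omega> + f (X 0 \<omega>) + \<kappa> * stop r t \<omega> \<le> f (X (stop r t \<omega>) \<omega>)" if "\<omega> \<in> space M" for \<omega>
      using Lx[OF that] unfolding N_def I[OF that] by linarith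
  qed (rule ifT)
  also have "(\<integral>\<omega>. N (stop r t \<omega>) \<omega> + f (X 0 \<omega>) + \<kappa> * stop r t \<omega> \<partial>M) = f x + \<kappa> * (\<integral>\<omega>. stop r t \<omega> \<partial>M)"
    using iN if0 iT eN fx by simp
  finally show ?thesis .
qed

lemma exit_position_eq_stopped:
  assumes "exit_time r X \<omega> < \<infinity>"
  shows "\<forall>\<^sub>F n in sequentially. X (stop r (real n) \<omega>) \<omega> = exit_position r X \<omega>"
proof -
  obtain s where s: "s \<ge> 0" "exit_time r X \<omega> = ennreal s"
    using assms by (cases "exit_time r X \<omega>") auto
  have "stop r (real n) \<omega> = s" if "n \<ge> nat \<lceil>s\<rceil>" for n
  proof -
    have "s \<le> real n" using that by linarith
    then show ?thesis using s by (simp add: stop_def min_def ennreal_leI)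
  qed
  then show ?thesis
    unfolding eventually_sequentially exit_position_def using s by (intro exI[of _ "nat \<lceil>s\<rceil>"]) auto
qed

text \<open>For \<open>f = |x|\<^sup>2\<close> the Laplacian is at least some \<open>\<kappa> > 0\<close> on the ball, whereas \<open>f\<close> is bounded; so \<open>\<kappa>\<close> times
the mean of the exit time truncated at \<open>t\<close> is bounded uniformly in \<open>t\<close>.\<close>

lemma exit_time_finite:
  assumes r: "0 < r" "r < 1" and n: "CARD('n) \<ge> 2"
  shows "AE \<omega> in M. exit_time r X \<omega> < \<infinity>"
proof -
  obtain f :: "real ^ 'n \<Rightarrow> real" where f: "test_function f"
    and L: "\<And>x. norm x \<le> r \<Longrightarrow> hyperbolic_Laplacian f x =
       (1 - x \<bullet> x)\<^sup>2 * (2 * real CARD('n)) + 2 * (real CARD('n) - 2) * (1 - x \<bullet> x) * (2 * (x \<bullet> x))"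
    using square_test_function[OF r, where 'n = 'n] by blast
  obtain B where B: "B \<ge> 0" "\<And>y. norm y < 1 \<Longrightarrow> \<bar>f y\<bar> \<le> B"
    using bounded_on_unit_ball[OF continuous_on_hyperbolic_Laplacian(1)[OF f]] by blast
  define \<kappa> where "\<kappa> = (1 - r\<^sup>2)\<^sup>2 * (2 * real CARD('n))"
  have r2: "r\<^sup>2 < 1" using r by (simp add: power_less_one_iff)
  then have \<kappa>: "\<kappa> > 0" using n by (simp add: \<kappa>_def)
  have le: "\<kappa> \<le> hyperbolic_Laplacian f y" if y: "norm y < r" for y
  proof -
    have q: "0 \<le> y \<bullet> y" "y \<bullet> y \<le> r\<^sup>2" using y by (auto simp: power2_norm_eq_inner[symmetric] power_mono)
    have "\<kappa> \<le> (1 - y \<bullet> y)\<^sup>2 * (2 * real CARD('n))"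
      unfolding \<kappa>_def using q r2 by (intro mult_right_mono power_mono) auto
    moreover have "0 \<le> 2 * (real CARD('n) - 2) * (1 - y \<bullet> y) * (2 * (y \<bullet> y))"
      using q r2 n by (intro mult_nonneg_nonneg) auto
    ultimately show ?thesis using L[OF less_imp_le[OF y]] by linarith
  qed
  define p where "p = prob {\<omega>\<in>space M. exit_time r X \<omega> = \<infinity>}"
  have "\<kappa> * (t * p) \<le> 2 * B" if t: "t > 0" for t :: real
  proof -
    have "t * p = (\<integral>\<omega>. t * indicator {\<omega>\<in>space M. exit_time r X \<omega> = \<infinity>} \<omega> \<partial>M)"
      by (simp add: p_def)
    also have "\<dots> \<le> (\<integral>\<omega>. stop r t \<omega> \<partial>M)"
    proof (rule integral_mono)
      show "integrable M (stop r t)"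
        by (rule integrable_const_bound[where B = t]) (use stop_bounds t in \<open>auto intro!: AE_I2\<close>)
      show "t * indicator {\<omega>\<in>space M. exit_time r X \<omega> = \<infinity>} \<omega> \<le> stop r t \<omega>" for \<omega>
        using stop_bounds(1)[of r t \<omega>] t by (auto simp: indicator_def stop_def)
      have "{\<omega>\<in>space M. exit_time r X \<omega> = \<infinity>} \<in> sets M" by measurable
      then show "integrable M (\<lambda>\<omega>. t * indicator {\<omega>\<in>space M. exit_time r X \<omega> = \<infinity>} \<omega>)"
        by (intro integrable_mult_right integrable_real_indicator) (simp_all add: less_top[symmetric])
    qed
    finally have "\<kappa> * (t * p) \<le> \<kappa> * (\<integral>\<omega>. stop r t \<omega> \<partial>M)" using \<kappa> by simp
    also have "\<dots> \<le> (\<integral>\<omega>. f (X (stop r t \<omega>) \<omega>) \<partial>M) - f x"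
      using dynkin_inequality[where r = r, OF f le t] by simp
    also have "\<dots> \<le> B + B"
    proof (rule diff_mono[of _ _ "- B" "f x", simplified])
      have "(\<integral>\<omega>. f (X (stop r t \<omega>) \<omega>) \<partial>M) \<le> (\<integral>\<omega>. B \<partial>M)"
        by (rule integral_mono') (use B X_in_ball stop_bounds(1) in \<open>auto simp: abs_le_iff\<close>)
      then show "(\<integral>\<omega>. f (X (stop r t \<omega>) \<omega>) \<partial>M) \<le> B" by (simp add: prob_space)
      have "\<exists>\<omega>\<in>space M. X 0 \<omega> = x"
      proof (rule ccontr)
        assume none: "\<not> (\<exists>\<omega>\<in>space M. X 0 \<omega> = x)"
        have "AE \<omega> in M. \<omega> \<in> space M \<and> X 0 \<omega> = x" using X_start AE_space by eventually_elim simp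
        then have "AE \<omega> in M. False" by (rule eventually_mono) (use none in auto)
        then show False by simp
      qed
      then obtain \<omega> where "\<omega> \<in> space M" "X 0 \<omega> = x" by blast
      then show "- B \<le> f x" using B(2)[of x] X_in_ball[of \<omega> 0] by (auto simp: abs_le_iff)
    qed
    finally show ?thesis by simp
  qed
  moreover have "p \<le> (2 * B / \<kappa>) * inverse m" if "\<kappa> * (m * p) \<le> 2 * B" "m > 0" for m
    using that \<kappa> by (simp add: field_simps)
  ultimately have le: "p \<le> (2 * B / \<kappa>) * inverse (real (Suc n))" for n by simp
  have "p \<le> 0"
  proof (rule LIMSEQ_le_const[where X = "\<lambda>n. (2 * B / \<kappa>) * inverse (real (Suc n))"])
    show "(\<lambda>n. (2 * B / \<kappa>) * inverse (real (Suc n))) \<longlonglongrightarrow> 0"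
      by (rule tendsto_mult_right_zero[OF LIMSEQ_inverse_real_of_nat])
  qed (use le in auto)
  then have "p = 0" by (simp add: p_def measure_nonneg antisym)
  then have "{\<omega>\<in>space M. exit_time r X \<omega> = \<infinity>} \<in> null_sets M"
    unfolding p_def by (intro null_setsI) (auto simp: emeasure_eq_measure)
  then show ?thesis by (rule AE_I') (auto simp: less_top[symmetric])
qed

lemma exit_position_expectation:
  assumes r: "0 < r" "r < 1" and n: "CARD('n) \<ge> 2"
    and f: "test_function f" and L: "\<And>y. norm y \<le> r \<Longrightarrow> hyperbolic_Laplacian f y = 0"
  shows "(\<integral>\<omega>. f (exit_position r X \<omega>) \<partial>M) = f x"
proof -
  note cf = continuous_on_hyperbolic_Laplacian(1)[OF f]
  obtain B where B: "B \<ge> 0" "\<And>y. norm y < 1 \<Longrightarrow> \<bar>f y\<bar> \<le> B"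
    using bounded_on_unit_ball[OF cf] by blast
  have mf [measurable]: "f \<in> borel_measurable borel" by (rule borel_measurable_continuous_onI[OF cf])
  have stop: "(\<integral>\<omega>. f (X (stop r t \<omega>) \<omega>) \<partial>M) = f x" if "t > 0" for t
  proof (rule antisym)
    show "f x \<le> (\<integral>\<omega>. f (X (stop r t \<omega>) \<omega>) \<partial>M)"
      using dynkin_inequality[where r = r and \<kappa> = 0, OF f _ that] L by simp
    note minus = test_function_uminus[OF f]
    have "- f x + 0 * (\<integral>\<omega>. stop r t \<omega> \<partial>M) \<le> (\<integral>\<omega>. - f (X (stop r t \<omega>) \<omega>) \<partial>M)"
      by (rule dynkin_inequality[OF minus(1) _ that]) (simp add: minus(2) L)
    then show "(\<integral>\<omega>. f (X (stop r t \<omega>) \<omega>) \<partial>M) \<le> f x" by simp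
  qed
  have lim: "(\<lambda>n. \<integral>\<omega>. f (X (stop r (real n) \<omega>) \<omega>) \<partial>M) \<longlonglongrightarrow> (\<integral>\<omega>. f (exit_position r X \<omega>) \<partial>M)"
  proof (rule integral_dominated_convergence[where w = "\<lambda>_. B"])
    show "AE \<omega> in M. (\<lambda>n. f (X (stop r (real n) \<omega>) \<omega>)) \<longlonglongrightarrow> f (exit_position r X \<omega>)"
      using exit_time_finite[OF r n]
    proof eventually_elim
      case (elim \<omega>)
      from exit_position_eq_stopped[OF this]
      have "\<forall>\<^sub>F n in sequentially. f (X (stop r (real n) \<omega>) \<omega>) = f (exit_position r X \<omega>)"
        by (auto elim: eventually_mono)
      then show ?case by (rule tendsto_eventually)
    qed
    show "AE \<omega> in M. norm (f (X (stop r (real n) \<omega>) \<omega>)) \<le> B" for n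
      using B(2) X_in_ball stop_bounds(1) by (auto intro!: AE_I2)
  qed (simp_all add: measurable_compose[OF _ mf])
  have "\<forall>\<^sub>F n in sequentially. (\<integral>\<omega>. f (X (stop r (real n) \<omega>) \<omega>) \<partial>M) = f x"
    using eventually_gt_at_top[of 0] by eventually_elim (simp add: stop)
  from LIMSEQ_unique[OF lim tendsto_eventually[OF this]] show ?thesis .
qed

lemma exit_position_on_sphere:
  assumes r: "0 < r" "r < 1" and n: "CARD('n) \<ge> 2" and x: "norm x < r"
  shows "AE \<omega> in M. norm (exit_position r X \<omega>) = r"
  using exit_time_finite[OF r n] X_start AE_space
proof eventually_elim
  case (elim \<omega>)
  note c = X_continuous[OF elim(3)]
  from c show ?case
  proof (cases rule: exit_time_cases[of X \<omega> r])
    case infinite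
    then show ?thesis using elim(1) by simp
  next
    case (finite s)
    have s: "s > 0" using finite(1,3) elim(2) x by (cases "s = 0") auto
    have cl: "closure {0..<s} = {0..s}" using s by simp
    have "norm (X s \<omega>) \<le> r"
    proof (rule continuous_le_on_closure[where S = "{0..<s}" and f = "\<lambda>t. norm (X t \<omega>)"])
      show "continuous_on (closure {0..<s}) (\<lambda>t. norm (X t \<omega>))"
        unfolding cl by (intro continuous_intros continuous_on_subset[OF c]) auto
      show "s \<in> closure {0..<s}" unfolding cl using s by simp
      show "norm (X t \<omega>) \<le> r" if "t \<in> {0..<s}" for t using finite(4) that by (auto intro: less_imp_le)
    qed
    then show ?thesis using finite by (simp add: exit_position_def)
  qed
qed

end

section \<open>The surface measure of a sphere\<close>

text \<open>By Vitali's theorem an open set is covered up to a null set by disjoint balls inside it, and an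
orthogonal transformation maps balls to balls of the same radius.\<close>

lemma emeasure_lborel_open_le_orthogonal_image:
  fixes T :: "'a::euclidean_space \<Rightarrow> 'a"
  assumes T: "orthogonal_transformation T" and U: "open U"
  shows "emeasure lborel U \<le> emeasure lborel (T ` U)"
proof -
  define K where "K = {i :: 'a \<times> real. 0 < snd i \<and> ball (fst i) (snd i) \<subseteq> U}"
  have cover: "\<exists>i. i \<in> K \<and> x \<in> ball (fst i) (snd i) \<and> snd i < d" if "x \<in> U" "0 < d" for x d
  proof -
    obtain e where "e > 0" "ball x e \<subseteq> U" using U \<open>x \<in> U\<close> open_contains_ball by blast
    moreover have "ball x (min e (d / 2)) \<subseteq> ball x e" by (simp add: subset_ball)
    ultimately have "(x, min e (d / 2)) \<in> K" using that by (auto simp: K_def)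
    then show ?thesis using that \<open>e > 0\<close> by (intro exI[of _ "(x, min e (d / 2))"]) auto
  qed
  obtain C where C: "countable C" "C \<subseteq> K"
    "pairwise (\<lambda>i j. disjnt (ball (fst i) (snd i)) (ball (fst j) (snd j))) C"
    "negligible (U - (\<Union>i\<in>C. ball (fst i) (snd i)))"
    using Vitali_covering_theorem_balls[of U K fst snd, OF cover] by blast
  have inj: "inj T" using T by (simp add: orthogonal_transformation_inj)
  have img: "T ` ball c e = ball (T c) e" for c e
    by (rule image_orthogonal_transformation_ball[OF T])
  have d1: "disjoint_family_on (\<lambda>i. ball (fst i) (snd i)) C"
    using C(3) by (auto simp: disjoint_family_on_def pairwise_def disjnt_def)
  have d2: "disjoint_family_on (\<lambda>i. T ` ball (fst i) (snd i)) C"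
    unfolding disjoint_family_on_def
  proof (intro ballI impI)
    fix i j assume "i \<in> C" "j \<in> C" "i \<noteq> j"
    then have "ball (fst i) (snd i) \<inter> ball (fst j) (snd j) = {}" using d1 by (simp add: disjoint_family_on_def)
    then show "T ` ball (fst i) (snd i) \<inter> T ` ball (fst j) (snd j) = {}"
      using inj by (metis image_Int image_empty)
  qed
  have N: "emeasure lborel (U - (\<Union>i\<in>C. ball (fst i) (snd i))) = 0"
  proof -
    have "U - (\<Union>i\<in>C. ball (fst i) (snd i)) \<in> sets borel" using U C(1) by (intro sets.Diff sets.countable_UN') auto
    then show ?thesis using C(4) by (simp add: negligible_iff_null_sets null_sets_completion_iff null_setsD1)
  qed
  have "emeasure lborel U \<le> emeasure lborel ((\<Union>i\<in>C. ball (fst i) (snd i)) \<union> (U - (\<Union>i\<in>C. ball (fst i) (snd i))))"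
    using U C(1) by (intro emeasure_mono sets.Un sets.Diff sets.countable_UN') auto
  also have "\<dots> \<le> emeasure lborel (\<Union>i\<in>C. ball (fst i) (snd i)) + emeasure lborel (U - (\<Union>i\<in>C. ball (fst i) (snd i)))"
    using U C(1) by (intro emeasure_subadditive sets.Diff sets.countable_UN') auto
  also have "\<dots> = (\<integral>\<^sup>+i. emeasure lborel (ball (fst i) (snd i)) \<partial>count_space C)"
    unfolding N using C(1) d1 by (simp add: emeasure_UN_countable)
  also have "\<dots> = (\<integral>\<^sup>+i. emeasure lborel (T ` ball (fst i) (snd i)) \<partial>count_space C)"
    using C(2) by (intro nn_integral_cong) (auto simp: img emeasure_ball K_def)
  also have "\<dots> = emeasure lborel (\<Union>i\<in>C. T ` ball (fst i) (snd i))"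
    using C(1) d2 by (intro emeasure_UN_countable[symmetric]) (auto simp: img)
  also have "\<dots> \<le> emeasure lborel (T ` U)"
  proof (rule emeasure_mono)
    have "open (T ` U)" using open_bijective_linear_image_eq[of T U] T U
      by (simp add: orthogonal_transformation_linear orthogonal_transformation_bij)
    then show "T ` U \<in> sets lborel" by simp
    show "(\<Union>i\<in>C. T ` ball (fst i) (snd i)) \<subseteq> T ` U" using C(2) by (auto simp: K_def)
  qed
  finally show ?thesis .
qed

lemma lborel_orthogonal_transformation:
  fixes T :: "'a::euclidean_space \<Rightarrow> 'a"
  assumes T: "orthogonal_transformation T"
  shows "distr lborel borel T = lborel"
proof (rule lborel_eqI[symmetric])
  have [measurable]: "T \<in> borel_measurable borel"
    using T by (intro borel_measurable_continuous_onI linear_continuous_on)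
      (simp add: orthogonal_transformation_linear linear_conv_bounded_linear[symmetric])
  have inv: "orthogonal_transformation (inv T)" "bij T"
    using T by (simp_all add: orthogonal_transformation_inv orthogonal_transformation_bij)
  fix l u :: 'a assume le: "\<And>b. b \<in> Basis \<Longrightarrow> l \<bullet> b \<le> u \<bullet> b"
  have vim: "T -` box l u = inv T ` box l u" using inv(2) by (simp add: bij_vimage_eq_inv_image)
  have op: "open (T -` box l u)"
    using T by (intro open_vimage open_box linear_continuous_on)
      (simp add: orthogonal_transformation_linear linear_conv_bounded_linear[symmetric])
  have "emeasure lborel (box l u) \<le> emeasure lborel (T -` box l u)"
    unfolding vim by (rule emeasure_lborel_open_le_orthogonal_image[OF inv(1) open_box])
  moreover have "emeasure lborel (T -` box l u) \<le> emeasure lborel (T ` (T -` box l u))"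
    by (rule emeasure_lborel_open_le_orthogonal_image[OF T op])
  moreover have "T ` (T -` box l u) = box l u" using inv(2) by (simp add: bij_is_surj surj_image_vimage_eq)
  ultimately have "emeasure (distr lborel borel T) (box l u) = emeasure lborel (box l u)"
    by (simp add: emeasure_distr)
  then show "emeasure (distr lborel borel T) (box l u) = (\<Prod>b\<in>Basis. (u - l) \<bullet> b)"
    using le by (simp add: emeasure_lborel_box)
qed simp

lemma sets_sphere_measure [simp, measurable_cong]: "sets (sphere_measure r) = sets borel"
  and space_sphere_measure [simp]: "space (sphere_measure r) = UNIV"
  by (simp_all add: sphere_measure_def)

lemma emeasure_sphere_measure:
  assumes A: "A \<in> sets borel"
  shows "emeasure (sphere_measure r :: (real ^ 'n) measure) A =
    (\<integral>\<^sup>+z. ennreal (real CARD('n) / r) * indicator (ball 0 r) z * indicator A ((r / norm z) *\<^sub>R z) \<partial>lborel)"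
proof -
  have [measurable]: "(\<lambda>z::real ^ 'n. (r / norm z) *\<^sub>R z) \<in> borel_measurable borel" by measurable
  have B: "(\<lambda>z::real ^ 'n. (r / norm z) *\<^sub>R z) -` A \<in> sets borel"
    using measurable_sets[of "\<lambda>z::real ^ 'n. (r / norm z) *\<^sub>R z" borel borel A] A by simp
  have "emeasure (sphere_measure r :: (real ^ 'n) measure) A
     = emeasure (density lborel (\<lambda>z. ennreal (real CARD('n) / r) * indicator (ball 0 r) z)) ((\<lambda>z::real ^ 'n. (r / norm z) *\<^sub>R z) -` A)"
    unfolding sphere_measure_def using A by (simp add: emeasure_distr)
  also have "\<dots> = (\<integral>\<^sup>+z. ennreal (real CARD('n) / r) * indicator (ball 0 r) z * indicator ((\<lambda>z::real ^ 'n. (r / norm z) *\<^sub>R z) -` A) z \<partial>lborel)"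
  proof (rule emeasure_density)
    have [measurable]: "ball (0 :: real ^ 'n) r \<in> sets borel" by simp
    show "(\<lambda>z::real ^ 'n. ennreal (real CARD('n) / r) * indicator (ball 0 r) z) \<in> borel_measurable lborel" by measurable
  qed (use B in simp)
  finally show ?thesis by (simp add: indicator_def)
qed

lemma emeasure_sphere_measure_UNIV:
  assumes "r > 0"
  shows "emeasure (sphere_measure r :: (real ^ 'n) measure) UNIV =
    ennreal (real CARD('n) * unit_ball_vol (real CARD('n)) * r ^ (CARD('n) - 1))"
proof -
  have "emeasure (sphere_measure r :: (real ^ 'n) measure) UNIV = ennreal (real CARD('n) / r) * emeasure lborel (ball (0::real ^ 'n) r)"
    by (simp add: emeasure_sphere_measure nn_integral_cmult_indicator)
  also have "\<dots> = ennreal (real CARD('n) / r * (unit_ball_vol (real CARD('n)) * r ^ CARD('n)))"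
    using assms by (simp add: emeasure_ball ennreal_mult[symmetric])
  also have "r ^ CARD('n) = r * r ^ (CARD('n) - 1)"
    by (metis power_minus_mult zero_less_card_finite mult.commute)
  finally show ?thesis using assms by (simp add: mult.assoc)
qed

lemma finite_sphere_measure: "r > 0 \<Longrightarrow> finite_measure (sphere_measure r :: (real ^ 'n) measure)"
  by (intro finite_measureI) (simp add: emeasure_sphere_measure_UNIV)

lemma AE_sphere_measure:
  assumes "r > 0"
  shows "AE y in sphere_measure r. norm (y :: real ^ 'n) = r"
proof (rule AE_I)
  have "{y :: real ^ 'n. norm y \<noteq> r} \<in> sets borel" by measurable
  then have "emeasure (sphere_measure r) {y :: real ^ 'n. norm y \<noteq> r}
    = (\<integral>\<^sup>+z. ennreal (real CARD('n) / r) * indicator (ball 0 r) z * indicator {y :: real ^ 'n. norm y \<noteq> r} ((r / norm z) *\<^sub>R z) \<partial>lborel)"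
    by (rule emeasure_sphere_measure)
  also have "\<dots> = (\<integral>\<^sup>+z. 0 \<partial>(lborel :: (real ^ 'n) measure))"
  proof (rule nn_integral_cong_AE)
    have "AE z in lborel. z \<noteq> (0 :: real ^ 'n)" by (rule AE_lborel_singleton)
    then show "AE z in lborel. ennreal (real CARD('n) / r) * indicator (ball 0 r) z * indicator {y :: real ^ 'n. norm y \<noteq> r} ((r / norm z) *\<^sub>R z) = (0::ennreal)"
      by eventually_elim (use assms in \<open>auto simp: indicator_def\<close>)
  qed
  finally show "emeasure (sphere_measure r) {y :: real ^ 'n. norm y \<noteq> r} = 0" by simp
  show "{y :: real ^ 'n. norm y \<noteq> r} \<in> sets (sphere_measure r)" by simp
qed auto

text \<open>The cone over \<open>ball y e\<close> contains a small ball around \<open>y / 2\<close>.\<close>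

lemma sphere_measure_ball_pos:
  fixes y :: "real ^ 'n"
  assumes r: "r > 0" and y: "norm y = r" and e: "e > 0"
  shows "emeasure (sphere_measure r) (ball y e) > 0"
proof -
  have "((\<lambda>z. (r / norm z) *\<^sub>R z) \<longlongrightarrow> (r / norm ((1/2) *\<^sub>R y)) *\<^sub>R ((1/2) *\<^sub>R y)) (at ((1/2) *\<^sub>R y))"
    by (intro tendsto_intros) (use r y in auto)
  then have "continuous (at ((1/2) *\<^sub>R y)) (\<lambda>z. (r / norm z) *\<^sub>R z)" by (simp only: isCont_def)
  then obtain d where d: "d > 0" "\<And>z. dist z ((1/2) *\<^sub>R y) < d \<Longrightarrow>
      dist ((r / norm z) *\<^sub>R z) ((r / norm ((1/2) *\<^sub>R y)) *\<^sub>R ((1/2) *\<^sub>R y)) < e"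
    using e unfolding continuous_at_eps_delta by blast
  have eq: "(r / norm ((1/2) *\<^sub>R y)) *\<^sub>R ((1/2) *\<^sub>R y) = y" using r y by simp
  define d' where "d' = min d (r / 2)"
  have d': "d' > 0" using d r by (simp add: d'_def)
  have sub: "ball ((1/2) *\<^sub>R y) d' \<subseteq> ball 0 r"
  proof
    fix z assume "z \<in> ball ((1/2) *\<^sub>R y) d'"
    then have "norm (z - (1/2) *\<^sub>R y) < r / 2" by (simp add: dist_norm norm_minus_commute d'_def)
    moreover have "norm z \<le> norm (z - (1/2) *\<^sub>R y) + norm ((1/2) *\<^sub>R y)" by (metis diff_add_cancel norm_triangle_ineq)
    ultimately show "z \<in> ball 0 r" using y by simp
  qed
  have "0 < ennreal (real CARD('n) / r) * emeasure lborel (ball ((1/2) *\<^sub>R y) d')"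
    using r d' by (simp add: emeasure_ball ennreal_zero_less_mult_iff)
  also have "\<dots> = (\<integral>\<^sup>+z. ennreal (real CARD('n) / r) * indicator (ball ((1/2) *\<^sub>R y) d') z \<partial>lborel)"
    by (simp add: nn_integral_cmult_indicator)
  also have "\<dots> \<le> (\<integral>\<^sup>+z. ennreal (real CARD('n) / r) * indicator (ball 0 r) z * indicator (ball y e) ((r / norm z) *\<^sub>R z) \<partial>lborel)"
    using sub d(2)[unfolded eq] by (intro nn_integral_mono) (auto simp: indicator_def d'_def dist_commute)
  also have "\<dots> = emeasure (sphere_measure r) (ball y e)"
    by (rule emeasure_sphere_measure[symmetric]) simp
  finally show ?thesis .
qed

text \<open>Orthogonal transformations preserve the volume and commute with the radial projection.\<close>

lemma sphere_measure_orthogonal_transformation: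
  fixes T :: "real ^ 'n \<Rightarrow> real ^ 'n"
  assumes T: "orthogonal_transformation T"
  shows "distr (sphere_measure r) borel T = sphere_measure r"
proof (rule measure_eqI)
  have [measurable]: "T \<in> borel_measurable borel"
    using T by (intro borel_measurable_continuous_onI linear_continuous_on)
      (simp add: orthogonal_transformation_linear linear_conv_bounded_linear[symmetric])
  have lin: "T (c *\<^sub>R v) = c *\<^sub>R T v" "norm (T v) = norm v" for c v
    using T by (simp_all add: orthogonal_transformation_linear linear_scale orthogonal_transformation_norm)
  fix A assume "A \<in> sets (distr (sphere_measure r) borel T)"
  then have A [measurable]: "A \<in> sets borel" by simp
  have TA: "T -` A \<in> sets borel" using measurable_sets[of T borel borel A] A by simp
  let ?F = "\<lambda>z::real ^ 'n. ennreal (real CARD('n) / r) * indicator (ball 0 r) z * indicator A ((r / norm z) *\<^sub>R z)"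
  have "emeasure (distr (sphere_measure r) borel T) A = emeasure (sphere_measure r) (T -` A)"
    using A by (simp add: emeasure_distr)
  also have "\<dots> = (\<integral>\<^sup>+z. ?F (T z) \<partial>lborel)"
    unfolding emeasure_sphere_measure[OF TA] by (intro nn_integral_cong) (simp add: indicator_def lin)
  also have "\<dots> = (\<integral>\<^sup>+z. ?F z \<partial>distr lborel borel T)"
  proof (rule nn_integral_distr[symmetric])
    have [measurable]: "ball (0 :: real ^ 'n) r \<in> sets borel" by simp
    show "T \<in> lborel \<rightarrow>\<^sub>M borel" by measurable
    show "?F \<in> borel_measurable (distr lborel borel T)" by measurable
  qed
  also have "\<dots> = emeasure (sphere_measure r) A"
    unfolding lborel_orthogonal_transformation[OF T] emeasure_sphere_measure[OF A] ..
  finally show "emeasure (distr (sphere_measure r) borel T) A = emeasure (sphere_measure r) A" .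
qed simp

section \<open>Identification of a density on the sphere\<close>

text \<open>The indicator of a closed set is the decreasing limit of the functions \<open>max 0 (1 - k * infdist y C)\<close>.\<close>

lemma measure_eqI_continuous_functions:
  fixes \<mu> \<nu> :: "'a::metric_space measure"
  assumes fin: "finite_measure \<mu>" "finite_measure \<nu>" and sets: "sets \<mu> = sets borel" "sets \<nu> = sets borel"
    and eq: "\<And>\<phi> :: 'a \<Rightarrow> real. continuous_on UNIV \<phi> \<Longrightarrow> (\<And>y. 0 \<le> \<phi> y \<and> \<phi> y \<le> 1) \<Longrightarrow> (\<integral>y. \<phi> y \<partial>\<mu>) = (\<integral>y. \<phi> y \<partial>\<nu>)"
  shows "\<mu> = \<nu>"
proof -
  have closed_eq: "measure \<mu> C = measure \<nu> C" if C: "closed C" "C \<noteq> {}" for C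
  proof -
    define \<phi> where "\<phi> k y = max 0 (1 - real k * infdist y C)" for k y
    have c: "continuous_on UNIV (\<phi> k)" for k unfolding \<phi>_def[abs_def] by (intro continuous_intros)
    have b: "0 \<le> \<phi> k y \<and> \<phi> k y \<le> 1" for k y by (simp add: \<phi>_def infdist_nonneg)
    have lim: "(\<lambda>k. \<phi> k y) \<longlonglongrightarrow> indicator C y" for y
    proof (cases "y \<in> C")
      case True
      then show ?thesis by (simp add: \<phi>_def)
    next
      case False
      then have i: "infdist y C > 0"
        using C by (metis in_closed_iff_infdist_zero infdist_nonneg less_eq_real_def)
      have "\<phi> k y = 0" if "k \<ge> nat \<lceil>1 / infdist y C\<rceil>" for k
      proof -
        have "1 / infdist y C \<le> real k" using that by linarith
        then show ?thesis using i by (simp add: \<phi>_def pos_divide_le_eq)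
      qed
      then have "\<forall>\<^sub>F k in sequentially. \<phi> k y = 0" unfolding eventually_sequentially by blast
      then show ?thesis using False by (simp add: tendsto_eventually)
    qed
    have "(\<lambda>k. \<integral>y. \<phi> k y \<partial>M) \<longlonglongrightarrow> measure M C" if M: "finite_measure M" "sets M = sets borel" for M
    proof -
      interpret finite_measure M by fact
      have sp: "space M = UNIV" using M(2) sets_eq_imp_space_eq by fastforce
      have "(\<lambda>k. \<integral>y. \<phi> k y \<partial>M) \<longlonglongrightarrow> (\<integral>y. indicator C y \<partial>M)"
      proof (rule integral_dominated_convergence[where w = "\<lambda>_. 1"])
        show "\<phi> k \<in> borel_measurable M" for k
          using borel_measurable_continuous_onI[OF c] measurable_cong_sets[OF M(2) refl] by blast
        show "indicator C \<in> borel_measurable M" using C(1) M(2) by (intro borel_measurable_indicator) auto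
      qed (use lim b in auto)
      moreover have "(\<integral>y. indicator C y \<partial>M) = measure M C" using C(1) M(2) sp by simp
      ultimately show ?thesis by simp
    qed
    from this[OF fin(1) sets(1)] this[OF fin(2) sets(2)] show ?thesis
      unfolding eq[OF c b] by (rule LIMSEQ_unique)
  qed
  interpret a: finite_measure \<mu> by fact
  interpret b: finite_measure \<nu> by fact
  show ?thesis
  proof (rule measure_eqI_generator_eq[where E = "{C. closed C}" and \<Omega> = UNIV and A = "\<lambda>_. UNIV"])
    show "Int_stable {C :: 'a set. closed C}" by (auto simp: Int_stable_def)
    show "sets \<mu> = sigma_sets UNIV {C. closed C}" "sets \<nu> = sigma_sets UNIV {C. closed C}"
      using sets by (simp_all add: borel_eq_closed)
    show "emeasure \<mu> C = emeasure \<nu> C" if "C \<in> {C. closed C}" for C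
      using closed_eq[of C] that by (cases "C = {}") (auto simp: a.emeasure_eq_measure b.emeasure_eq_measure)
  qed auto
qed

lemma finite_measure_product_integrable:
  fixes f :: "'a \<times> 'b \<Rightarrow> real"
  assumes "finite_measure M" "finite_measure N"
    and "f \<in> borel_measurable (M \<Otimes>\<^sub>M N)" and "\<And>p. \<bar>f p\<bar> \<le> C"
  shows "integrable (M \<Otimes>\<^sub>M N) f"
proof -
  interpret finite_measure "M \<Otimes>\<^sub>M N" using assms(2,1) by (rule finite_measure_pair_measure)
  show ?thesis by (rule integrable_const_bound[where B = C]) (use assms in auto)
qed

text \<open>For \<open>z = t \<zeta>\<close> with \<open>\<zeta>\<close> on the sphere and \<open>t\<close> decreasing to \<open>1\<close> the quotients
\<open>K t y \<zeta> = (|z|\<^sup>2 - r\<^sup>2) / |y - z|\<^sup>n\<close> concentrate at \<open>y = \<zeta>\<close>.  Their integral over \<open>\<zeta>\<close> does not depend on \<open>y\<close> by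
rotation invariance, so it can be computed after averaging \<open>y\<close> over \<open>\<mu>\<^sub>0\<close>, where the second integral
hypothesis gives its value.  Hence \<open>\<integral> \<phi>(\<zeta>) K t y \<zeta> d\<zeta>\<close> tends to a known multiple of \<open>\<phi>(y)\<close>.  Integrating over \<open>\<mu>\<close>
and exchanging the integrals identifies \<open>\<integral> \<phi> d\<mu>\<close> with the integral of \<open>\<phi> \<Psi>\<close>.\<close>

lemma sphere_density_from_poisson_integrals:
  fixes \<mu> \<mu>\<^sub>0 :: "(real ^ 'n) measure" and \<Psi> :: "real ^ 'n \<Rightarrow> real"
  assumes r: "r > 0" and n: "CARD('n) \<ge> 2"
    and \<mu>: "prob_space \<mu>" "sets \<mu> = sets borel" "AE y in \<mu>. norm y = r"
    and \<mu>0: "prob_space \<mu>\<^sub>0" "sets \<mu>\<^sub>0 = sets borel" "AE y in \<mu>\<^sub>0. norm y = r"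
    and int: "\<And>z. norm z > r \<Longrightarrow> (\<integral>y. ((norm z)\<^sup>2 - (norm y)\<^sup>2) / norm (y - z) ^ CARD('n) \<partial>\<mu>) = \<Psi> z"
    and int0: "\<And>z. norm z > r \<Longrightarrow> (\<integral>y. ((norm z)\<^sup>2 - (norm y)\<^sup>2) / norm (y - z) ^ CARD('n) \<partial>\<mu>\<^sub>0) = 1 / norm z ^ (CARD('n) - 2)"
    and cont: "continuous_on {z. r \<le> norm z} \<Psi>"
  shows "\<And>y. norm y = r \<Longrightarrow> 0 \<le> \<Psi> y"
    and "\<mu> = density (sphere_measure r)
          (\<lambda>y. ennreal (if norm y = r then \<Psi> y / (real CARD('n) * unit_ball_vol (real CARD('n)) * r) else 0))"
proof -
  let ?n = "CARD('n)"
  define \<sigma> where "\<sigma> = (sphere_measure r :: (real ^ 'n) measure)"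
  define S where "S = {y :: real ^ 'n. norm y = r}"
  have S [measurable]: "S \<in> sets borel" unfolding S_def by measurable
  interpret \<mu>: prob_space \<mu> by fact
  interpret \<mu>0: prob_space \<mu>\<^sub>0 by fact
  interpret \<sigma>: finite_measure \<sigma> unfolding \<sigma>_def using r by (rule finite_sphere_measure)
  note [measurable_cong] = \<mu>(2) \<mu>0(2)
  have [measurable_cong, simp]: "sets \<sigma> = sets borel" by (simp add: \<sigma>_def)
  have AE\<sigma>: "AE y in \<sigma>. y \<in> S" unfolding \<sigma>_def S_def using AE_sphere_measure[OF r] by simp
  define tot where "tot = real ?n * unit_ball_vol (real ?n) * r ^ (?n - 1)"
  have tot: "measure \<sigma> (space \<sigma>) = tot" "tot > 0"
    unfolding tot_def using emeasure_sphere_measure_UNIV[OF r, where 'n = 'n] r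
    by (simp_all add: \<sigma>_def measure_def)
  define K where "K t y \<zeta> = indicator S y * (indicator S \<zeta> * ((t\<^sup>2 - 1) * r\<^sup>2 / norm (y - t *\<^sub>R \<zeta>) ^ ?n))" for t and y \<zeta> :: "real ^ 'n"
  have K_meas [measurable]: "(\<lambda>p. K t (fst p) (snd p)) \<in> borel_measurable (borel \<Otimes>\<^sub>M borel)"
    "(\<lambda>p. K t (snd p) (fst p)) \<in> borel_measurable (borel \<Otimes>\<^sub>M borel)" for t
    unfolding K_def by measurable
  have K_meas2 [measurable]: "K t y \<in> borel_measurable borel" "(\<lambda>y. K t y \<zeta>) \<in> borel_measurable borel" for t y \<zeta>
    unfolding K_def by measurable
  have far: "norm (y - t *\<^sub>R \<zeta>) \<ge> (t - 1) * r" if "y \<in> S" "\<zeta> \<in> S" "t > 1" for t y \<zeta>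
  proof -
    have "norm (t *\<^sub>R \<zeta>) - norm y \<le> norm (t *\<^sub>R \<zeta> - y)" by (rule norm_triangle_ineq2)
    then show ?thesis using that by (simp add: S_def norm_minus_commute left_diff_distrib)
  qed
  have K0: "0 \<le> K t y \<zeta>" if "t > 1" for t y \<zeta>
    using that by (auto simp: K_def indicator_def)
  have KC: "\<bar>K t y \<zeta>\<bar> \<le> (t\<^sup>2 - 1) * r\<^sup>2 / ((t - 1) * r) ^ ?n" if t: "t > 1" for t y \<zeta>
  proof (cases "y \<in> S \<and> \<zeta> \<in> S")
    case True
    then have "(t\<^sup>2 - 1) * r\<^sup>2 / norm (y - t *\<^sub>R \<zeta>) ^ ?n \<le> (t\<^sup>2 - 1) * r\<^sup>2 / ((t - 1) * r) ^ ?n"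
    proof -
      have "0 < (t - 1) * r" using t r by simp
      moreover from this have "0 < norm (y - t *\<^sub>R \<zeta>)" using far[of y \<zeta> t] True t by linarith
      moreover have "0 \<le> (t\<^sup>2 - 1) * r\<^sup>2" using t by simp
      ultimately show ?thesis
        using far[of y \<zeta> t] True t r by (intro divide_left_mono power_mono mult_pos_pos zero_less_power) auto
    qed
    then show ?thesis using K0[OF t, of y \<zeta>] True by (simp add: K_def)
  next
    case False
    then show ?thesis using t r by (auto simp: K_def)
  qed
  have Kint: "(\<integral>y. K t y \<zeta> \<partial>\<nu>) = (\<integral>y. ((norm (t *\<^sub>R \<zeta>))\<^sup>2 - (norm y)\<^sup>2) / norm (y - t *\<^sub>R \<zeta>) ^ ?n \<partial>\<nu>)"
    if "AE y in \<nu>. norm y = r" "sets \<nu> = sets borel" "\<zeta> \<in> S" for t \<zeta> \<nu>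
  proof (rule integral_cong_AE)
    note [measurable_cong] = that(2)
    show "(\<lambda>y. K t y \<zeta>) \<in> borel_measurable \<nu>"
      "(\<lambda>y. ((norm (t *\<^sub>R \<zeta>))\<^sup>2 - (norm y)\<^sup>2) / norm (y - t *\<^sub>R \<zeta>) ^ ?n) \<in> borel_measurable \<nu>" by measurable
    show "AE y in \<nu>. K t y \<zeta> = ((norm (t *\<^sub>R \<zeta>))\<^sup>2 - (norm y)\<^sup>2) / norm (y - t *\<^sub>R \<zeta>) ^ ?n"
      using that(1) by eventually_elim (use that(3) in \<open>simp add: K_def S_def power_mult_distrib left_diff_distrib\<close>)
  qed
  have tS: "norm (t *\<^sub>R \<zeta>) > r" "norm (t *\<^sub>R \<zeta>) = t * r" if "\<zeta> \<in> S" "t > 1" for t \<zeta>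
    using that r by (auto simp: S_def)
  have K\<mu>: "(\<integral>y. K t y \<zeta> \<partial>\<mu>) = \<Psi> (t *\<^sub>R \<zeta>)" if "\<zeta> \<in> S" "t > 1" for t \<zeta>
    using Kint[OF \<mu>(3,2) that(1)] int[OF tS(1)[OF that]] by simp
  have K\<mu>0: "(\<integral>y. K t y \<zeta> \<partial>\<mu>\<^sub>0) = 1 / (t * r) ^ (?n - 2)" if "\<zeta> \<in> S" "t > 1" for t \<zeta>
    using Kint[OF \<mu>0(3,2) that(1)] int0[OF tS(1)[OF that]] tS(2)[OF that] by simp
  have fub: "(\<integral>y. (\<integral>\<zeta>. g \<zeta> * K t y \<zeta> \<partial>\<sigma>) \<partial>\<nu>) = (\<integral>\<zeta>. g \<zeta> * (\<integral>y. K t y \<zeta> \<partial>\<nu>) \<partial>\<sigma>)"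
    if t: "t > 1" and \<nu>: "prob_space \<nu>" "sets \<nu> = sets borel" and g: "g \<in> borel_measurable borel" "\<And>\<zeta>. \<bar>g \<zeta>\<bar> \<le> B"
    for t \<nu> B and g :: "real ^ 'n \<Rightarrow> real"
  proof -
    note [measurable_cong] = \<nu>(2) and [measurable] = g(1)
    interpret \<nu>: prob_space \<nu> by fact
    interpret pair_sigma_finite \<nu> \<sigma> ..
    have "integrable (\<nu> \<Otimes>\<^sub>M \<sigma>) (\<lambda>p. g (snd p) * K t (fst p) (snd p))"
    proof (rule finite_measure_product_integrable)
      show "(\<lambda>p. g (snd p) * K t (fst p) (snd p)) \<in> borel_measurable (\<nu> \<Otimes>\<^sub>M \<sigma>)" by measurable
      show "\<bar>g (snd p) * K t (fst p) (snd p)\<bar> \<le> B * ((t\<^sup>2 - 1) * r\<^sup>2 / ((t - 1) * r) ^ ?n)" for p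
        unfolding abs_mult by (intro mult_mono g KC[OF t]) (use order_trans[OF abs_ge_zero g(2)] in auto)
    qed (rule \<nu>.finite_measure_axioms \<sigma>.finite_measure_axioms)+
    then have "integrable (\<nu> \<Otimes>\<^sub>M \<sigma>) (\<lambda>(y, \<zeta>). g \<zeta> * K t y \<zeta>)" by (simp add: case_prod_unfold)
    from Fubini_integral[OF this] show ?thesis by simp
  qed
  have rot: "(\<integral>\<zeta>. K t y \<zeta> \<partial>\<sigma>) = (\<integral>\<zeta>. K t y' \<zeta> \<partial>\<sigma>)" if y: "y \<in> S" "y' \<in> S" for t y y'
  proof -
    obtain T where T: "orthogonal_transformation T" "T y' = y"
      using orthogonal_transformation_exists[of y' y] y by (auto simp: S_def)
    have [measurable]: "T \<in> borel_measurable borel"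
      using T(1) by (intro borel_measurable_continuous_onI linear_continuous_on)
        (simp add: orthogonal_transformation_linear linear_conv_bounded_linear[symmetric])
    have lin: "T a - t *\<^sub>R T b = T (a - t *\<^sub>R b)" "norm (T v) = norm v" for a b v
      using T(1) by (simp_all add: orthogonal_transformation_linear linear_scale linear_diff orthogonal_transformation_norm)
    have "(\<integral>\<zeta>. K t y \<zeta> \<partial>\<sigma>) = (\<integral>\<zeta>. K t y \<zeta> \<partial>distr \<sigma> borel T)"
      unfolding \<sigma>_def sphere_measure_orthogonal_transformation[OF T(1)] ..
    also have "\<dots> = (\<integral>\<zeta>. K t (T y') (T \<zeta>) \<partial>\<sigma>)"
      by (subst integral_distr) (auto simp: T(2))
    also have "\<dots> = (\<integral>\<zeta>. K t y' \<zeta> \<partial>\<sigma>)"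
      by (intro Bochner_Integration.integral_cong refl) (simp add: K_def lin S_def indicator_def)
    finally show ?thesis .
  qed
  have mass: "(\<integral>\<zeta>. K t y \<zeta> \<partial>\<sigma>) = tot / (t * r) ^ (?n - 2)" if y: "y \<in> S" and t: "t > 1" for t y
  proof -
    have "(\<integral>\<zeta>. K t y \<zeta> \<partial>\<sigma>) = (\<integral>y'. (\<integral>\<zeta>. K t y \<zeta> \<partial>\<sigma>) \<partial>\<mu>\<^sub>0)" by (simp add: \<mu>0.prob_space)
    also have "\<dots> = (\<integral>y'. (\<integral>\<zeta>. 1 * K t y' \<zeta> \<partial>\<sigma>) \<partial>\<mu>\<^sub>0)"
    proof (rule integral_cong_AE)
      show "(\<lambda>y'. \<integral>\<zeta>. 1 * K t y' \<zeta> \<partial>\<sigma>) \<in> borel_measurable \<mu>\<^sub>0" by measurable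
      show "AE y' in \<mu>\<^sub>0. (\<integral>\<zeta>. K t y \<zeta> \<partial>\<sigma>) = (\<integral>\<zeta>. 1 * K t y' \<zeta> \<partial>\<sigma>)"
        using \<mu>0(3) by eventually_elim (use rot[OF y] in \<open>simp add: S_def\<close>)
    qed simp
    also have "\<dots> = (\<integral>\<zeta>. 1 * (\<integral>y'. K t y' \<zeta> \<partial>\<mu>\<^sub>0) \<partial>\<sigma>)"
      by (rule fub[OF t \<mu>0(1,2)], simp, rule order_refl)
    also have "\<dots> = (\<integral>\<zeta>. 1 / (t * r) ^ (?n - 2) \<partial>\<sigma>)"
    proof (rule integral_cong_AE)
      show "(\<lambda>\<zeta>. 1 * (\<integral>y'. K t y' \<zeta> \<partial>\<mu>\<^sub>0)) \<in> borel_measurable \<sigma>" by measurable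
      show "AE \<zeta> in \<sigma>. 1 * (\<integral>y'. K t y' \<zeta> \<partial>\<mu>\<^sub>0) = 1 / (t * r) ^ (?n - 2)"
        using AE\<sigma> by eventually_elim (simp add: K\<mu>0 t)
    qed simp
    finally show ?thesis by (simp add: tot)
  qed
  \<comment> \<open>limit of the mass of the approximate identity\<close>
  define m1 where "m1 = tot / r ^ (?n - 2)"
  have m1: "m1 > 0" unfolding m1_def using tot r by simp
  have mass_le: "tot / (t * r) ^ (?n - 2) \<le> m1" if "t > 1" for t
    unfolding m1_def using that tot r by (intro divide_left_mono power_mono) auto
  define tk where "tk k = 1 + inverse (real (Suc k))" for k
  have tk: "tk k > 1" "tk k \<le> 2" for k by (auto simp: tk_def inverse_le_1_iff simp del: of_nat_Suc)
  have tk_lim: "tk \<longlonglongrightarrow> 1"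
    unfolding tk_def[abs_def] using tendsto_add[OF tendsto_const LIMSEQ_inverse_real_of_nat, of 1] by simp
  have \<Psi>lim: "(\<lambda>k. \<Psi> (tk k *\<^sub>R \<zeta>)) \<longlonglongrightarrow> \<Psi> \<zeta>" if "\<zeta> \<in> S" for \<zeta>
  proof -
    have "(\<lambda>k. tk k *\<^sub>R \<zeta>) \<longlonglongrightarrow> 1 *\<^sub>R \<zeta>" by (intro tendsto_intros tk_lim)
    then show ?thesis
      using continuous_on_tendsto_compose[OF cont, of "\<lambda>k. tk k *\<^sub>R \<zeta>" \<zeta>] that tS(1)[OF that tk(1)]
      by (auto simp: S_def less_imp_le)
  qed
  show \<Psi>0: "0 \<le> \<Psi> y" if "norm y = r" for y
  proof (rule LIMSEQ_le_const[OF \<Psi>lim])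
    show y: "y \<in> S" using that by (simp add: S_def)
    have "0 \<le> \<Psi> (tk k *\<^sub>R y)" for k
      unfolding K\<mu>[OF y tk(1), symmetric] using K0[OF tk(1)] by simp
    then show "\<exists>N. \<forall>k\<ge>N. 0 \<le> \<Psi> (tk k *\<^sub>R y)" by blast
  qed
  have \<Psi>meas: "(\<lambda>\<zeta>. indicator S \<zeta> * \<Psi> (t *\<^sub>R \<zeta>)) \<in> borel_measurable borel" if "t \<ge> 1" for t
  proof -
    have "continuous_on S (\<lambda>\<zeta>. \<Psi> (t *\<^sub>R \<zeta>))"
      by (rule continuous_on_compose2[OF cont]) (use that r in \<open>auto intro!: continuous_intros simp: S_def mult_le_cancel_right1\<close>)
    from borel_measurable_continuous_on_indicator[OF S this] show ?thesis by simp
  qed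
  obtain B\<Psi> where B\<Psi>: "\<And>z. r \<le> norm z \<Longrightarrow> norm z \<le> 2 * r \<Longrightarrow> \<bar>\<Psi> z\<bar> \<le> B\<Psi>"
  proof -
    have "compact ({z::real ^ 'n. r \<le> norm z} \<inter> cball 0 (2 * r))"
      by (intro closed_Int_compact closed_Collect_le continuous_intros) auto
    then have "compact (\<Psi> ` ({z. r \<le> norm z} \<inter> cball 0 (2 * r)))"
      by (intro compact_continuous_image continuous_on_subset[OF cont]) auto
    then obtain B where "\<forall>v\<in>\<Psi> ` ({z. r \<le> norm z} \<inter> cball 0 (2 * r)). norm v \<le> B"
      using compact_imp_bounded bounded_iff by metis
    then show thesis using that[of B] by (auto simp: dist_norm)
  qed
  have key: "m1 * (\<integral>y. \<phi> y \<partial>\<mu>) = (\<integral>\<zeta>. \<phi> \<zeta> * (indicator S \<zeta> * \<Psi> \<zeta>) \<partial>\<sigma>)"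
    if c\<phi>: "continuous_on UNIV \<phi>" and b\<phi>: "\<And>y. 0 \<le> \<phi> y \<and> \<phi> y \<le> 1" for \<phi> :: "real ^ 'n \<Rightarrow> real"
  proof -
    have [measurable]: "\<phi> \<in> borel_measurable borel" by (rule borel_measurable_continuous_onI[OF c\<phi>])
    have ab: "\<bar>\<phi> y\<bar> \<le> 1" for y using b\<phi>[of y] by simp
    define G where "G t y = (\<integral>\<zeta>. \<phi> \<zeta> * K t y \<zeta> \<partial>\<sigma>)" for t y
    have iK: "integrable \<sigma> (K t y)" if "t > 1" for t y
      by (rule \<sigma>.integrable_const_bound[where B = "(t\<^sup>2 - 1) * r\<^sup>2 / ((t - 1) * r) ^ ?n"])
        (use KC[OF that] in \<open>auto simp del: abs_divide\<close>)
    have igK: "integrable \<sigma> (\<lambda>\<zeta>. g \<zeta> * K t y \<zeta>)"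
      if "t > 1" "g \<in> borel_measurable borel" "\<And>\<zeta>. \<bar>g \<zeta>\<bar> \<le> 1" for g :: "real ^ 'n \<Rightarrow> real" and t y
    proof (rule Bochner_Integration.integrable_bound[OF iK[OF that(1)]])
      note [measurable] = that(2)
      show "(\<lambda>\<zeta>. g \<zeta> * K t y \<zeta>) \<in> borel_measurable \<sigma>" by measurable
      show "AE \<zeta> in \<sigma>. norm (g \<zeta> * K t y \<zeta>) \<le> norm (K t y \<zeta>)"
        using that(3) by (intro AE_I2) (simp add: abs_mult mult_left_le_one_le)
    qed
    have Gb: "\<bar>G t y\<bar> \<le> m1" if "t > 1" "y \<in> S" for t y
    proof -
      have "\<bar>G t y\<bar> \<le> (\<integral>\<zeta>. 1 * K t y \<zeta> \<partial>\<sigma>)"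
        unfolding G_def
      proof (rule integral_abs_bound[THEN order_trans], rule integral_mono)
        show "\<bar>\<phi> \<zeta> * K t y \<zeta>\<bar> \<le> 1 * K t y \<zeta>" for \<zeta>
          unfolding abs_mult using ab[of \<zeta>] K0[OF that(1), of y \<zeta>] by (intro mult_mono) auto
      qed (use igK[OF that(1) _ ab] iK[OF that(1)] in auto)
      also have "\<dots> \<le> m1" using mass[OF that(2,1)] mass_le[OF that(1)] by simp
      finally show ?thesis .
    qed
    have Glim: "(\<lambda>k. G (tk k) y) \<longlonglongrightarrow> m1 * \<phi> y" if y: "y \<in> S" for y
    proof -
      have "(\<lambda>k. G (tk k) y - \<phi> y * (tot / (tk k * r) ^ (?n - 2))) \<longlonglongrightarrow> 0"
      proof (rule LIMSEQ_I)
        fix e :: real assume e: "e > 0"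
        define \<epsilon> where "\<epsilon> = e / (2 * m1)"
        have \<epsilon>: "\<epsilon> > 0" "\<epsilon> * m1 = e / 2" using e m1 by (auto simp: \<epsilon>_def)
        have "continuous (at y) \<phi>" using c\<phi> by (simp add: continuous_on_eq_continuous_at)
        then obtain \<delta> where \<delta>: "\<delta> > 0" "\<And>\<zeta>. dist \<zeta> y < \<delta> \<Longrightarrow> \<bar>\<phi> \<zeta> - \<phi> y\<bar> < \<epsilon>"
          using \<epsilon>(1) unfolding continuous_at_eps_delta dist_real_def by blast
        define c where "c k = ((tk k)\<^sup>2 - 1) * (r\<^sup>2 / \<delta> ^ ?n)" for k
        have "c \<longlonglongrightarrow> (1\<^sup>2 - 1) * (r\<^sup>2 / \<delta> ^ ?n)" unfolding c_def[abs_def] by (intro tendsto_intros tk_lim)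
        then have "(\<lambda>k. c k * tot) \<longlonglongrightarrow> 0" using tendsto_mult_left_zero by fastforce
        then have "\<forall>\<^sub>F k in sequentially. c k * tot < e / 2" using e by (intro order_tendstoD) auto
        then obtain k0 where k0: "\<And>k. k \<ge> k0 \<Longrightarrow> c k * tot < e / 2" by (auto simp: eventually_sequentially)
        have bound: "\<bar>G (tk k) y - \<phi> y * (tot / (tk k * r) ^ (?n - 2))\<bar> \<le> \<epsilon> * m1 + c k * tot" for k
        proof -
          define t where "t = tk k"
          have t: "t > 1" using tk by (simp add: t_def)
          have i1: "integrable \<sigma> (\<lambda>\<zeta>. (\<phi> \<zeta> - \<phi> y) * K t y \<zeta>)"
          proof (rule igK[OF t])
            show "\<bar>\<phi> \<zeta> - \<phi> y\<bar> \<le> 1" for \<zeta> using b\<phi>[of \<zeta>] b\<phi>[of y] by (auto simp: abs_le_iff)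
          qed measurable
          have i2: "integrable \<sigma> (\<lambda>\<zeta>. \<epsilon> * K t y \<zeta> + c k)"
            using iK[OF t] by simp
          have "G t y - \<phi> y * (tot / (t * r) ^ (?n - 2)) = (\<integral>\<zeta>. (\<phi> \<zeta> - \<phi> y) * K t y \<zeta> \<partial>\<sigma>)"
          proof -
            have "(\<integral>\<zeta>. (\<phi> \<zeta> - \<phi> y) * K t y \<zeta> \<partial>\<sigma>) = (\<integral>\<zeta>. \<phi> \<zeta> * K t y \<zeta> - \<phi> y * K t y \<zeta> \<partial>\<sigma>)"
              by (simp add: left_diff_distrib)
            also have "\<dots> = (\<integral>\<zeta>. \<phi> \<zeta> * K t y \<zeta> \<partial>\<sigma>) - (\<integral>\<zeta>. \<phi> y * K t y \<zeta> \<partial>\<sigma>)"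
              by (intro Bochner_Integration.integral_diff igK[OF t] integrable_mult_right iK[OF t] ab) measurable
            finally show ?thesis using mass[OF y t] by (simp add: G_def)
          qed
          also have "\<bar>\<dots>\<bar> \<le> (\<integral>\<zeta>. \<epsilon> * K t y \<zeta> + c k \<partial>\<sigma>)"
          proof (rule integral_abs_bound[THEN order_trans], rule integral_mono)
            fix \<zeta>
            show "\<bar>(\<phi> \<zeta> - \<phi> y) * K t y \<zeta>\<bar> \<le> \<epsilon> * K t y \<zeta> + c k"
            proof (cases "dist \<zeta> y < \<delta> \<or> \<zeta> \<notin> S")
              case True
              have c0: "c k \<ge> 0" using t r \<delta>(1) unfolding c_def t_def by (intro mult_nonneg_nonneg) auto
              from True have "\<bar>(\<phi> \<zeta> - \<phi> y) * K t y \<zeta>\<bar> \<le> \<epsilon> * K t y \<zeta>"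
              proof
                assume "dist \<zeta> y < \<delta>"
                then show ?thesis unfolding abs_mult using \<delta>(2)[of \<zeta>] K0[OF t, of y \<zeta>] by (simp add: mult_right_mono)
              qed (simp add: K_def)
              then show ?thesis using c0 by simp
            next
              case False
              then have \<zeta>: "\<zeta> \<in> S" "\<delta> \<le> norm (y - \<zeta>)" by (auto simp: dist_norm norm_minus_commute)
              \<comment> \<open>moving \<open>\<zeta>\<close> outwards along its ray does not bring it closer to \<open>y\<close>\<close>
              have eq: "(norm (y - t *\<^sub>R \<zeta>))\<^sup>2 = t * (norm (y - \<zeta>))\<^sup>2 + r\<^sup>2 * (t - 1)\<^sup>2"
              proof -
                have q: "y \<bullet> y = r\<^sup>2" "\<zeta> \<bullet> \<zeta> = r\<^sup>2" using y \<zeta>(1) by (auto simp: S_def power2_norm_eq_inner[symmetric])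
                show ?thesis
                  unfolding power2_norm_eq_inner by (simp add: inner_diff inner_commute q) (simp add: algebra_simps power2_eq_square)
              qed
              have "1 * (norm (y - \<zeta>))\<^sup>2 \<le> t * (norm (y - \<zeta>))\<^sup>2 + r\<^sup>2 * (t - 1)\<^sup>2"
                using t by (intro add_increasing2 mult_right_mono) auto
              then have "(norm (y - \<zeta>))\<^sup>2 \<le> (norm (y - t *\<^sub>R \<zeta>))\<^sup>2" unfolding eq by simp
              then have "norm (y - \<zeta>) \<le> norm (y - t *\<^sub>R \<zeta>)" by (rule power2_le_imp_le) simp
              then have d: "\<delta> \<le> norm (y - t *\<^sub>R \<zeta>)" using \<zeta>(2) by simp
              have "K t y \<zeta> = (t\<^sup>2 - 1) * r\<^sup>2 / norm (y - t *\<^sub>R \<zeta>) ^ ?n" using y \<zeta> by (simp add: K_def)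
              also have "\<dots> \<le> (t\<^sup>2 - 1) * r\<^sup>2 / \<delta> ^ ?n"
                using d \<delta>(1) t by (intro divide_left_mono power_mono mult_nonneg_nonneg mult_pos_pos zero_less_power) (auto intro: less_le_trans)
              also have "\<dots> = c k" by (simp add: c_def t_def)
              finally have "K t y \<zeta> \<le> c k" .
              moreover have "\<bar>\<phi> \<zeta> - \<phi> y\<bar> \<le> 1" using b\<phi>[of \<zeta>] b\<phi>[of y] by auto
              ultimately have "\<bar>\<phi> \<zeta> - \<phi> y\<bar> * K t y \<zeta> \<le> 1 * c k"
                using K0[OF t, of y \<zeta>] by (intro mult_mono) auto
              moreover have "0 \<le> \<epsilon> * K t y \<zeta>" using \<epsilon>(1) K0[OF t, of y \<zeta>] by simp
              ultimately show ?thesis using K0[OF t, of y \<zeta>] by (simp add: abs_mult)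
            qed
          qed (use i1 i2 in auto)
          also have "\<dots> = \<epsilon> * (tot / (t * r) ^ (?n - 2)) + c k * tot"
            using iK[OF t] mass[OF y t] tot by (simp add: mult.commute)
          also have "\<dots> \<le> \<epsilon> * m1 + c k * tot" using mass_le[OF t] \<epsilon>(1)
            by (intro add_right_mono mult_left_mono) auto
          finally show ?thesis by (simp add: t_def)
        qed
        show "\<exists>no. \<forall>k\<ge>no. norm (G (tk k) y - \<phi> y * (tot / (tk k * r) ^ (?n - 2)) - 0) < e"
        proof (intro exI allI impI)
          fix k assume "k \<ge> k0"
          then show "norm (G (tk k) y - \<phi> y * (tot / (tk k * r) ^ (?n - 2)) - 0) < e"
            using bound[of k] k0[of k] \<epsilon>(2) by simp
        qed
      qed
      moreover have "(\<lambda>k. \<phi> y * (tot / (tk k * r) ^ (?n - 2))) \<longlonglongrightarrow> \<phi> y * (tot / (1 * r) ^ (?n - 2))"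
        by (intro tendsto_intros tk_lim) (use r in auto)
      ultimately have "(\<lambda>k. (G (tk k) y - \<phi> y * (tot / (tk k * r) ^ (?n - 2))) + \<phi> y * (tot / (tk k * r) ^ (?n - 2)))
          \<longlonglongrightarrow> 0 + \<phi> y * (tot / (1 * r) ^ (?n - 2))" by (rule tendsto_add)
      then show ?thesis by (simp add: m1_def mult.commute)
    qed
    have lim1: "(\<lambda>k. \<integral>y. G (tk k) y \<partial>\<mu>) \<longlonglongrightarrow> (\<integral>y. m1 * \<phi> y \<partial>\<mu>)"
    proof (rule integral_dominated_convergence[where w = "\<lambda>_. m1"])
      show "G (tk k) \<in> borel_measurable \<mu>" for k unfolding G_def[abs_def] by measurable
      show "AE y in \<mu>. (\<lambda>k. G (tk k) y) \<longlonglongrightarrow> m1 * \<phi> y"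
        using \<mu>(3) by eventually_elim (simp add: Glim S_def)
      show "AE y in \<mu>. norm (G (tk k) y) \<le> m1" for k
        using \<mu>(3) by eventually_elim (use Gb[OF tk(1)] in \<open>simp add: S_def\<close>)
    qed auto
    have eqk: "(\<integral>y. G (tk k) y \<partial>\<mu>) = (\<integral>\<zeta>. \<phi> \<zeta> * (indicator S \<zeta> * \<Psi> (tk k *\<^sub>R \<zeta>)) \<partial>\<sigma>)" for k
    proof -
      have [measurable]: "(\<lambda>\<zeta>. indicator S \<zeta> * \<Psi> (tk k *\<^sub>R \<zeta>)) \<in> borel_measurable borel"
        using tk(1)[of k] by (intro \<Psi>meas) simp
      have "(\<integral>y. G (tk k) y \<partial>\<mu>) = (\<integral>\<zeta>. \<phi> \<zeta> * (\<integral>y. K (tk k) y \<zeta> \<partial>\<mu>) \<partial>\<sigma>)"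
        unfolding G_def by (rule fub[OF tk(1) \<mu>(1,2) _ ab]) measurable
      also have "\<dots> = (\<integral>\<zeta>. \<phi> \<zeta> * (indicator S \<zeta> * \<Psi> (tk k *\<^sub>R \<zeta>)) \<partial>\<sigma>)"
      proof (rule integral_cong_AE)
        show "AE \<zeta> in \<sigma>. \<phi> \<zeta> * (\<integral>y. K (tk k) y \<zeta> \<partial>\<mu>) = \<phi> \<zeta> * (indicator S \<zeta> * \<Psi> (tk k *\<^sub>R \<zeta>))"
          using AE\<sigma> by eventually_elim (simp add: K\<mu> tk)
      qed measurable
      finally show ?thesis .
    qed
    have lim2: "(\<lambda>k. \<integral>\<zeta>. \<phi> \<zeta> * (indicator S \<zeta> * \<Psi> (tk k *\<^sub>R \<zeta>)) \<partial>\<sigma>) \<longlonglongrightarrow> (\<integral>\<zeta>. \<phi> \<zeta> * (indicator S \<zeta> * \<Psi> \<zeta>) \<partial>\<sigma>)"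
    proof (rule integral_dominated_convergence[where w = "\<lambda>_. \<bar>B\<Psi>\<bar>"])
      have [measurable]: "(\<lambda>\<zeta>. indicator S \<zeta> * \<Psi> (tk k *\<^sub>R \<zeta>)) \<in> borel_measurable borel" "(\<lambda>\<zeta>. indicator S \<zeta> * \<Psi> \<zeta>) \<in> borel_measurable borel" for k
        using tk(1)[of k] \<Psi>meas[of 1] by (auto intro!: \<Psi>meas)
      show "(\<lambda>\<zeta>. \<phi> \<zeta> * (indicator S \<zeta> * \<Psi> \<zeta>)) \<in> borel_measurable \<sigma>"
        "(\<lambda>\<zeta>. \<phi> \<zeta> * (indicator S \<zeta> * \<Psi> (tk k *\<^sub>R \<zeta>))) \<in> borel_measurable \<sigma>" for k by measurable
      have "(\<lambda>k. \<phi> \<zeta> * (indicator S \<zeta> * \<Psi> (tk k *\<^sub>R \<zeta>))) \<longlonglongrightarrow> \<phi> \<zeta> * (indicator S \<zeta> * \<Psi> \<zeta>)" for \<zeta>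
        using \<Psi>lim[of \<zeta>] by (cases "\<zeta> \<in> S") (auto intro!: tendsto_intros)
      then show "AE \<zeta> in \<sigma>. (\<lambda>k. \<phi> \<zeta> * (indicator S \<zeta> * \<Psi> (tk k *\<^sub>R \<zeta>))) \<longlonglongrightarrow> \<phi> \<zeta> * (indicator S \<zeta> * \<Psi> \<zeta>)" by simp
      have "norm (\<phi> \<zeta> * (indicator S \<zeta> * \<Psi> (tk k *\<^sub>R \<zeta>))) \<le> 1 * \<bar>B\<Psi>\<bar>" for \<zeta> k
        unfolding real_norm_def abs_mult[of "\<phi> \<zeta>"]
      proof (rule mult_mono[OF ab])
        show "\<bar>indicator S \<zeta> * \<Psi> (tk k *\<^sub>R \<zeta>)\<bar> \<le> \<bar>B\<Psi>\<bar>"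
          using B\<Psi>[of "tk k *\<^sub>R \<zeta>"] tS[of \<zeta>, OF _ tk(1)[of k]] tk[of k] r by (cases "\<zeta> \<in> S") (auto intro: order_trans)
      qed auto
      then show "AE \<zeta> in \<sigma>. norm (\<phi> \<zeta> * (indicator S \<zeta> * \<Psi> (tk k *\<^sub>R \<zeta>))) \<le> \<bar>B\<Psi>\<bar>" for k by simp
    qed auto
    have "(\<integral>y. m1 * \<phi> y \<partial>\<mu>) = (\<integral>\<zeta>. \<phi> \<zeta> * (indicator S \<zeta> * \<Psi> \<zeta>) \<partial>\<sigma>)"
      using LIMSEQ_unique[OF lim1[unfolded eqk] lim2] .
    then show ?thesis by simp
  qed
  define p where "p y = indicator S y * \<Psi> y / m1" for y
  have p_meas [measurable]: "p \<in> borel_measurable borel"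
    unfolding p_def[abs_def] using \<Psi>meas[of 1] by (intro borel_measurable_divide) auto
  have p0: "0 \<le> p y" for y using \<Psi>0[of y] m1 by (auto simp: p_def indicator_def S_def)
  have pb: "p y \<le> \<bar>B\<Psi>\<bar> / m1" for y
    unfolding p_def using B\<Psi>[of y] m1 r by (intro divide_right_mono) (auto simp: indicator_def S_def abs_le_iff)
  have ip: "integrable \<sigma> p" by (rule \<sigma>.integrable_const_bound[where B = "\<bar>B\<Psi>\<bar> / m1"]) (use p0 pb in auto)
  have fin: "finite_measure (density \<sigma> (\<lambda>y. ennreal (p y)))"
  proof (rule finite_measureI)
    have "emeasure (density \<sigma> (\<lambda>y. ennreal (p y))) (space \<sigma>) = (\<integral>\<^sup>+y. ennreal (p y) \<partial>\<sigma>)"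
    proof (subst emeasure_density)
      show "(\<lambda>y. ennreal (p y)) \<in> borel_measurable \<sigma>" by measurable
    qed (auto simp: indicator_def \<sigma>_def intro!: nn_integral_cong)
    also have "\<dots> = ennreal (\<integral>y. p y \<partial>\<sigma>)" using ip p0 by (intro nn_integral_eq_integral) auto
    finally show "emeasure (density \<sigma> (\<lambda>y. ennreal (p y))) (space (density \<sigma> (\<lambda>y. ennreal (p y)))) \<noteq> \<infinity>" by simp
  qed
  have "\<mu> = density \<sigma> (\<lambda>y. ennreal (p y))"
  proof (rule measure_eqI_continuous_functions)
    fix \<phi> :: "real ^ 'n \<Rightarrow> real" assume c: "continuous_on UNIV \<phi>" and b: "\<And>y. 0 \<le> \<phi> y \<and> \<phi> y \<le> 1"
    have [measurable]: "\<phi> \<in> borel_measurable borel" by (rule borel_measurable_continuous_onI[OF c])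
    have "(\<integral>y. \<phi> y \<partial>density \<sigma> (\<lambda>y. ennreal (p y))) = (\<integral>y. p y *\<^sub>R \<phi> y \<partial>\<sigma>)"
      by (rule integral_density) (use p0 in auto)
    also have "\<dots> = (\<integral>\<zeta>. \<phi> \<zeta> * (indicator S \<zeta> * \<Psi> \<zeta>) / m1 \<partial>\<sigma>)"
      by (intro Bochner_Integration.integral_cong refl) (simp add: p_def)
    also have "\<dots> = (\<integral>y. \<phi> y \<partial>\<mu>)" using key[OF c b, symmetric] m1 by simp
    finally show "(\<integral>y. \<phi> y \<partial>\<mu>) = (\<integral>y. \<phi> y \<partial>density \<sigma> (\<lambda>y. ennreal (p y)))" by simp
  qed (simp_all add: \<mu> fin \<mu>.finite_measure_axioms)
  moreover have "m1 = real ?n * unit_ball_vol (real ?n) * r"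
  proof -
    have "?n - 1 = Suc (?n - 2)" using n by simp
    then have "r ^ (?n - 1) = r * r ^ (?n - 2)" by simp
    then show ?thesis unfolding m1_def tot_def using r by simp
  qed
  ultimately have "p = (\<lambda>y. if norm y = r then \<Psi> y / (real ?n * unit_ball_vol (real ?n) * r) else 0)"
    and "\<mu> = density \<sigma> (\<lambda>y. ennreal (p y))"
    by (auto simp: p_def S_def indicator_def fun_eq_iff)
  then show "\<mu> = density (sphere_measure r)
          (\<lambda>y. ennreal (if norm y = r then \<Psi> y / (real CARD('n) * unit_ball_vol (real CARD('n)) * r) else 0))"
    by (simp only: \<sigma>_def)
qed

section \<open>Integration against damped kernels\<close>

text \<open>Two integrations by parts move the differential operator from \<open>f\<close> to the kernel \<open>K\<close>.\<close>

lemma kernel_integral_by_parts: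
  fixes K K1 K2 f f1 f2 :: "real \<Rightarrow> real"
  assumes K: "\<And>v. v \<ge> 0 \<Longrightarrow> (K has_real_derivative K1 v) (at v)" "\<And>v. v \<ge> 0 \<Longrightarrow> (K1 has_real_derivative K2 v) (at v)"
      "continuous_on {0<..} K2"
    and f: "\<And>v. v \<ge> 0 \<Longrightarrow> (f has_real_derivative f1 v) (at v)" "\<And>v. v \<ge> 0 \<Longrightarrow> (f1 has_real_derivative f2 v) (at v)"
      "continuous_on {0<..} f2"
    and bK: "\<delta> > 0" "\<And>v. v \<ge> 0 \<Longrightarrow> \<bar>K v\<bar> \<le> B * exp (- \<delta> * v)" "\<And>v. v \<ge> 0 \<Longrightarrow> \<bar>K1 v\<bar> \<le> B * exp (- \<delta> * v)"
      "\<And>v. v \<ge> 0 \<Longrightarrow> \<bar>K2 v\<bar> \<le> B * exp (- \<delta> * v)"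
    and bf: "\<And>v. v \<ge> 0 \<Longrightarrow> \<bar>f v\<bar> \<le> C" "\<And>v. v \<ge> 0 \<Longrightarrow> \<bar>f1 v\<bar> \<le> C" "\<And>v. v \<ge> 0 \<Longrightarrow> \<bar>f2 v\<bar> \<le> C"
  shows "(LINT v:{0<..}|lborel. K v * (A2 * f2 v - A1 * f1 v + A0 * f v))
     = A2 * (K1 0 * f 0 - K 0 * f1 0) + A1 * (K 0 * f 0)
       + (LINT v:{0<..}|lborel. (A2 * K2 v + A1 * K1 v + A0 * K v) * f v)"
proof -
  have bd: "\<bar>g v * h v\<bar> \<le> (B * C) * exp (- \<delta> * v)"
    if "\<bar>g v\<bar> \<le> B * exp (- \<delta> * v)" "\<bar>h v\<bar> \<le> C" for g h :: "real \<Rightarrow> real" and v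
  proof -
    have "\<bar>g v * h v\<bar> \<le> (B * exp (- \<delta> * v)) * C"
      unfolding abs_mult using that by (intro mult_mono) (auto intro: order_trans[OF abs_ge_zero])
    then show ?thesis by (simp add: ac_simps)
  qed
  have cont: "continuous_on {0<..} g" if "\<And>v. v \<ge> 0 \<Longrightarrow> (g has_real_derivative g1 v) (at v)" for g g1 :: "real \<Rightarrow> real"
    using that by (auto intro!: continuous_at_imp_continuous_on DERIV_isCont less_imp_le)
  note c = cont[OF K(1)] cont[OF K(2)] K(3) cont[OF f(1)] cont[OF f(2)] f(3)
  have int: "set_integrable lborel {0<..} (\<lambda>v. g v * h v)"
    if "continuous_on {0<..} g" "continuous_on {0<..} h" "\<And>v. v \<ge> 0 \<Longrightarrow> \<bar>g v\<bar> \<le> B * exp (- \<delta> * v)" "\<And>v. v \<ge> 0 \<Longrightarrow> \<bar>h v\<bar> \<le> C"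
    for g h :: "real \<Rightarrow> real"
    by (rule set_integrable_exp_bound[where \<delta> = \<delta> and B = "B * C"])
      (use that bd bK(1) in \<open>auto intro!: continuous_intros simp del: mult_minus_left\<close>)
  define F where "F v = A2 * (K v * f1 v - K1 v * f v) - A1 * (K v * f v)" for v
  define F' where "F' v = A2 * (K v * f2 v - K2 v * f v) - A1 * (K1 v * f v + K v * f1 v)" for v
  have iF: "set_integrable lborel {0<..} F'"
    unfolding F'_def[abs_def]
    by (intro set_integral_diff(1) set_integral_add(1) set_integrable_mult_right impI int c bK bf)
  have I1: "(LINT v:{0<..}|lborel. F' v) = - F 0"
  proof (rule FTC_Ioi[OF _ _ iF])
    fix v :: real assume v: "v \<ge> 0"
    have "(F has_real_derivative F' v) (at v)"
      unfolding F_def[abs_def] F'_def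
      by (auto intro!: derivative_eq_intros K(1,2)[OF v] f(1,2)[OF v] simp: algebra_simps)
    then show "(F has_vector_derivative F' v) (at v)" by (simp add: has_real_derivative_iff_has_vector_derivative)
  next
    show "continuous_on {0<..} F'" unfolding F'_def[abs_def] by (intro continuous_intros c)
    have lim: "((\<lambda>v. g v * h v) \<longlongrightarrow> 0) at_top"
      if "\<And>v. v \<ge> 0 \<Longrightarrow> \<bar>g v\<bar> \<le> B * exp (- \<delta> * v)" "\<And>v. v \<ge> 0 \<Longrightarrow> \<bar>h v\<bar> \<le> C" for g h :: "real \<Rightarrow> real"
    proof (rule Lim_null_comparison)
      show "\<forall>\<^sub>F v in at_top. norm (g v * h v) \<le> (B * C) * exp (- \<delta> * v)"
        using eventually_ge_at_top[of 0] by eventually_elim (use that bd in \<open>simp only: real_norm_def\<close>)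
      show "((\<lambda>v. (B * C) * exp (- \<delta> * v)) \<longlongrightarrow> 0) at_top" using \<open>\<delta> > 0\<close> by real_asymp
    qed
    have "(F \<longlongrightarrow> A2 * (0 - 0) - A1 * 0) at_top"
      unfolding F_def[abs_def] by (intro tendsto_intros lim bK bf)
    then show "(F \<longlongrightarrow> 0) at_top" by simp
  qed
  have I2: "(LINT v:{0<..}|lborel. K v * (A2 * f2 v - A1 * f1 v + A0 * f v))
      = (LINT v:{0<..}|lborel. F' v + (A2 * K2 v + A1 * K1 v + A0 * K v) * f v)"
    by (simp add: F'_def algebra_simps)
  have "set_integrable lborel {0<..} (\<lambda>v. A2 * (K2 v * f v) + A1 * (K1 v * f v) + A0 * (K v * f v))"
    by (intro set_integral_add(1) set_integrable_mult_right impI int c bK bf)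
  then have iG: "set_integrable lborel {0<..} (\<lambda>v. (A2 * K2 v + A1 * K1 v + A0 * K v) * f v)"
    by (simp add: algebra_simps)
  show ?thesis
    unfolding I2 set_integral_add(2)[OF iF iG] I1 by (simp add: F_def algebra_simps)
qed

text \<open>The general element of the solution space of \<open>(d/dv + b)\<^sup>2 f = d f\<close>.\<close>

definition damped :: "real \<Rightarrow> real \<Rightarrow> real \<Rightarrow> real \<Rightarrow> real \<Rightarrow> real" where
  "damped b d c s v = exp (- b * v) * (c * cosh_sqrt d v + s * sinh_sqrt d v)"

lemma damped_deriv: "(damped b d c s has_real_derivative damped b d (s - b * c) (d * c - b * s) v) (at v)"
  unfolding damped_def[abs_def]
  by (auto intro!: derivative_eq_intros cosh_sqrt_deriv sinh_sqrt_deriv simp: algebra_simps)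

lemma damped_0 [simp]: "damped b d c s 0 = c"
  by (simp add: damped_def)

lemma continuous_on_damped [continuous_intros]: "continuous_on S (damped b d c s)"
  using damped_deriv by (auto intro!: continuous_at_imp_continuous_on DERIV_isCont)

lemma damped_scale: "x * damped b d c s v = damped b d (x * c) (x * s) v"
  by (simp add: damped_def algebra_simps)

lemma damped_exp: "exp (k * v) * damped b d c s v = damped (b - k) d c s v"
proof -
  have "exp (k * v) * exp (- b * v) = exp (- (b - k) * v)"
    unfolding exp_add[symmetric] by (simp add: algebra_simps)
  then show ?thesis unfolding damped_def mult.assoc[symmetric] by simp
qed

text \<open>Three functions share the constants, because a kernel is always used together with its first two
derivatives.\<close>

lemma damped_bound:
  assumes "sqrt (max d 0) < b"
  shows "\<exists>\<delta> B. \<delta> > 0 \<and> (\<forall>v\<ge>0. \<bar>damped b d c s v\<bar> \<le> B * exp (- \<delta> * v) \<and>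
    \<bar>damped b d c1 s1 v\<bar> \<le> B * exp (- \<delta> * v) \<and> \<bar>damped b d c2 s2 v\<bar> \<le> B * exp (- \<delta> * v))"
proof -
  obtain \<delta> B where \<delta>: "\<delta> > 0" "b > \<delta>"
    and b: "\<And>v. v \<ge> 0 \<Longrightarrow> \<bar>exp (- b * v) * cosh_sqrt d v\<bar> \<le> B * exp (- \<delta> * v)"
      "\<And>v. v \<ge> 0 \<Longrightarrow> \<bar>exp (- b * v) * sinh_sqrt d v\<bar> \<le> B * exp (- \<delta> * v)"
    using damped_sqrt_bound[OF assms] by blast
  have B: "B \<ge> 0" using b(1)[of 0] by simp
  define A where "A = (\<bar>c\<bar> + \<bar>s\<bar>) + (\<bar>c1\<bar> + \<bar>s1\<bar>) + (\<bar>c2\<bar> + \<bar>s2\<bar>)"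
  have *: "\<bar>damped b d x y v\<bar> \<le> (A * B) * exp (- \<delta> * v)" if v: "v \<ge> 0" and A: "\<bar>x\<bar> + \<bar>y\<bar> \<le> A" for x y v
  proof -
    have "damped b d x y v = x * (exp (- b * v) * cosh_sqrt d v) + y * (exp (- b * v) * sinh_sqrt d v)"
      by (simp add: damped_def algebra_simps)
    also have "\<bar>\<dots>\<bar> \<le> \<bar>x\<bar> * \<bar>exp (- b * v) * cosh_sqrt d v\<bar> + \<bar>y\<bar> * \<bar>exp (- b * v) * sinh_sqrt d v\<bar>"
      by (simp only: abs_mult[symmetric] abs_triangle_ineq)
    also have "\<dots> \<le> \<bar>x\<bar> * (B * exp (- \<delta> * v)) + \<bar>y\<bar> * (B * exp (- \<delta> * v))"
      using b[OF v] by (intro add_mono mult_left_mono) auto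
    also have "\<dots> = (\<bar>x\<bar> + \<bar>y\<bar>) * (B * exp (- \<delta> * v))" by (simp add: algebra_simps)
    also have "\<dots> \<le> A * (B * exp (- \<delta> * v))" using A B by (intro mult_right_mono) auto
    finally show ?thesis by (simp add: mult.assoc)
  qed
  show ?thesis
    by (intro exI[of _ \<delta>] exI[of _ "A * B"] conjI allI impI \<delta>(1) *) (simp_all add: A_def)
qed

lemma damped_integral:
  assumes "sqrt (max d 0) < b"
  shows "set_integrable lborel {0<..} (damped b d c s)"
    and "(LINT v:{0<..}|lborel. damped b d c s v) = (c * b + s) / (b\<^sup>2 - d)"
proof -
  have k: "Re 0 + b > sqrt (max d 0)" using assms by simp
  note L = damped_sqrt_laplace[OF k]
  have L': "set_integrable lborel {0<..} (\<lambda>v. exp (- b * v) * cosh_sqrt d v)" "set_integrable lborel {0<..} (\<lambda>v. exp (- b * v) * sinh_sqrt d v)"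
    using L(1,2) by (simp_all add: set_integrable_def scaleR_conv_of_real flip: of_real_mult complex_of_real_integrable_eq)
  have "complex_of_real (LINT v:{0<..}|lborel. exp (- b * v) * cosh_sqrt d v) = complex_of_real (b / (b\<^sup>2 - d))"
    "complex_of_real (LINT v:{0<..}|lborel. exp (- b * v) * sinh_sqrt d v) = complex_of_real (1 / (b\<^sup>2 - d))"
    using L(4,5) unfolding set_integral_complex_of_real[symmetric] by simp_all
  then have I: "(LINT v:{0<..}|lborel. exp (- b * v) * cosh_sqrt d v) = b / (b\<^sup>2 - d)"
    "(LINT v:{0<..}|lborel. exp (- b * v) * sinh_sqrt d v) = 1 / (b\<^sup>2 - d)"
    unfolding of_real_eq_iff by blast+
  have eq: "damped b d c s = (\<lambda>v. c * (exp (- b * v) * cosh_sqrt d v) + s * (exp (- b * v) * sinh_sqrt d v))"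
    by (rule ext) (simp add: damped_def algebra_simps)
  show "set_integrable lborel {0<..} (damped b d c s)"
    unfolding eq by (intro set_integral_add(1) set_integrable_mult_right impI L')
  have "(LINT v:{0<..}|lborel. damped b d c s v) = c * (b / (b\<^sup>2 - d)) + s * (1 / (b\<^sup>2 - d))"
    unfolding eq I[symmetric] set_integral_mult_right[symmetric]
    by (intro set_integral_add(2) set_integrable_mult_right impI L')
  then show "(LINT v:{0<..}|lborel. damped b d c s v) = (c * b + s) / (b\<^sup>2 - d)"
    by (simp add: add_divide_distrib)
qed

text \<open>Fubini's theorem for a decaying kernel in \<open>v\<close> and a bounded integrand on the sphere.\<close>

lemma integral_kernel_exchange:
  fixes \<mu> :: "(real ^ 'n) measure" and g :: "real \<Rightarrow> real ^ 'n \<Rightarrow> real"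
  assumes \<mu>: "prob_space \<mu>" "sets \<mu> = sets borel" "AE y in \<mu>. norm y = r"
    and K: "continuous_on {0<..} K" "\<delta> > 0" "\<And>v. v \<ge> 0 \<Longrightarrow> \<bar>K v\<bar> \<le> B * exp (- \<delta> * v)"
    and g: "continuous_on ({0<..} \<times> {y. norm y = r}) (\<lambda>p. g (fst p) (snd p))"
      "\<And>v y. v > 0 \<Longrightarrow> norm y = r \<Longrightarrow> \<bar>g v y\<bar> \<le> C"
    and meas: "\<And>v. v > 0 \<Longrightarrow> g v \<in> borel_measurable borel" "u \<in> borel_measurable borel"
    and u: "\<And>y. norm y = r \<Longrightarrow> (LINT v:{0<..}|lborel. K v * g v y) = u y"
    and H: "\<And>v. v > 0 \<Longrightarrow> (\<integral>y. g v y \<partial>\<mu>) = H v"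
  shows "(\<integral>y. u y \<partial>\<mu>) = (LINT v:{0<..}|lborel. K v * H v)"
proof -
  interpret \<mu>: prob_space \<mu> by fact
  note [measurable_cong] = \<mu>(2)
  define S where "S = {y :: real ^ 'n. norm y = r}"
  have S: "S \<in> sets borel" unfolding S_def by measurable
  note [measurable] = S
  define G where "G v y = indicator {0<..} v * (indicator S y * (K v * g v y))" for v y
  have "continuous_on ({0<..} \<times> S) (\<lambda>p. K (fst p) * g (fst p) (snd p))"
    using g(1) unfolding S_def by (intro continuous_on_mult) (auto intro!: continuous_on_compose2[OF K(1)] continuous_intros)
  moreover have P: "{0<..} \<times> S \<in> sets (borel :: (real \<times> (real ^ 'n)) measure)"
    unfolding borel_prod[symmetric] using S by (intro pair_measureI) auto
  ultimately have "(\<lambda>p. indicator ({0<..} \<times> S) p *\<^sub>R (K (fst p) * g (fst p) (snd p))) \<in> borel_measurable borel"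
    by (intro borel_measurable_continuous_on_indicator)
  moreover have "indicator ({0<..} \<times> S) p *\<^sub>R (K (fst p) * g (fst p) (snd p)) = G (fst p) (snd p)" for p
    by (cases p) (auto simp: G_def indicator_def)
  ultimately have Gm0: "(\<lambda>p. G (fst p) (snd p)) \<in> borel_measurable (borel \<Otimes>\<^sub>M borel)"
    by (simp add: borel_prod)
  have "sets (lborel \<Otimes>\<^sub>M \<mu>) = sets (borel \<Otimes>\<^sub>M borel)" by (intro sets_pair_measure_cong) (simp_all add: \<mu>(2))
  then have Gm: "(\<lambda>p. G (fst p) (snd p)) \<in> borel_measurable (lborel \<Otimes>\<^sub>M \<mu>)"
    using Gm0 measurable_cong_sets by blast
  have C: "\<bar>G v y\<bar> \<le> indicator {0<..} v * ((B * \<bar>C\<bar>) * exp (- (v * \<delta>)))" for v y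
  proof (cases "v > 0 \<and> y \<in> S")
    case True
    then have "\<bar>K v * g v y\<bar> \<le> (B * exp (- \<delta> * v)) * \<bar>C\<bar>"
      unfolding abs_mult using K(3)[of v] g(2)[of v y]
      by (intro mult_mono) (auto simp: S_def intro: order_trans[OF abs_ge_zero] order_trans[OF _ abs_ge_self])
    then show ?thesis using True by (simp add: G_def ac_simps)
  next
    case False
    have "B \<ge> 0" using K(3)[of 0] by simp
    then show ?thesis using False by (auto simp: G_def)
  qed
  interpret pair_sigma_finite lborel \<mu> ..
  have "integrable lborel (\<lambda>v. indicator {0<..} v * ((B * \<bar>C\<bar>) * exp (- (v * \<delta>))))"
    using set_integrable_mult_right[OF integrable_I0i_exp_mscale[OF K(2)], of "B * \<bar>C\<bar>"] by (simp add: set_integrable_def)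
  then have "integrable (lborel \<Otimes>\<^sub>M \<mu>) (\<lambda>p. (\<lambda>v. indicator {0<..} v * ((B * \<bar>C\<bar>) * exp (- (v * \<delta>)))) (fst p))"
  proof (intro Fubini_integrable)
    assume i: "integrable lborel (\<lambda>v. indicator {0<..} v * ((B * \<bar>C\<bar>) * exp (- (v * \<delta>))))"
    show "integrable lborel (\<lambda>v. \<integral>y. norm (indicator {0<..} (fst (v, y)) * ((B * \<bar>C\<bar>) * exp (- (fst (v, y) * \<delta>)))) \<partial>\<mu>)"
      using integrable_norm[OF i] by (simp add: \<mu>.prob_space)
  qed auto
  then have iG: "integrable (lborel \<Otimes>\<^sub>M \<mu>) (\<lambda>p. G (fst p) (snd p))"
    by (rule Bochner_Integration.integrable_bound[OF _ Gm]) (use C in \<open>auto intro!: AE_I2 order_trans[OF _ abs_ge_self]\<close>)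
  then have iG': "integrable (lborel \<Otimes>\<^sub>M \<mu>) (\<lambda>(v, y). G v y)" by (simp add: case_prod_unfold)
  have "(\<integral>y. u y \<partial>\<mu>) = (\<integral>y. (\<integral>v. G v y \<partial>lborel) \<partial>\<mu>)"
  proof (rule integral_cong_AE)
    have "u y = (\<integral>v. G v y \<partial>lborel)" if "norm y = r" for y
      unfolding u[OF that, symmetric] set_lebesgue_integral_def using that
      by (intro Bochner_Integration.integral_cong) (auto simp: G_def S_def)
    then show "AE y in \<mu>. u y = (\<integral>v. G v y \<partial>lborel)"
      using \<mu>(3) by (auto elim: eventually_mono)
    show "(\<lambda>y. \<integral>v. G v y \<partial>lborel) \<in> borel_measurable \<mu>"
      using borel_measurable_integrable[OF integrable_snd[OF iG']] by simp
    show "u \<in> borel_measurable \<mu>" using meas(2) by measurable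
  qed
  also have "\<dots> = (\<integral>v. (\<integral>y. G v y \<partial>\<mu>) \<partial>lborel)"
    by (rule Fubini_integral[OF iG'])
  also have "\<dots> = (LINT v:{0<..}|lborel. K v * H v)"
    unfolding set_lebesgue_integral_def
  proof (rule Bochner_Integration.integral_cong[OF refl])
    fix v :: real
    show "(\<integral>y. G v y \<partial>\<mu>) = indicator {0<..} v *\<^sub>R (K v * H v)"
    proof (cases "v > 0")
      case True
      have [measurable]: "g v \<in> borel_measurable borel" using meas(1)[OF True] .
      have "(\<integral>y. G v y \<partial>\<mu>) = (\<integral>y. K v * g v y \<partial>\<mu>)"
      proof (rule integral_cong_AE)
        show "G v \<in> borel_measurable \<mu>" unfolding G_def[abs_def] by measurable
        show "AE y in \<mu>. G v y = K v * g v y"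
          using \<mu>(3) by eventually_elim (use True in \<open>simp add: G_def S_def\<close>)
      qed measurable
      then show ?thesis using True H by simp
    qed (simp add: G_def)
  qed
  finally show ?thesis .
qed

section \<open>Newton kernels along a dilation\<close>

text \<open>Up to the factor \<open>exp (2 * v)\<close> this is the squared distance of \<open>x\<close> from the dilated pole
\<open>exp v *\<^sub>R z\<close>.\<close>

definition dsq :: "'a::real_inner \<Rightarrow> 'a \<Rightarrow> real \<Rightarrow> real" where
  "dsq x z v = (norm (exp (- v) *\<^sub>R x - z))\<^sup>2"

lemma dsq_alt: "dsq x z v = z \<bullet> z - 2 * (x \<bullet> z) * exp (- v) + (x \<bullet> x) * (exp (- v))\<^sup>2"
  unfolding dsq_def power2_norm_eq_inner by (simp add: inner_diff inner_commute algebra_simps power2_eq_square)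

lemma dsq_0: "dsq x z 0 = (norm (x - z))\<^sup>2"
  by (simp add: dsq_def)

lemma dsq_scale: "(x - exp v *\<^sub>R z) \<bullet> (x - exp v *\<^sub>R z) = (exp v)\<^sup>2 * dsq x z v"
proof -
  have "x - exp v *\<^sub>R z = exp v *\<^sub>R (exp (- v) *\<^sub>R x - z)"
    by (simp add: scaleR_diff_right mult_exp_exp)
  then show ?thesis by (simp add: dsq_def power2_norm_eq_inner[symmetric] power_mult_distrib)
qed

lemma dsq_deriv:
  "(dsq x z has_real_derivative ((z \<bullet> z - (x \<bullet> x) * (exp (- v))\<^sup>2) - dsq x z v)) (at v)"
proof -
  have "((\<lambda>v. z \<bullet> z - 2 * (x \<bullet> z) * exp (- v) + (x \<bullet> x) * (exp (- v))\<^sup>2) has_real_derivative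
      2 * (x \<bullet> z) * exp (- v) - 2 * (x \<bullet> x) * (exp (- v))\<^sup>2) (at v)"
    by (auto intro!: derivative_eq_intros simp: power2_eq_square)
  then show ?thesis by (simp add: dsq_alt[abs_def] algebra_simps)
qed

lemma dsq_lower:
  assumes "v \<ge> 0" "norm x \<le> \<rho>" "\<rho> \<le> norm z"
  shows "(norm z - \<rho>)\<^sup>2 \<le> dsq x z v"
proof -
  have "norm z - norm (exp (- v) *\<^sub>R x) \<le> norm (z - exp (- v) *\<^sub>R x)" by (rule norm_triangle_ineq2)
  moreover have "norm (exp (- v) *\<^sub>R x) \<le> norm x" using assms(1) by (simp add: mult_left_le_one_le)
  ultimately have "norm z - \<rho> \<le> norm (exp (- v) *\<^sub>R x - z)" using assms by (simp add: norm_minus_commute)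
  then show ?thesis unfolding dsq_def using assms by (intro power_mono) auto
qed

lemma dsq_pos:
  assumes "v \<ge> 0" "norm x < norm z"
  shows "dsq x z v > 0"
proof -
  have "0 < (norm z - norm x)\<^sup>2" using assms(2) by simp
  then show ?thesis using dsq_lower[OF assms(1) order_refl, of x z] assms(2) by linarith
qed

lemma dsq_upper:
  assumes "v \<ge> 0" "norm x \<le> \<rho>"
  shows "dsq x z v \<le> (norm z + \<rho>)\<^sup>2"
proof -
  have "norm (exp (- v) *\<^sub>R x - z) \<le> norm (exp (- v) *\<^sub>R x) + norm z" by (rule norm_triangle_ineq4)
  moreover have "norm (exp (- v) *\<^sub>R x) \<le> norm x" using assms(1) by (simp add: mult_left_le_one_le)
  ultimately show ?thesis unfolding dsq_def using assms by (intro power_mono) auto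
qed

text \<open>The Newton kernel of dimension \<open>2 * m + 2\<close> at the scaled point, followed by its first two derivatives
with respect to \<open>v\<close>.\<close>

definition newton :: "nat \<Rightarrow> 'a::real_inner \<Rightarrow> 'a \<Rightarrow> real \<Rightarrow> real" where
  "newton m x z v = 1 / dsq x z v ^ m"

definition newton1 :: "nat \<Rightarrow> 'a::real_inner \<Rightarrow> 'a \<Rightarrow> real \<Rightarrow> real" where
  "newton1 m x z v = - real m * ((z \<bullet> z - (x \<bullet> x) * (exp (- v))\<^sup>2) - dsq x z v) / dsq x z v ^ (m + 1)"

definition newton2 :: "nat \<Rightarrow> 'a::real_inner \<Rightarrow> 'a \<Rightarrow> real \<Rightarrow> real" where
  "newton2 m x z v =
     - real m * (2 * (x \<bullet> x) * (exp (- v))\<^sup>2 - (z \<bullet> z - (x \<bullet> x) * (exp (- v))\<^sup>2) + dsq x z v) / dsq x z v ^ (m + 1)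
     + real m * real (m + 1) * ((z \<bullet> z - (x \<bullet> x) * (exp (- v))\<^sup>2) - dsq x z v)\<^sup>2 / dsq x z v ^ (m + 2)"

lemma newton_deriv:
  assumes D: "dsq x z v > 0"
  shows "(newton m x z has_real_derivative newton1 m x z v) (at v)"
    and "(newton1 m x z has_real_derivative newton2 m x z v) (at v)"
proof -
  have inv: "((\<lambda>v. 1 / dsq x z v ^ k) has_real_derivative
      - real k / dsq x z v ^ (k + 1) * ((z \<bullet> z - (x \<bullet> x) * (exp (- v))\<^sup>2) - dsq x z v)) (at v)" for k
    by (rule DERIV_chain2[OF inverse_power_deriv dsq_deriv]) (use D in simp)
  show "(newton m x z has_real_derivative newton1 m x z v) (at v)"
    unfolding newton_def[abs_def] newton1_def using inv[of m] by (simp add: mult.commute)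
  have e: "((\<lambda>v. (exp (- v))\<^sup>2) has_real_derivative - 2 * (exp (- v))\<^sup>2) (at v)"
    by (auto intro!: derivative_eq_intros simp: power2_eq_square)
  have main: "((\<lambda>v. (- real m * ((z \<bullet> z - (x \<bullet> x) * (exp (- v))\<^sup>2) - dsq x z v)) * (1 / dsq x z v ^ (m + 1))) has_real_derivative
      (- real m * ((0 - (x \<bullet> x) * (- 2 * (exp (- v))\<^sup>2)) - ((z \<bullet> z - (x \<bullet> x) * (exp (- v))\<^sup>2) - dsq x z v))) * (1 / dsq x z v ^ (m + 1))
      + (- real (m + 1) / dsq x z v ^ (m + 1 + 1) * ((z \<bullet> z - (x \<bullet> x) * (exp (- v))\<^sup>2) - dsq x z v))
        * (- real m * ((z \<bullet> z - (x \<bullet> x) * (exp (- v))\<^sup>2) - dsq x z v))) (at v)"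
    by (intro DERIV_mult DERIV_cmult DERIV_diff DERIV_const e dsq_deriv inv)
  have val: "(- k * ((0 - q * (- 2 * E)) - (W - D))) * (1 / P) + (- l / P' * (W - D)) * (- k * (W - D))
      = - k * (2 * q * E - W + D) / P + k * l * (W - D)\<^sup>2 / P'" for k l q E W D P P' :: real
    by (simp add: divide_inverse power2_eq_square algebra_simps)
  from main[unfolded val] show "(newton1 m x z has_real_derivative newton2 m x z v) (at v)"
    unfolding newton1_def[abs_def] newton2_def
    by (simp only: times_divide_eq_right mult_1_right add.assoc one_add_one)
qed

lemma newton_bounds:
  fixes z :: "'a::real_inner"
  assumes "\<rho> < norm z" "0 \<le> \<rho>"
  shows "\<exists>C. \<forall>x v. norm x = \<rho> \<longrightarrow> 0 \<le> v \<longrightarrow> \<bar>newton m x z v\<bar> \<le> C \<and> \<bar>newton1 m x z v\<bar> \<le> C \<and> \<bar>newton2 m x z v\<bar> \<le> C"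
proof -
  define D0 where "D0 = (norm z - \<rho>)\<^sup>2"
  define Y where "Y = z \<bullet> z + 3 * \<rho>\<^sup>2 + (norm z + \<rho>)\<^sup>2"
  have D0: "D0 > 0" using assms by (simp add: D0_def)
  define C where "C = 1 / D0 ^ m + real m * Y / D0 ^ (m + 1) + real m * real (m + 1) * Y\<^sup>2 / D0 ^ (m + 2)"
  have Y: "Y \<ge> 0" by (simp add: Y_def)
  have nn: "0 \<le> 1 / D0 ^ m" "0 \<le> real m * Y / D0 ^ (m + 1)" "0 \<le> real m * real (m + 1) * Y\<^sup>2 / D0 ^ (m + 2)"
    using D0 Y by simp_all
  have "\<bar>newton m x z v\<bar> \<le> C \<and> \<bar>newton1 m x z v\<bar> \<le> C \<and> \<bar>newton2 m x z v\<bar> \<le> C" if x: "norm x = \<rho>" and v: "v \<ge> 0" for x v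
  proof -
    have xx: "x \<bullet> x = \<rho>\<^sup>2" using x by (simp add: power2_norm_eq_inner[symmetric])
    define D where "D = dsq x z v"
    define E where "E = (exp (- v))\<^sup>2"
    have E: "0 \<le> E" "E \<le> 1" using v by (auto simp: E_def power_le_one)
    have D: "D0 \<le> D" "D \<le> (norm z + \<rho>)\<^sup>2" "0 < D"
      using dsq_lower[OF v eq_refl[OF x]] dsq_upper[OF v eq_refl[OF x]] dsq_pos[OF v, of x z] x assms by (auto simp: D_def D0_def)
    have xE: "0 \<le> (x \<bullet> x) * E" "(x \<bullet> x) * E \<le> x \<bullet> x"
      using E by (auto simp: mult_left_le)
    have W: "\<bar>(z \<bullet> z - (x \<bullet> x) * E) - D\<bar> \<le> Y" "\<bar>2 * (x \<bullet> x) * E - (z \<bullet> z - (x \<bullet> x) * E) + D\<bar> \<le> Y"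
      using xE D inner_ge_zero[of z] unfolding Y_def abs_le_iff xx by - (intro conjI; linarith)+
    have q: "\<bar>a / D ^ k\<bar> \<le> b / D0 ^ k" if "\<bar>a\<bar> \<le> b" for a b k
    proof -
      have "\<bar>a / D ^ k\<bar> = \<bar>a\<bar> / D ^ k" using D by simp
      also have "\<dots> \<le> b / D0 ^ k" using that D D0 by (intro frac_le power_mono zero_less_power) auto
      finally show ?thesis .
    qed
    have 0: "\<bar>newton m x z v\<bar> \<le> 1 / D0 ^ m" unfolding newton_def D_def[symmetric] by (rule q) simp
    have 1: "\<bar>newton1 m x z v\<bar> \<le> real m * Y / D0 ^ (m + 1)"
      unfolding newton1_def D_def[symmetric] E_def[symmetric]
      by (rule q) (use W in \<open>simp add: abs_mult mult_left_mono\<close>)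
    have "\<bar>newton2 m x z v\<bar> \<le> real m * Y / D0 ^ (m + 1) + real m * real (m + 1) * Y\<^sup>2 / D0 ^ (m + 2)"
      unfolding newton2_def D_def[symmetric] E_def[symmetric]
    proof (rule order_trans[OF abs_triangle_ineq], intro add_mono q)
      show "\<bar>- real m * (2 * (x \<bullet> x) * E - (z \<bullet> z - (x \<bullet> x) * E) + D)\<bar> \<le> real m * Y"
        using W(2) by (simp add: abs_mult mult_left_mono)
      have "(z \<bullet> z - (x \<bullet> x) * E - D)\<^sup>2 \<le> Y\<^sup>2" using W(1) by (metis abs_ge_zero power2_abs power_mono)
      then show "\<bar>real m * real (m + 1) * (z \<bullet> z - (x \<bullet> x) * E - D)\<^sup>2\<bar> \<le> real m * real (m + 1) * Y\<^sup>2"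
        by (simp add: abs_mult mult_left_mono del: of_nat_add)
    qed
    with 0 1 show ?thesis unfolding C_def using nn by linarith
  qed
  then show ?thesis by blast
qed

lemma continuous_on_dsq: "continuous_on S (dsq x z)"
  unfolding dsq_def[abs_def] by (intro continuous_intros)

text \<open>The kernel and its derivatives are given by their coefficients: differentiation takes \<open>(c, s)\<close> to
\<open>(s - b * c, d * c - b * s)\<close>.\<close>

lemma newton_kernel_integral:
  fixes x z :: "'a::real_inner" and b c d s :: real
  assumes xz: "norm x < norm z" and b: "sqrt (max d 0) < b"
  defines "c1 \<equiv> s - b * c" and "s1 \<equiv> d * c - b * s"
  shows "(LINT v:{0<..}|lborel. damped b d c s v * (A2 * newton2 m x z v - A1 * newton1 m x z v + A0 * newton m x z v))
     = A2 * (c1 * newton m x z 0 - c * newton1 m x z 0) + A1 * (c * newton m x z 0)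
       + (LINT v:{0<..}|lborel. damped b d (A2 * (s1 - b * c1) + A1 * c1 + A0 * c) (A2 * (d * c1 - b * s1) + A1 * s1 + A0 * s) v
           * newton m x z v)"
proof -
  obtain C where C: "\<And>v. v \<ge> 0 \<Longrightarrow> \<bar>newton m x z v\<bar> \<le> C" "\<And>v. v \<ge> 0 \<Longrightarrow> \<bar>newton1 m x z v\<bar> \<le> C"
    "\<And>v. v \<ge> 0 \<Longrightarrow> \<bar>newton2 m x z v\<bar> \<le> C"
    using newton_bounds[OF xz norm_ge_zero, of m] by blast
  obtain \<delta> B where B: "\<delta> > 0" "\<And>v. v \<ge> 0 \<Longrightarrow> \<bar>damped b d c s v\<bar> \<le> B * exp (- \<delta> * v)"
    "\<And>v. v \<ge> 0 \<Longrightarrow> \<bar>damped b d c1 s1 v\<bar> \<le> B * exp (- \<delta> * v)"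
    "\<And>v. v \<ge> 0 \<Longrightarrow> \<bar>damped b d (s1 - b * c1) (d * c1 - b * s1) v\<bar> \<le> B * exp (- \<delta> * v)"
    using damped_bound[OF b, of c s c1 s1 "s1 - b * c1" "d * c1 - b * s1"] by blast
  have pos: "dsq x z v > 0" if "v \<ge> 0" for v using dsq_pos[OF that xz] .
  have k: "A2 * damped b d (s1 - b * c1) (d * c1 - b * s1) v + A1 * damped b d c1 s1 v + A0 * damped b d c s v
     = damped b d (A2 * (s1 - b * c1) + A1 * c1 + A0 * c) (A2 * (d * c1 - b * s1) + A1 * s1 + A0 * s) v" for v
    by (simp add: damped_def algebra_simps)
  have "(LINT v:{0<..}|lborel. damped b d c s v * (A2 * newton2 m x z v - A1 * newton1 m x z v + A0 * newton m x z v))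
     = A2 * (damped b d c1 s1 0 * newton m x z 0 - damped b d c s 0 * newton1 m x z 0) + A1 * (damped b d c s 0 * newton m x z 0)
       + (LINT v:{0<..}|lborel. (A2 * damped b d (s1 - b * c1) (d * c1 - b * s1) v + A1 * damped b d c1 s1 v + A0 * damped b d c s v)
           * newton m x z v)"
  proof (rule kernel_integral_by_parts[where \<delta> = \<delta> and B = B and C = C])
    show "(damped b d c s has_real_derivative damped b d c1 s1 v) (at v)" for v
      unfolding c1_def s1_def by (rule damped_deriv)
    show "(damped b d c1 s1 has_real_derivative damped b d (s1 - b * c1) (d * c1 - b * s1) v) (at v)" for v
      by (rule damped_deriv)
    show "continuous_on {0<..} (damped b d (s1 - b * c1) (d * c1 - b * s1))" by (intro continuous_intros)
    have "dsq x z v \<noteq> 0" if "v \<in> {0<..}" for v using pos[of v] that by auto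
    then show "continuous_on {0<..} (newton2 m x z)"
      unfolding newton2_def[abs_def] by (intro continuous_intros continuous_on_dsq) auto
  qed (use B C newton_deriv[OF pos] in auto)
  then show ?thesis unfolding k damped_0 .
qed

text \<open>Dominated convergence: the distance from the scaled point to all \<open>z\<close> with \<open>r \<le> norm z\<close> is bounded
below.\<close>

lemma continuous_kernel_newton:
  fixes x :: "'a::{real_inner, second_countable_topology, banach}"
  assumes x: "norm x < r" and b: "sqrt (max d 0) < b"
  shows "continuous_on {z. r \<le> norm z} (\<lambda>z. LINT v:{0<..}|lborel. damped b d c s v * newton m x z v)"
  unfolding continuous_on_sequentially
proof (intro allI ballI impI, elim conjE)
  fix zs :: "nat \<Rightarrow> 'a" and z assume z: "z \<in> {z. r \<le> norm z}" "\<forall>n. zs n \<in> {z. r \<le> norm z}" "zs \<longlonglongrightarrow> z"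
  obtain \<delta> B where B: "\<delta> > 0" "\<And>v. v \<ge> 0 \<Longrightarrow> \<bar>damped b d c s v\<bar> \<le> B * exp (- \<delta> * v)"
    using damped_bound[OF b, of c s c s c s] by blast
  define D0 where "D0 = (r - norm x)\<^sup>2"
  have D0: "D0 > 0" using x by (simp add: D0_def)
  have low: "D0 \<le> dsq x z v" if "v \<ge> 0" "r \<le> norm z" for z v
  proof -
    have "D0 \<le> (norm z - norm x)\<^sup>2" unfolding D0_def using x that by (intro power_mono) auto
    also have "\<dots> \<le> dsq x z v" using that x by (intro dsq_lower) auto
    finally show ?thesis .
  qed
  have meas: "(\<lambda>v. indicator {0<..} v *\<^sub>R (damped b d c s v * newton m x z v)) \<in> borel_measurable lborel" if "r \<le> norm z" for z
  proof -
    have "dsq x z v \<noteq> 0" if "v \<in> {0<..}" for v using low[of v z] D0 that \<open>r \<le> norm z\<close> by auto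
    then have "continuous_on {0<..} (\<lambda>v. damped b d c s v * newton m x z v)"
      unfolding newton_def by (intro continuous_intros continuous_on_dsq) auto
    from borel_measurable_continuous_on_indicator[OF _ this] show ?thesis by simp
  qed
  have "(\<lambda>n. LINT v:{0<..}|lborel. damped b d c s v * newton m x (zs n) v) \<longlonglongrightarrow> (LINT v:{0<..}|lborel. damped b d c s v * newton m x z v)"
    unfolding set_lebesgue_integral_def
  proof (rule integral_dominated_convergence[where w = "\<lambda>v. indicator {0<..} v *\<^sub>R ((B / D0 ^ m) * exp (- (v * \<delta>)))"])
    show "integrable lborel (\<lambda>v. indicator {0<..} v *\<^sub>R ((B / D0 ^ m) * exp (- (v * \<delta>))))"
      using set_integrable_mult_right[OF integrable_I0i_exp_mscale[OF B(1)], of "B / D0 ^ m"] by (simp add: set_integrable_def)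
    have "(\<lambda>n. indicator {0<..} v *\<^sub>R (damped b d c s v * newton m x (zs n) v)) \<longlonglongrightarrow> indicator {0<..} v *\<^sub>R (damped b d c s v * newton m x z v)" for v
    proof (cases "v > 0")
      case True
      then have "dsq x z v \<noteq> 0" using low[of v z] z(1) D0 by auto
      then show ?thesis unfolding newton_def dsq_def by (intro tendsto_intros z(3)) (auto simp: dsq_def)
    qed simp
    then show "AE v in lborel. (\<lambda>n. indicator {0<..} v *\<^sub>R (damped b d c s v * newton m x (zs n) v)) \<longlonglongrightarrow> indicator {0<..} v *\<^sub>R (damped b d c s v * newton m x z v)"
      by simp
    have "norm (indicator {0<..} v *\<^sub>R (damped b d c s v * newton m x (zs n) v)) \<le> indicator {0<..} v *\<^sub>R ((B / D0 ^ m) * exp (- (v * \<delta>)))" for v n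
    proof (cases "v > 0")
      case True
      have "newton m x (zs n) v \<le> 1 / D0 ^ m"
        unfolding newton_def using low[of v "zs n"] z(2) True D0 by (intro divide_left_mono power_mono mult_pos_pos zero_less_power) auto
      moreover have "0 \<le> newton m x (zs n) v" by (simp add: newton_def dsq_def)
      ultimately have "\<bar>damped b d c s v * newton m x (zs n) v\<bar> \<le> (B * exp (- \<delta> * v)) * (1 / D0 ^ m)"
        unfolding abs_mult using B(2)[of v] True by (intro mult_mono) (auto intro: order_trans[OF abs_ge_zero])
      then show ?thesis using True by (simp add: mult.commute)
    qed simp
    then show "AE v in lborel. norm (indicator {0<..} v *\<^sub>R (damped b d c s v * newton m x (zs n) v)) \<le> indicator {0<..} v *\<^sub>R ((B / D0 ^ m) * exp (- (v * \<delta>)))" for n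
      by simp
  qed (use meas z in auto)
  then show "((\<lambda>z. LINT v:{0<..}|lborel. damped b d c s v * newton m x z v) \<circ> zs) \<longlonglongrightarrow> (LINT v:{0<..}|lborel. damped b d c s v * newton m x z v)"
    by (simp add: comp_def)
qed

section \<open>The exit law\<close>

definition exit_law :: "'w measure \<Rightarrow> (real \<Rightarrow> 'w \<Rightarrow> real ^ 'n) \<Rightarrow> real \<Rightarrow> (real ^ 'n) measure" where
  "exit_law M X r = distr M borel (exit_position r X)"

context hyperbolic_motion
begin

lemma exit_law_basic:
  assumes "0 < r" "r < 1" "CARD('n) \<ge> 2" "norm x < r"
  shows "prob_space (exit_law M X r)" "sets (exit_law M X r) = sets borel" "AE y in exit_law M X r. norm y = r"
proof -
  show "prob_space (exit_law M X r)" unfolding exit_law_def by (rule prob_space_distr) simp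
  show "sets (exit_law M X r) = sets borel" by (simp add: exit_law_def)
  show "AE y in exit_law M X r. norm y = r"
    unfolding exit_law_def using exit_position_on_sphere[OF assms] by (subst AE_distr_iff) auto
qed

text \<open>If the test function is harmonic on the ball and agrees there with \<open>h\<close>, then the mean of \<open>h\<close> at the
exit position is \<open>h x\<close>.\<close>

lemma exit_law_integral:
  assumes r: "0 < r" "r < 1" "CARD('n) \<ge> 2" "norm x < r"
    and f: "test_function f" "\<And>y. norm y \<le> r \<Longrightarrow> hyperbolic_Laplacian f y = 0"
      "\<And>y. norm y \<le> r \<Longrightarrow> f y = h y" and h: "g \<in> borel_measurable borel" "\<And>y. norm y = r \<Longrightarrow> g y = h y"
  shows "(\<integral>y. g y \<partial>exit_law M X r) = h x"
proof -
  have mf [measurable]: "f \<in> borel_measurable borel"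
    by (rule borel_measurable_continuous_onI[OF continuous_on_hyperbolic_Laplacian(1)[OF f(1)]])
  have "(\<integral>y. g y \<partial>exit_law M X r) = (\<integral>y. f y \<partial>exit_law M X r)"
  proof (rule integral_cong_AE)
    show "g \<in> borel_measurable (exit_law M X r)" "f \<in> borel_measurable (exit_law M X r)"
      using h(1) by (simp_all add: exit_law_def)
    show "AE y in exit_law M X r. g y = f y"
      using exit_law_basic(3)[OF r] by eventually_elim (simp add: h f(3))
  qed
  also have "\<dots> = (\<integral>\<omega>. f (exit_position r X \<omega>) \<partial>M)"
    unfolding exit_law_def by (rule integral_distr) auto
  also have "\<dots> = h x" using exit_position_expectation[OF r(1,2,3) f(1,2)] f(3)[of x] r by simp
  finally show ?thesis .
qed

end

section \<open>Poisson integrals of the exit law\<close>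

lemma newton_measurable [measurable]:
  fixes z :: "real ^ 'n"
  shows "(\<lambda>y. newton m y z v) \<in> borel_measurable borel" "(\<lambda>y. newton1 m y z v) \<in> borel_measurable borel"
    "(\<lambda>y. newton2 m y z v) \<in> borel_measurable borel"
  unfolding newton_def newton1_def newton2_def dsq_def by measurable

text \<open>The differential operator has constant coefficients \<open>A2, A1, A0\<close> on the sphere and different ones,
\<open>B2, B1, B0\<close>, at the starting point.  The equations \<open>ode\<close> say that the kernel solves the adjoint equation on the
sphere, so there only the boundary terms at \<open>v = 0\<close> survive.  At the starting point the integral
remains, with the kernel to which the adjoint operator with the coefficients \<open>B2, B1, B0\<close> has been applied.\<close>

lemma exit_newton_transfer:
  fixes \<mu> :: "(real ^ 'n) measure" and b d c s :: real
  assumes \<mu>: "prob_space \<mu>" "sets \<mu> = sets borel" "AE y in \<mu>. norm y = r"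
    and r: "0 \<le> r" "r < norm z" and x: "norm x < r" and b: "sqrt (max d 0) < b"
  defines "c1 \<equiv> s - b * c" and "s1 \<equiv> d * c - b * s"
  assumes ode: "A2 * (s1 - b * c1) + A1 * c1 + A0 * c = 0" "A2 * (d * c1 - b * s1) + A1 * s1 + A0 * s = 0"
    and H: "\<And>v. v > 0 \<Longrightarrow> (\<integral>y. A2 * newton2 m y z v - A1 * newton1 m y z v + A0 * newton m y z v \<partial>\<mu>)
       = B2 * newton2 m x z v - B1 * newton1 m x z v + B0 * newton m x z v"
  shows "(\<integral>y. A2 * (c1 * newton m y z 0 - c * newton1 m y z 0) + A1 * (c * newton m y z 0) \<partial>\<mu>)
     = B2 * (c1 * newton m x z 0 - c * newton1 m x z 0) + B1 * (c * newton m x z 0)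
       + (LINT v:{0<..}|lborel. damped b d (B2 * (s1 - b * c1) + B1 * c1 + B0 * c) (B2 * (d * c1 - b * s1) + B1 * s1 + B0 * s) v
           * newton m x z v)"
proof -
  obtain C where C: "\<And>y v. norm y = r \<Longrightarrow> 0 \<le> v \<Longrightarrow> \<bar>newton m y z v\<bar> \<le> C \<and> \<bar>newton1 m y z v\<bar> \<le> C \<and> \<bar>newton2 m y z v\<bar> \<le> C"
    using newton_bounds[OF r(2,1), of m] by blast
  obtain \<delta> B where B: "\<delta> > 0" "\<And>v. v \<ge> 0 \<Longrightarrow> \<bar>damped b d c s v\<bar> \<le> B * exp (- \<delta> * v)"
    "\<And>v. v \<ge> 0 \<Longrightarrow> \<bar>damped b d c1 s1 v\<bar> \<le> B * exp (- \<delta> * v)"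
    using damped_bound[OF b, of c s c1 s1 c1 s1] by blast
  let ?g = "\<lambda>v y. A2 * newton2 m y z v - A1 * newton1 m y z v + A0 * newton m y z v"
  have "(\<integral>y. A2 * (c1 * newton m y z 0 - c * newton1 m y z 0) + A1 * (c * newton m y z 0) \<partial>\<mu>)
     = (LINT v:{0<..}|lborel. damped b d c s v * (B2 * newton2 m x z v - B1 * newton1 m x z v + B0 * newton m x z v))"
  proof (rule integral_kernel_exchange[OF \<mu> _ B(1,2), where g = ?g and C = "\<bar>A2\<bar> * C + \<bar>A1\<bar> * C + \<bar>A0\<bar> * C"])
    show "continuous_on {0<..} (damped b d c s)" by (intro continuous_intros)
    have pos: "dsq (snd p) z (fst p) \<noteq> 0" if "p \<in> {0<..} \<times> {y. norm y = r}" for p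
      using dsq_pos[of "fst p" "snd p" z] that r by auto
    have cd: "continuous_on ({0<..} \<times> {y. norm y = r}) (\<lambda>p. dsq (snd p) z (fst p))"
      unfolding dsq_def by (intro continuous_intros)
    show "continuous_on ({0<..} \<times> {y. norm y = r}) (\<lambda>p. ?g (fst p) (snd p))"
      unfolding newton_def newton1_def newton2_def
      by (intro continuous_intros cd) (use pos in auto)
    show "\<bar>?g v y\<bar> \<le> \<bar>A2\<bar> * C + \<bar>A1\<bar> * C + \<bar>A0\<bar> * C" if "v > 0" "norm y = r" for v y
    proof -
      have "\<bar>A2 * newton2 m y z v\<bar> \<le> \<bar>A2\<bar> * C" "\<bar>A1 * newton1 m y z v\<bar> \<le> \<bar>A1\<bar> * C" "\<bar>A0 * newton m y z v\<bar> \<le> \<bar>A0\<bar> * C"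
        unfolding abs_mult using C[OF that(2), of v] that(1) by (auto intro: mult_left_mono)
      then show ?thesis by linarith
    qed
    show "(LINT v:{0<..}|lborel. damped b d c s v * ?g v y)
       = A2 * (c1 * newton m y z 0 - c * newton1 m y z 0) + A1 * (c * newton m y z 0)" if "norm y = r" for y
    proof -
      have "norm y < norm z" using that r by simp
      from newton_kernel_integral[OF this b, of c s A2 m A1 A0]
      show ?thesis unfolding c1_def[symmetric] s1_def[symmetric] ode by (simp add: damped_def)
    qed
    show "?g v \<in> borel_measurable borel" for v by measurable
    show "(\<lambda>y. A2 * (c1 * newton m y z 0 - c * newton1 m y z 0) + A1 * (c * newton m y z 0)) \<in> borel_measurable borel"
      by measurable
  qed (assumption, erule H)
  also have "\<dots> = B2 * (c1 * newton m x z 0 - c * newton1 m x z 0) + B1 * (c * newton m x z 0)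
       + (LINT v:{0<..}|lborel. damped b d (B2 * (s1 - b * c1) + B1 * c1 + B0 * c) (B2 * (d * c1 - b * s1) + B1 * s1 + B0 * s) v
           * newton m x z v)"
    unfolding c1_def s1_def by (rule newton_kernel_integral[OF _ b]) (use x r in simp)
  finally show ?thesis .
qed

text \<open>Homogeneity lets the pole be dilated instead of the point, and then \<open>E = - d/dv\<close>.\<close>

lemma harm4_newton:
  assumes "dsq x z v > 0"
  shows "(exp v)\<^sup>2 * harm4 ((exp v *\<^sub>R z) \<bullet> (exp v *\<^sub>R z)) (x \<bullet> x) ((x - exp v *\<^sub>R z) \<bullet> (x - exp v *\<^sub>R z))
    = 0 * newton2 1 x z v - (1 - x \<bullet> x) * newton1 1 x z v + 2 * newton 1 x z v"
proof -
  define E where "E = exp v"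
  have E: "E \<noteq> 0" "exp (- v) = 1 / E" by (simp_all add: E_def exp_minus divide_inverse)
  have gen: "E\<^sup>2 * harm4 (E\<^sup>2 * R2) q (E\<^sup>2 * D) = (1 - q) * ((R2 - q * (1 / E)\<^sup>2) - D) / D ^ 2 + 2 / D" if "D \<noteq> 0" for R2 q D
    using that E(1) unfolding harm4_def by (simp add: field_simps power2_eq_square)
  have "(exp v *\<^sub>R z) \<bullet> (exp v *\<^sub>R z) = E\<^sup>2 * (z \<bullet> z)" by (simp add: E_def power2_eq_square)
  then show ?thesis
    unfolding dsq_scale unfolding E_def[symmetric] using gen[of "dsq x z v" "z \<bullet> z" "x \<bullet> x"] assms
    by (simp add: newton1_def newton_def E power2_eq_square mult.assoc) (simp add: divide_inverse algebra_simps)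
qed

lemma harm6_newton:
  assumes "dsq x z v > 0"
  shows "(exp v)\<^sup>2 * (exp v)\<^sup>2 * harm6 ((exp v *\<^sub>R z) \<bullet> (exp v *\<^sub>R z)) (x \<bullet> x) ((x - exp v *\<^sub>R z) \<bullet> (x - exp v *\<^sub>R z))
    = (1 - x \<bullet> x)\<^sup>2 * newton2 2 x z v - ((1 - x \<bullet> x) * (7 - x \<bullet> x)) * newton1 2 x z v + 12 * newton 2 x z v"
proof -
  define E where "E = (exp v)\<^sup>2"
  have E: "E \<noteq> 0" "(exp (- v))\<^sup>2 = 1 / E" by (simp_all add: E_def exp_minus divide_inverse power_inverse)
  have gen: "E * E * harm6 (E * R2) q (E * D)
     = (1 - q)\<^sup>2 * (- 2 * (2 * q * e - (R2 - q * e) + D) / D ^ 3 + 2 * 3 * ((R2 - q * e) - D)\<^sup>2 / D ^ 4)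
       - ((1 - q) * (7 - q)) * (- 2 * ((R2 - q * e) - D) / D ^ 3) + 12 * (1 / D ^ 2)"
    if "D \<noteq> 0" "e = 1 / E" for R2 q D e
  proof -
    define t where "t = 1 / D"
    have Dt: "D * t = 1" "E * e = 1" using that E(1) by (simp_all add: t_def)
    have p: "a / D ^ k = a * t ^ k" for a k by (simp add: t_def power_divide)
    have pE: "a / (E * D) ^ k = a * (e * t) ^ k" for a k by (simp add: t_def that(2) power_divide power_mult_distrib)
    show ?thesis unfolding harm6_def p pE using Dt by algebra
  qed
  have zz: "(exp v *\<^sub>R z) \<bullet> (exp v *\<^sub>R z) = E * (z \<bullet> z)" by (simp add: E_def power2_eq_square)
  have num: "real 2 = 2" "real (2 + 1) = 3" "(2::nat) + 1 = 3" "(2::nat) + 2 = 4" "real 3 = 3" by simp_all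
  show ?thesis
    unfolding dsq_scale zz newton_def newton1_def newton2_def num E_def[symmetric]
    by (rule gen) (use assms E(2) in simp_all)
qed

context hyperbolic_motion
begin

lemma exit_newton4:
  assumes n: "CARD('n) = 4" and r: "0 < r" "r < 1" "norm x < r" and z: "r < norm z" and v: "v \<ge> 0"
  shows "(\<integral>y. 0 * newton2 1 y z v - (1 - r\<^sup>2) * newton1 1 y z v + 2 * newton 1 y z v \<partial>exit_law M X r)
    = 0 * newton2 1 x z v - (1 - x \<bullet> x) * newton1 1 x z v + 2 * newton 1 x z v"
proof -
  define z' where "z' = exp v *\<^sub>R z"
  have "1 * norm z \<le> exp v * norm z" using v by (intro mult_right_mono) auto
  then have z': "r < norm z'" using z by (simp add: z'_def)
  obtain f where f: "test_function f" "\<And>x. norm x \<le> r \<Longrightarrow> f x = harm4 (z' \<bullet> z') (x \<bullet> x) ((x - z') \<bullet> (x - z'))"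
    "\<And>x. norm x \<le> r \<Longrightarrow> hyperbolic_Laplacian f x = 0"
    using harm4_test_function[OF n r(1,2) z'] by blast
  let ?g = "\<lambda>y. 0 * newton2 1 y z v - (1 - r\<^sup>2) * newton1 1 y z v + 2 * newton 1 y z v"
  have pos: "dsq y z v > 0" if "norm y \<le> r" for y using dsq_pos[OF v, of y z] that z by simp
  have "(\<integral>y. ?g y / (exp v)\<^sup>2 \<partial>exit_law M X r) = harm4 (z' \<bullet> z') (x \<bullet> x) ((x - z') \<bullet> (x - z'))"
  proof (rule exit_law_integral[OF r(1,2) _ r(3) f(1) f(3) f(2)])
    show "?g y / (exp v)\<^sup>2 = harm4 (z' \<bullet> z') (y \<bullet> y) ((y - z') \<bullet> (y - z'))" if "norm y = r" for y
    proof -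
      have "y \<bullet> y = r\<^sup>2" using that by (simp add: power2_norm_eq_inner[symmetric])
      with harm4_newton[OF pos[OF eq_refl[OF that]]] show ?thesis
        unfolding z'_def by (simp add: field_simps)
    qed
    show "(\<lambda>y. ?g y / (exp v)\<^sup>2) \<in> borel_measurable borel" by measurable
  qed (use n in auto)
  then have "(\<integral>y. ?g y \<partial>exit_law M X r) = (exp v)\<^sup>2 * harm4 (z' \<bullet> z') (x \<bullet> x) ((x - z') \<bullet> (x - z'))"
    by (simp add: field_simps)
  also have "\<dots> = 0 * newton2 1 x z v - (1 - x \<bullet> x) * newton1 1 x z v + 2 * newton 1 x z v"
    unfolding z'_def by (rule harm4_newton) (use pos r in simp)
  finally show ?thesis .
qed

lemma exit_newton6:
  assumes n: "CARD('n) = 6" and r: "0 < r" "r < 1" "norm x < r" and z: "r < norm z" and v: "v \<ge> 0"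
  shows "(\<integral>y. (1 - r\<^sup>2)\<^sup>2 * newton2 2 y z v - ((1 - r\<^sup>2) * (7 - r\<^sup>2)) * newton1 2 y z v + 12 * newton 2 y z v \<partial>exit_law M X r)
    = (1 - x \<bullet> x)\<^sup>2 * newton2 2 x z v - ((1 - x \<bullet> x) * (7 - x \<bullet> x)) * newton1 2 x z v + 12 * newton 2 x z v"
proof -
  define z' where "z' = exp v *\<^sub>R z"
  have "1 * norm z \<le> exp v * norm z" using v by (intro mult_right_mono) auto
  then have z': "r < norm z'" using z by (simp add: z'_def)
  obtain f where f: "test_function f" "\<And>x. norm x \<le> r \<Longrightarrow> f x = harm6 (z' \<bullet> z') (x \<bullet> x) ((x - z') \<bullet> (x - z'))"
    "\<And>x. norm x \<le> r \<Longrightarrow> hyperbolic_Laplacian f x = 0"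
    using harm6_test_function[OF n r(1,2) z'] by blast
  let ?g = "\<lambda>y. (1 - r\<^sup>2)\<^sup>2 * newton2 2 y z v - ((1 - r\<^sup>2) * (7 - r\<^sup>2)) * newton1 2 y z v + 12 * newton 2 y z v"
  have pos: "dsq y z v > 0" if "norm y \<le> r" for y using dsq_pos[OF v, of y z] that z by simp
  define k where "k = (exp v)\<^sup>2 * (exp v)\<^sup>2"
  have k: "k \<noteq> 0" by (simp add: k_def)
  have "(\<integral>y. ?g y / k \<partial>exit_law M X r) = harm6 (z' \<bullet> z') (x \<bullet> x) ((x - z') \<bullet> (x - z'))"
  proof (rule exit_law_integral[OF r(1,2) _ r(3) f(1) f(3) f(2)])
    show "?g y / k = harm6 (z' \<bullet> z') (y \<bullet> y) ((y - z') \<bullet> (y - z'))" if "norm y = r" for y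
    proof -
      have yy: "y \<bullet> y = r\<^sup>2" using that by (simp add: power2_norm_eq_inner[symmetric])
      have "?g y = k * harm6 (z' \<bullet> z') (y \<bullet> y) ((y - z') \<bullet> (y - z'))"
        using harm6_newton[OF pos[OF eq_refl[OF that]]] unfolding k_def z'_def yy ..
      then show ?thesis using k by simp
    qed
    show "(\<lambda>y. ?g y / k) \<in> borel_measurable borel" by measurable
  qed (use n in auto)
  then have "(\<integral>y. ?g y \<partial>exit_law M X r) = k * harm6 (z' \<bullet> z') (x \<bullet> x) ((x - z') \<bullet> (x - z'))"
    using k by (simp add: field_simps)
  also have "\<dots> = (1 - x \<bullet> x)\<^sup>2 * newton2 2 x z v - ((1 - x \<bullet> x) * (7 - x \<bullet> x)) * newton1 2 x z v + 12 * newton 2 x z v"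
    unfolding z'_def k_def by (rule harm6_newton) (use pos r in simp)
  finally show ?thesis .
qed

end

text \<open>The integral of the Poisson quotient with pole \<open>z\<close> against the exit law of the motion started at \<open>x\<close>,
in dimension four.\<close>

definition poisson4 :: "real \<Rightarrow> 'a::real_inner \<Rightarrow> 'a \<Rightarrow> real" where
  "poisson4 r x z = (2 * newton 1 x z 0 - (1 - x \<bullet> x) * newton1 1 x z 0
     - (1 + r\<^sup>2) / (1 - r\<^sup>2) * ((1 - x \<bullet> x) * newton 1 x z 0
        + (LINT v:{0<..}|lborel. damped (2 / (1 - r\<^sup>2)) 0 (2 - 2 / (1 - r\<^sup>2) * (1 - x \<bullet> x)) 0 v * newton 1 x z v))) / (1 - r\<^sup>2)"

text \<open>The corresponding value in dimension six.\<close>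

definition poisson6 :: "real \<Rightarrow> 'a::real_inner \<Rightarrow> 'a \<Rightarrow> real" where
  "poisson6 r x z =
     (1 - x \<bullet> x)\<^sup>2 * (2 * (1 - b6 r) * newton 2 x z 0 - newton1 2 x z 0) / (2 * (1 - r\<^sup>2)\<^sup>2)
     + (1 - x \<bullet> x) * (7 - x \<bullet> x) * newton 2 x z 0 / (2 * (1 - r\<^sup>2)\<^sup>2)
     + (r\<^sup>2 - x \<bullet> x) / (1 - r\<^sup>2) ^ 4 * (LINT v:{0<..}|lborel. w6 (x \<bullet> x) r v * newton 2 x z v)"

lemma w6_damped: "w6 q r v = damped (b6 r) (d6 r) (3 * (1 - r\<^sup>2 * q + 3 * (r\<^sup>2 - q))) (3 / 2 * (1 + r\<^sup>2 * q + 5 * (r\<^sup>2 + q))) v"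
  by (simp add: w6_def damped_def algebra_simps)

text \<open>The Poisson quotient is \<open>g + E g / m\<close> for the Newton kernel \<open>g\<close>.\<close>

lemma poisson_quotient_newton:
  fixes y z :: "real ^ 'n"
  assumes "norm y < norm z" "m > 0"
  shows "((norm z)\<^sup>2 - (norm y)\<^sup>2) / norm (y - z) ^ (2 * m + 2) = newton m y z 0 - newton1 m y z 0 / real m"
proof -
  define D where "D = dsq y z 0"
  have "D > 0" unfolding D_def using assms by (intro dsq_pos) auto
  have "norm (y - z) ^ (2 * m + 2) = D ^ (m + 1)"
    unfolding D_def dsq_0 power_mult[symmetric] by simp
  moreover have "(norm z)\<^sup>2 - (norm y)\<^sup>2 = z \<bullet> z - y \<bullet> y" by (simp add: power2_norm_eq_inner)
  moreover have "newton m y z 0 - newton1 m y z 0 / real m = 1 / D ^ m + (z \<bullet> z - y \<bullet> y - D) / D ^ (m + 1)"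
    unfolding newton_def newton1_def D_def[symmetric] using assms(2) by (simp add: minus_divide_left[symmetric] diff_divide_distrib add_divide_distrib)
  moreover have "1 / D ^ m + (z \<bullet> z - y \<bullet> y - D) / D ^ (m + 1) = (z \<bullet> z - y \<bullet> y) / D ^ (m + 1)"
    using \<open>D > 0\<close> by (simp add: field_simps)
  ultimately show ?thesis by simp
qed

context hyperbolic_motion
begin

lemma exit_law_integrable_newton:
  assumes "0 < r" "r < 1" "CARD('n) \<ge> 2" "norm x < r" "r < norm z"
  shows "integrable (exit_law M X r) (\<lambda>y. newton m y z 0)" "integrable (exit_law M X r) (\<lambda>y. newton1 m y z 0)"
proof -
  obtain C where C: "\<And>y v. norm y = r \<Longrightarrow> 0 \<le> v \<Longrightarrow> \<bar>newton m y z v\<bar> \<le> C \<and> \<bar>newton1 m y z v\<bar> \<le> C \<and> \<bar>newton2 m y z v\<bar> \<le> C"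
    using newton_bounds[of r z m] assms by (meson less_imp_le)
  note L = exit_law_basic[OF assms(1-4)]
  interpret L: prob_space "exit_law M X r" by (rule L(1))
  note [measurable_cong] = L(2)
  show "integrable (exit_law M X r) (\<lambda>y. newton m y z 0)"
  proof (rule L.integrable_const_bound[where B = C])
    show "AE y in exit_law M X r. norm (newton m y z 0) \<le> C" using L(3) by eventually_elim (use C in auto)
  qed measurable
  show "integrable (exit_law M X r) (\<lambda>y. newton1 m y z 0)"
  proof (rule L.integrable_const_bound[where B = C])
    show "AE y in exit_law M X r. norm (newton1 m y z 0) \<le> C" using L(3) by eventually_elim (use C in auto)
  qed measurable
qed

lemma poisson_quotient_integral:
  assumes r: "0 < r" "r < 1" "CARD('n) \<ge> 2" "norm x < r" and z: "r < norm z" and m: "m > 0"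
  shows "(\<integral>y. ((norm z)\<^sup>2 - (norm y)\<^sup>2) / norm (y - z) ^ (2 * m + 2) \<partial>exit_law M X r)
     = (\<integral>y. newton m y z 0 \<partial>exit_law M X r) - (\<integral>y. newton1 m y z 0 \<partial>exit_law M X r) / real m"
proof -
  note L = exit_law_basic[OF r]
  note [measurable_cong] = L(2)
  note i = exit_law_integrable_newton[OF r z, of m]
  have "(\<integral>y. ((norm z)\<^sup>2 - (norm y)\<^sup>2) / norm (y - z) ^ (2 * m + 2) \<partial>exit_law M X r)
     = (\<integral>y. newton m y z 0 - newton1 m y z 0 / real m \<partial>exit_law M X r)"
  proof (rule integral_cong_AE)
    show "AE y in exit_law M X r. ((norm z)\<^sup>2 - (norm y)\<^sup>2) / norm (y - z) ^ (2 * m + 2) = newton m y z 0 - newton1 m y z 0 / real m"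
      using L(3) by eventually_elim (use poisson_quotient_newton[OF _ m] z in auto)
  qed measurable
  also have "\<dots> = (\<integral>y. newton m y z 0 \<partial>exit_law M X r) - (\<integral>y. newton1 m y z 0 \<partial>exit_law M X r) / real m"
    using i by simp
  finally show ?thesis .
qed

text \<open>The mean of the Newton kernel is obtained with the kernel \<open>exp (- a * v)\<close>, where \<open>a = 2 / (1 - r\<^sup>2)\<close> solves
the first-order adjoint equation.  The mean of its derivative follows from the equation at \<open>v = 0\<close>.\<close>

lemma exit_poisson4:
  assumes n: "CARD('n) = 4" and r: "0 < r" "r < 1" "norm x < r" and z: "r < norm z"
  shows "(\<integral>y. ((norm z)\<^sup>2 - (norm y)\<^sup>2) / norm (y - z) ^ 4 \<partial>exit_law M X r) = poisson4 r x z"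
proof -
  have n2: "CARD('n) \<ge> 2" using n by simp
  define u where "u = 1 - r\<^sup>2"
  have u: "u > 0" using r by (simp add: u_def power_less_one_iff)
  define a where "a = 2 / u"
  have au: "a * u = 2" "a > 0" using u by (simp_all add: a_def)
  note L = exit_law_basic[OF r(1,2) n2 r(3)]
  note i = exit_law_integrable_newton[OF r(1,2) n2 r(3) z, of 1]
  have "(\<integral>y. 0 * ((0 - a * 1) * newton 1 y z 0 - 1 * newton1 1 y z 0) + u * (1 * newton 1 y z 0) \<partial>exit_law M X r)
     = 0 * ((0 - a * 1) * newton 1 x z 0 - 1 * newton1 1 x z 0) + (1 - x \<bullet> x) * (1 * newton 1 x z 0)
       + (LINT v:{0<..}|lborel. damped a 0 (0 * ((0 * 1 - a * 0) - a * (0 - a * 1)) + (1 - x \<bullet> x) * (0 - a * 1) + 2 * 1)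
            (0 * (0 * (0 - a * 1) - a * (0 * 1 - a * 0)) + (1 - x \<bullet> x) * (0 * 1 - a * 0) + 2 * 0) v * newton 1 x z v)"
    by (rule exit_newton_transfer[OF L less_imp_le[OF r(1)] z r(3), where ?A0.0 = 2])
      (use exit_newton4[OF n r z] au in \<open>simp_all add: u_def[symmetric] algebra_simps\<close>)
  then have 1: "u * (\<integral>y. newton 1 y z 0 \<partial>exit_law M X r) = (1 - x \<bullet> x) * newton 1 x z 0
       + (LINT v:{0<..}|lborel. damped a 0 (2 - a * (1 - x \<bullet> x)) 0 v * newton 1 x z v)"
    by (simp add: algebra_simps)
  have "(\<integral>y. 2 * newton 1 y z 0 - u * newton1 1 y z 0 \<partial>exit_law M X r) = 2 * newton 1 x z 0 - (1 - x \<bullet> x) * newton1 1 x z 0"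
    using exit_newton4[OF n r z, of 0] by (simp add: u_def algebra_simps)
  then have 2: "2 * (\<integral>y. newton 1 y z 0 \<partial>exit_law M X r) - u * (\<integral>y. newton1 1 y z 0 \<partial>exit_law M X r)
      = 2 * newton 1 x z 0 - (1 - x \<bullet> x) * newton1 1 x z 0"
    using i by simp
  have r2: "1 + r\<^sup>2 = 2 - u" by (simp add: u_def)
  have solve: "I - I1 = (Y - (2 - u) / u * X) / u" if "u * I = X" "2 * I - u * I1 = Y" for I I1 X Y :: real
    unfolding that[symmetric] using u by (simp add: field_simps)
  have "(\<integral>y. ((norm z)\<^sup>2 - (norm y)\<^sup>2) / norm (y - z) ^ 4 \<partial>exit_law M X r)
     = (\<integral>y. newton 1 y z 0 \<partial>exit_law M X r) - (\<integral>y. newton1 1 y z 0 \<partial>exit_law M X r)"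
    using poisson_quotient_integral[OF r(1,2) n2 r(3) z, of 1] by simp
  also have "\<dots> = poisson4 r x z"
    unfolding poisson4_def u_def[symmetric] r2 a_def[symmetric] by (rule solve[OF 1 2])
  finally show ?thesis .
qed

text \<open>The adjoint equation is of second order and has a plane of decaying solutions.  The initial values
\<open>c\<close> and \<open>s\<close> are those for which the boundary terms on the sphere combine to the Poisson quotient.  The kernel
left at the starting point is a multiple of \<open>w6\<close>.\<close>

lemma exit_poisson6:
  assumes n: "CARD('n) = 6" and r: "0 < r" "r < 1" "norm x < r" and z: "r < norm z"
  shows "(\<integral>y. ((norm z)\<^sup>2 - (norm y)\<^sup>2) / norm (y - z) ^ 6 \<partial>exit_law M X r) = poisson6 r x z"
proof -
  have n2: "CARD('n) \<ge> 2" using n by simp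
  define u where "u = 1 - r\<^sup>2"
  have u: "u > 0" using r by (simp add: u_def power_less_one_iff)
  define b d where "b = b6 r" and "d = d6 r"
  define q where "q = x \<bullet> x"
  \<comment> \<open>chosen so that the boundary terms on the sphere become \<open>newton - newton1 / 2\<close>\<close>
  define c where "c = 1 / (2 * u\<^sup>2)"
  define s where "s = (2 - b) * c"
  define c1 s1 where "c1 = s - b * c" and "s1 = d * c - b * s"
  have "r\<^sup>2 < 1" using r by (simp add: power_less_one_iff)
  note bd = b6_d6[OF this, folded u_def b_def d_def]
  have b: "2 * (u * b) = 6 + u" unfolding bd(1) using u by (simp add: field_simps)
  have d: "u\<^sup>2 * (b\<^sup>2 - d) = 12" unfolding bd(2) using u by simp
  have cu: "2 * (u\<^sup>2 * c) = 1" using u by (simp add: c_def)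
  have r7: "7 - r\<^sup>2 = 6 + u" by (simp add: u_def)
  have sq: "sqrt (max d 0) < b" using sqrt_d6_less_b6[OF r(1,2)] by (simp add: b_def d_def)
  note L = exit_law_basic[OF r(1,2) n2 r(3)]
  note i = exit_law_integrable_newton[OF r(1,2) n2 r(3) z, of 2]
  have ode: "u\<^sup>2 * (s1 - b * c1) + (u * (6 + u)) * c1 + 12 * c = 0" "u\<^sup>2 * (d * c1 - b * s1) + (u * (6 + u)) * s1 + 12 * s = 0"
    unfolding c1_def s1_def b[symmetric] d[symmetric] by (simp_all add: algebra_simps power2_eq_square)
  have T: "(\<integral>y. u\<^sup>2 * (c1 * newton 2 y z 0 - c * newton1 2 y z 0) + (u * (6 + u)) * (c * newton 2 y z 0) \<partial>exit_law M X r)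
     = (1 - q)\<^sup>2 * (c1 * newton 2 x z 0 - c * newton1 2 x z 0) + ((1 - q) * (7 - q)) * (c * newton 2 x z 0)
       + (LINT v:{0<..}|lborel. damped b d ((1 - q)\<^sup>2 * (s1 - b * c1) + ((1 - q) * (7 - q)) * c1 + 12 * c)
            ((1 - q)\<^sup>2 * (d * c1 - b * s1) + ((1 - q) * (7 - q)) * s1 + 12 * s) v * newton 2 x z v)"
    unfolding c1_def s1_def
    by (rule exit_newton_transfer[OF L less_imp_le[OF r(1)] z r(3) sq, where ?A0.0 = 12])
      (use ode[unfolded c1_def s1_def] exit_newton6[OF n r z] in \<open>simp_all add: u_def[symmetric] r7 q_def\<close>)
  have "u\<^sup>2 * (c1 * N - c * N1) + (u * (6 + u)) * (c * N) = N - N1 / 2" for N N1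
  proof -
    have "u\<^sup>2 * (c1 * N - c * N1) + (u * (6 + u)) * (c * N) = (2 * (u\<^sup>2 * c)) * N - (2 * (u\<^sup>2 * c)) * (N1 / 2)"
      unfolding c1_def s_def b[symmetric] by (simp add: algebra_simps power2_eq_square)
    then show ?thesis unfolding cu by simp
  qed
  then have "(\<integral>y. u\<^sup>2 * (c1 * newton 2 y z 0 - c * newton1 2 y z 0) + (u * (6 + u)) * (c * newton 2 y z 0) \<partial>exit_law M X r)
     = (\<integral>y. newton 2 y z 0 \<partial>exit_law M X r) - (\<integral>y. newton1 2 y z 0 \<partial>exit_law M X r) / 2"
    using i by simp
  also have "\<dots> = (\<integral>y. ((norm z)\<^sup>2 - (norm y)\<^sup>2) / norm (y - z) ^ 6 \<partial>exit_law M X r)"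
    using poisson_quotient_integral[OF r(1,2) n2 r(3) z, of 2] by simp
  finally have lhs: "(\<integral>y. u\<^sup>2 * (c1 * newton 2 y z 0 - c * newton1 2 y z 0) + (u * (6 + u)) * (c * newton 2 y z 0) \<partial>exit_law M X r)
     = (\<integral>y. ((norm z)\<^sup>2 - (norm y)\<^sup>2) / norm (y - z) ^ 6 \<partial>exit_law M X r)" .
  have cc: "c1 = (2 - 2 * b) * c" by (simp add: c1_def s_def algebra_simps)
  have k: "(1 - q)\<^sup>2 * (s1 - b * c1) + ((1 - q) * (7 - q)) * c1 + 12 * c
       = (r\<^sup>2 - q) / u ^ 4 * (3 * (1 - r\<^sup>2 * q + 3 * (r\<^sup>2 - q)))"
    "(1 - q)\<^sup>2 * (d * c1 - b * s1) + ((1 - q) * (7 - q)) * s1 + 12 * s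
       = (r\<^sup>2 - q) / u ^ 4 * (3 / 2 * (1 + r\<^sup>2 * q + 5 * (r\<^sup>2 + q)))"
  proof -
    have r2: "r\<^sup>2 = 1 - u" by (simp add: u_def)
    define t where "t = 1 / u"
    have t: "u * t = 1" using u by (simp add: t_def)
    have bt: "b = 3 * t + 1 / 2" using b u by (simp add: t_def field_simps)
    have dt: "d = b\<^sup>2 - 12 * t\<^sup>2" using d u by (simp add: t_def field_simps)
    have ct: "c = t\<^sup>2 / 2" using u by (simp add: c_def t_def power_divide)
    have qt: "(r\<^sup>2 - q) * t = (1 - q) * t - 1"
      "3 * (1 - r\<^sup>2 * q + 3 * (r\<^sup>2 - q)) * t = 3 * (4 * (1 - q) * t + (q - 3))"
      "3 / 2 * (1 + r\<^sup>2 * q + 5 * (r\<^sup>2 + q)) * t = 3 / 2 * (6 * (1 + q) * t - (q + 5))"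
      unfolding r2 using t by algebra+
    have p: "(r\<^sup>2 - q) / u ^ 4 * a = ((r\<^sup>2 - q) * t) * (a * t) * t\<^sup>2" for a
      by (simp add: t_def power_divide power2_eq_square power4_eq_xxxx)
    show "(1 - q)\<^sup>2 * (s1 - b * c1) + ((1 - q) * (7 - q)) * c1 + 12 * c
       = (r\<^sup>2 - q) / u ^ 4 * (3 * (1 - r\<^sup>2 * q + 3 * (r\<^sup>2 - q)))"
      unfolding p qt unfolding c1_def s1_def s_def dt bt ct by (simp add: field_simps) algebra
    show "(1 - q)\<^sup>2 * (d * c1 - b * s1) + ((1 - q) * (7 - q)) * s1 + 12 * s
       = (r\<^sup>2 - q) / u ^ 4 * (3 / 2 * (1 + r\<^sup>2 * q + 5 * (r\<^sup>2 + q)))"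
      unfolding p qt unfolding c1_def s1_def s_def dt bt ct by (simp add: field_simps) algebra
  qed
  have kw: "damped b d ((r\<^sup>2 - q) / u ^ 4 * (3 * (1 - r\<^sup>2 * q + 3 * (r\<^sup>2 - q)))) ((r\<^sup>2 - q) / u ^ 4 * (3 / 2 * (1 + r\<^sup>2 * q + 5 * (r\<^sup>2 + q)))) v
      = (r\<^sup>2 - q) / u ^ 4 * w6 q r v" for v
    unfolding w6_damped b_def d_def damped_scale ..
  have "(\<integral>y. ((norm z)\<^sup>2 - (norm y)\<^sup>2) / norm (y - z) ^ 6 \<partial>exit_law M X r)
     = (1 - q)\<^sup>2 * (c1 * newton 2 x z 0 - c * newton1 2 x z 0) + ((1 - q) * (7 - q)) * (c * newton 2 x z 0)
       + (r\<^sup>2 - q) / u ^ 4 * (LINT v:{0<..}|lborel. w6 q r v * newton 2 x z v)"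
    using T unfolding lhs k kw by (simp add: mult.assoc)
  also have "\<dots> = poisson6 r x z"
    unfolding poisson6_def u_def[symmetric] q_def[symmetric] b_def[symmetric] cc
    by (simp add: c_def algebra_simps add_divide_distrib diff_divide_distrib)
  finally show ?thesis .
qed

end

section \<open>Boundary values and the motion started at the centre\<close>

lemma continuous_on_newton_0:
  fixes x :: "real ^ 'n"
  assumes "norm x < r"
  shows "continuous_on {z. r \<le> norm z} (\<lambda>z. newton m x z 0)" "continuous_on {z. r \<le> norm z} (\<lambda>z. newton1 m x z 0)"
proof -
  have "dsq x z 0 \<noteq> 0" if "z \<in> {z. r \<le> norm z}" for z using dsq_pos[of 0 x z] that assms by auto
  moreover have "continuous_on {z. r \<le> norm z} (\<lambda>z. dsq x z 0)" unfolding dsq_def by (intro continuous_intros)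
  ultimately show "continuous_on {z. r \<le> norm z} (\<lambda>z. newton m x z 0)" "continuous_on {z. r \<le> norm z} (\<lambda>z. newton1 m x z 0)"
    unfolding newton_def newton1_def by (intro continuous_intros; simp)+
qed

lemma continuous_on_poisson4:
  fixes x :: "real ^ 'n"
  assumes "norm x < r" "0 < r" "r < 1"
  shows "continuous_on {z. r \<le> norm z} (poisson4 r x)"
proof -
  have "r\<^sup>2 < 1" using assms by (simp add: power_less_one_iff)
  then have b: "sqrt (max 0 0) < 2 / (1 - r\<^sup>2)" by simp
  show ?thesis unfolding poisson4_def[abs_def] using \<open>r\<^sup>2 < 1\<close>
    by (intro continuous_intros continuous_on_newton_0 continuous_kernel_newton b assms) auto
qed

lemma continuous_on_poisson6:
  fixes x :: "real ^ 'n"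
  assumes "norm x < r" "0 < r" "r < 1"
  shows "continuous_on {z. r \<le> norm z} (poisson6 r x)"
proof -
  have "r\<^sup>2 < 1" using assms by (simp add: power_less_one_iff)
  then show ?thesis unfolding poisson6_def[abs_def] w6_damped
    by (intro continuous_intros continuous_on_newton_0 continuous_kernel_newton sqrt_d6_less_b6 assms) auto
qed

lemma newton_centre:
  "newton m 0 z v = 1 / (z \<bullet> z) ^ m" "z \<noteq> 0 \<Longrightarrow> newton1 m 0 z v = 0"
  by (simp_all add: newton_def newton1_def dsq_alt)

text \<open>For \<open>x = 0\<close> the scaled distances do not depend on \<open>v\<close>, and only the integral of the kernel is needed.\<close>

lemma poisson4_centre:
  fixes z :: "real ^ 'n"
  assumes "0 < r" "r < 1" "z \<noteq> 0"
  shows "poisson4 r 0 z = 1 / (norm z)\<^sup>2"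
proof -
  define u where "u = 1 - r\<^sup>2"
  have u: "u > 0" and r2: "r\<^sup>2 = 1 - u" using assms by (simp_all add: u_def power_less_one_iff)
  have "sqrt (max 0 0) < 2 / u" using u by simp
  then have "(LINT v:{0<..}|lborel. damped (2 / u) 0 (2 - 2 / u * (1 - 0)) 0 v * newton 1 0 z v)
     = ((2 - 2 / u * (1 - 0)) * (2 / u) + 0) / ((2 / u)\<^sup>2 - 0) * (1 / (z \<bullet> z))"
    unfolding newton_centre by (simp add: damped_integral(2))
  also have "((2 - 2 / u * (1 - 0)) * (2 / u) + 0) / ((2 / u)\<^sup>2 - 0) = u - 1"
    using u by (simp add: power2_eq_square field_simps)
  finally have "poisson4 r 0 z = (2 * (1 / (z \<bullet> z)) - (2 - u) / u * (1 / (z \<bullet> z) + (u - 1) * (1 / (z \<bullet> z)))) / u"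
    unfolding poisson4_def r2 using assms(3) by (simp add: newton_centre)
  also have "\<dots> = 1 / (z \<bullet> z)" using u assms(3) by (simp add: field_simps)
  finally show ?thesis by (simp add: power2_norm_eq_inner)
qed

lemma poisson6_centre:
  fixes z :: "real ^ 'n"
  assumes "0 < r" "r < 1" "z \<noteq> 0"
  shows "poisson6 r 0 z = 1 / norm z ^ 4"
proof -
  define u where "u = 1 - r\<^sup>2"
  have u: "u > 0" and r2: "r\<^sup>2 = 1 - u" and r1: "r\<^sup>2 < 1" using assms by (simp_all add: u_def power_less_one_iff)
  define N where "N = 1 / (z \<bullet> z)\<^sup>2"
  note b = b6_d6[OF r1, folded u_def]
  have "(LINT v:{0<..}|lborel. w6 0 r v * newton 2 0 z v)
     = ((3 * (1 + 3 * r\<^sup>2)) * b6 r + (3 / 2 * (1 + 5 * r\<^sup>2))) / ((b6 r)\<^sup>2 - d6 r) * N"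
    unfolding newton_centre w6_damped N_def by (simp add: damped_integral(2)[OF sqrt_d6_less_b6[OF assms(1,2)]])
  also have "\<dots> = (u\<^sup>2 / 12 * ((3 * (1 + 3 * (1 - u))) * (3 / u + 1 / 2) + (3 / 2 * (1 + 5 * (1 - u))))) * N"
    unfolding b(2) unfolding b(1) r2 by simp
  finally have I: "(LINT v:{0<..}|lborel. w6 0 r v * newton 2 0 z v) = \<dots>" .
  have "poisson6 r 0 z = (2 * (1 - (3 / u + 1 / 2)) * N) / (2 * u\<^sup>2) + 7 * N / (2 * u\<^sup>2)
     + (1 - u) / u ^ 4 * ((u\<^sup>2 / 12 * ((3 * (1 + 3 * (1 - u))) * (3 / u + 1 / 2) + (3 / 2 * (1 + 5 * (1 - u))))) * N)"
    unfolding poisson6_def inner_zero_left I u_def[symmetric] b(1) using assms(3)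
    by (simp add: newton_centre N_def r2)
  also have "\<dots> = N * ((2 * (1 - (3 / u + 1 / 2))) / (2 * u\<^sup>2) + 7 / (2 * u\<^sup>2)
     + (1 - u) / u ^ 4 * (u\<^sup>2 / 12 * ((3 * (1 + 3 * (1 - u))) * (3 / u + 1 / 2) + (3 / 2 * (1 + 5 * (1 - u))))))"
    by (simp add: algebra_simps add_divide_distrib diff_divide_distrib)
  also have "(2 * (1 - (3 / u + 1 / 2))) / (2 * u\<^sup>2) + 7 / (2 * u\<^sup>2)
     + (1 - u) / u ^ 4 * (u\<^sup>2 / 12 * ((3 * (1 + 3 * (1 - u))) * (3 / u + 1 / 2) + (3 / 2 * (1 + 5 * (1 - u))))) = 1"
    using u by (simp add: divide_simps) algebra
  also have "N * 1 = 1 / norm z ^ 4"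
    unfolding N_def power2_norm_eq_inner[symmetric] by simp
  finally show ?thesis .
qed

section \<open>The Poisson kernel\<close>

text \<open>Two densities agree almost everywhere; if they are continuous on the sphere they agree on all of it,
because every ball around a point of the sphere has positive surface measure.\<close>

lemma poisson_kernel_eqI:
  fixes P :: "real ^ 'n \<Rightarrow> 'w measure"
  assumes r: "r > 0" and p: "continuous_on (sphere 0 r) p" "\<And>y. norm y = r \<Longrightarrow> 0 \<le> p y" "\<And>y. norm y \<noteq> r \<Longrightarrow> p y = 0"
    and d: "distr (P x) borel (exit_position r X) = density (sphere_measure r) (\<lambda>y. ennreal (p y))"
  shows "poisson_kernel P X r x = p"
  unfolding poisson_kernel_def
proof (rule the_equality)
  show "continuous_on (sphere 0 r) p \<and> (\<forall>y\<in>sphere 0 r. 0 \<le> p y) \<and> (\<forall>y. y \<notin> sphere 0 r \<longrightarrow> p y = 0) \<and>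
    distr (P x) borel (exit_position r X) = density (sphere_measure r) (\<lambda>y. ennreal (p y))"
    using assms by auto
next
  fix p' :: "real ^ 'n \<Rightarrow> real"
  assume "continuous_on (sphere 0 r) p' \<and> (\<forall>y\<in>sphere 0 r. 0 \<le> p' y) \<and> (\<forall>y. y \<notin> sphere 0 r \<longrightarrow> p' y = 0) \<and>
    distr (P x) borel (exit_position r X) = density (sphere_measure r) (\<lambda>y. ennreal (p' y))"
  then have p': "continuous_on (sphere 0 r) p'" "\<And>y. norm y = r \<Longrightarrow> 0 \<le> p' y" "\<And>y. norm y \<noteq> r \<Longrightarrow> p' y = 0"
    and d': "density (sphere_measure r) (\<lambda>y. ennreal (p' y)) = density (sphere_measure r) (\<lambda>y. ennreal (p y))"
    using d by auto
  interpret S: finite_measure "sphere_measure r :: (real ^ 'n) measure" by (rule finite_sphere_measure[OF r])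
  have meas: "f \<in> borel_measurable borel" if "continuous_on (sphere 0 r) f" "\<And>y. norm y \<noteq> r \<Longrightarrow> f y = 0" for f :: "real ^ 'n \<Rightarrow> real"
  proof -
    have "(\<lambda>y. indicator (sphere 0 r) y *\<^sub>R f y) \<in> borel_measurable borel"
      by (rule borel_measurable_continuous_on_indicator[OF _ that(1)]) simp
    moreover have "(\<lambda>y. indicator (sphere 0 r) y *\<^sub>R f y) = f"
      using that(2) by (auto simp: fun_eq_iff indicator_def)
    ultimately show ?thesis by simp
  qed
  have [measurable]: "p \<in> borel_measurable borel" "p' \<in> borel_measurable borel" using meas p p' by blast+
  have "AE y in sphere_measure r. ennreal (p' y) = ennreal (p y)"
    using d' by (subst (asm) S.density_unique_iff) simp_all
  then have ae: "AE y in sphere_measure r. norm y = r \<and> p' y = p y"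
    using AE_sphere_measure[OF r] by eventually_elim (use p(2) p'(2) in auto)
  show "p' = p"
  proof (rule ext, rule ccontr)
    fix y assume ne: "p' y \<noteq> p y"
    then have y: "norm y = r" using p(3) p'(3) by metis
    have "continuous_on (sphere 0 r) (\<lambda>y. p' y - p y)" using p(1) p'(1) by (intro continuous_intros)
    from this[unfolded continuous_on_iff, rule_format, of y "\<bar>p' y - p y\<bar>"] y ne
    obtain e where e: "e > 0" "\<And>y'. norm y' = r \<Longrightarrow> dist y' y < e \<Longrightarrow> dist (p' y' - p y') (p' y - p y) < \<bar>p' y - p y\<bar>"
      by auto
    have "AE y' in sphere_measure r. y' \<notin> ball y e"
      using ae by eventually_elim (use e(2) in \<open>force simp: dist_commute dist_real_def\<close>)
    then have "emeasure (sphere_measure r) (ball y e) = 0"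
      by (subst (asm) AE_iff_measurable[where N = "ball y e"]) auto
    with sphere_measure_ball_pos[OF r y e(1)] show False by simp
  qed
qed

lemma poisson_kernel_from_integrals:
  fixes P :: "real ^ 'n \<Rightarrow> 'w measure" and x y :: "real ^ 'n"
  assumes X: "hyperbolic_Brownian_motion P X" and n: "CARD('n) \<ge> 2"
    and r: "0 < r" "r < 1" "norm x < r" and y: "norm y = r"
    and int: "\<And>x z. norm x < r \<Longrightarrow> r < norm z \<Longrightarrow>
       (\<integral>y. ((norm z)\<^sup>2 - (norm y)\<^sup>2) / norm (y - z) ^ CARD('n) \<partial>exit_law (P x) X r) = \<Psi> x z"
    and cen: "\<And>z. r < norm z \<Longrightarrow> \<Psi> 0 z = 1 / norm z ^ (CARD('n) - 2)"
    and cont: "continuous_on {z. r \<le> norm z} (\<Psi> x)"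
  shows "poisson_kernel P X r x y = \<Psi> x y / (real CARD('n) * unit_ball_vol (real CARD('n)) * r)"
proof -
  define C where "C = real CARD('n) * unit_ball_vol (real CARD('n)) * r"
  have C: "C > 0" unfolding C_def using r(1) by simp
  interpret x: hyperbolic_motion "P x" X x by (rule hyperbolic_motionI[OF X]) (use r in simp)
  interpret o: hyperbolic_motion "P 0" X 0 by (rule hyperbolic_motionI[OF X]) simp
  have o: "norm (0 :: real ^ 'n) < r" using r by simp
  have int0: "(\<integral>y. ((norm z)\<^sup>2 - (norm y)\<^sup>2) / norm (y - z) ^ CARD('n) \<partial>exit_law (P 0) X r) = 1 / norm z ^ (CARD('n) - 2)"
    if "r < norm z" for z
    using int[OF o that] cen[OF that] by simp
  note D = sphere_density_from_poisson_integrals[OF r(1) n x.exit_law_basic[OF r(1,2) n r(3)] o.exit_law_basic[OF r(1,2) n o]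
      int[OF r(3)] int0 cont, simplified]
  define p where "p y = (if norm y = r then \<Psi> x y / C else 0)" for y
  have "poisson_kernel P X r x = p"
  proof (rule poisson_kernel_eqI[OF r(1)])
    have "continuous_on (sphere 0 r) (\<lambda>y. \<Psi> x y / C)"
      using C by (intro continuous_intros continuous_on_subset[OF cont]) auto
    then show "continuous_on (sphere 0 r) p" by (rule continuous_on_eq) (auto simp: p_def)
    show "0 \<le> p y" if "norm y = r" for y using D(1)[OF that] C by (simp add: p_def that)
    show "p y = 0" if "norm y \<noteq> r" for y using that by (simp add: p_def)
    show "distr (P x) borel (exit_position r X) = density (sphere_measure r) (\<lambda>y. ennreal (p y))"
      using D(2) unfolding exit_law_def p_def C_def by simp
  qed
  then show ?thesis using y by (simp add: p_def C_def)
qed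

section \<open>The boundary values as integrals against the inverse Laplace transform\<close>

lemma damped_newton_integrable:
  assumes "norm x < norm z" "sqrt (max d 0) < b"
  shows "set_integrable lborel {0<..} (\<lambda>v. damped b d c s v * newton m x z v)"
proof -
  obtain C where C: "\<And>v. v \<ge> 0 \<Longrightarrow> \<bar>newton m x z v\<bar> \<le> C"
    using newton_bounds[OF assms(1) norm_ge_zero, of m] by blast
  obtain \<delta> B where B: "\<delta> > 0" "\<And>v. v \<ge> 0 \<Longrightarrow> \<bar>damped b d c s v\<bar> \<le> B * exp (- \<delta> * v)"
    using damped_bound[OF assms(2), of c s c s c s] by blast
  show ?thesis
  proof (rule set_integrable_exp_bound[OF _ B(1), where B = "B * C"])
    have "dsq x z v \<noteq> 0" if "v \<in> {0<..}" for v using dsq_pos[of v x z] assms(1) that by auto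
    then show "continuous_on {0<..} (\<lambda>v. damped b d c s v * newton m x z v)"
      unfolding newton_def by (intro continuous_intros continuous_on_dsq) auto
    show "norm (damped b d c s v * newton m x z v) \<le> B * C * exp (- \<delta> * v)" if "v > 0" for v
    proof -
      have "\<bar>damped b d c s v\<bar> * \<bar>newton m x z v\<bar> \<le> (B * exp (- \<delta> * v)) * C"
        using B(2)[of v] C[of v] that by (intro mult_mono) (auto intro: order_trans[OF abs_ge_zero])
      then show ?thesis by (simp add: abs_mult ac_simps)
    qed
  qed
qed

lemma set_integral_combination:
  fixes f g h k :: "real \<Rightarrow> real"
  assumes "set_integrable M A f" "set_integrable M A g" "set_integrable M A h" "set_integrable M A k"
  shows "(LINT v:A|M. a * f v - b * g v + c * h v + d * k v)
    = a * (LINT v:A|M. f v) - b * (LINT v:A|M. g v) + c * (LINT v:A|M. h v) + d * (LINT v:A|M. k v)"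
  using assms[THEN set_integrable_mult_right] by (simp add: set_integral_add set_integral_diff)

text \<open>With \<open>e = exp (- v)\<close> the squared distance is \<open>|y|\<^sup>2 - 2 (x \<bullet> y) e + |x|\<^sup>2 e\<^sup>2\<close>, and \<open>x \<bullet> y\<close> is expressed by its value at
\<open>v = 0\<close>.\<close>

lemma scaled_distance_increment:
  fixes x y :: "'a::real_inner"
  shows "(norm x)\<^sup>2 * (exp (- v) - 1) + (norm y)\<^sup>2 * (exp v - 1) = exp v * dsq x y v - dsq x y 0"
    and "(exp v)\<^sup>2 * dsq x y v = (norm y)\<^sup>2 * (exp v)\<^sup>2 - ((norm y)\<^sup>2 + (norm x)\<^sup>2 - dsq x y 0) * exp v + (norm x)\<^sup>2"
proof -
  define e where "e = exp (- v)"
  have E: "exp v * e = 1" unfolding e_def mult_exp_exp by simp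
  show "(norm x)\<^sup>2 * (exp (- v) - 1) + (norm y)\<^sup>2 * (exp v - 1) = exp v * dsq x y v - dsq x y 0"
    "(exp v)\<^sup>2 * dsq x y v = (norm y)\<^sup>2 * (exp v)\<^sup>2 - ((norm y)\<^sup>2 + (norm x)\<^sup>2 - dsq x y 0) * exp v + (norm x)\<^sup>2"
    unfolding dsq_alt[of x y v] dsq_alt[of x y 0] e_def[symmetric] power2_norm_eq_inner
    using E by (simp_all, algebra+)
qed

text \<open>Write \<open>D\<close> for the squared distance from \<open>x\<close> to \<open>y\<close> and \<open>D\<^sub>v\<close> for \<open>dsq x y v\<close>.  The bracket in the integrand is
\<open>exp v * D\<^sub>v - D\<close>, hence the integrand is \<open>D\<^sup>2 w / D\<^sub>v\<close> plus a combination of \<open>w\<close>, \<open>exp v * w\<close> and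
\<open>exp (2 * v) * w\<close>.  The integrals of the latter are values of the Laplace transform of \<open>w\<close>.\<close>

lemma poisson4_on_sphere:
  fixes x y :: "real ^ 'n"
  assumes r: "0 < r" "r < 1" "norm x < r" and y: "norm y = r"
  shows "poisson4 r x y = (r\<^sup>2 - (norm x)\<^sup>2) / ((1 - r\<^sup>2)\<^sup>2 * norm (x - y) ^ 4) *
    (LINT v:{0<..}|lborel. ((norm x)\<^sup>2 * (exp (- v) - 1) + r\<^sup>2 * (exp v - 1))\<^sup>2
       * (2 * (1 + r\<^sup>2) / (1 - r\<^sup>2) * exp (- (2 * v / (1 - r\<^sup>2)))) / (norm (exp (- v) *\<^sub>R x - y))\<^sup>2)"
    (is "_ = _ * ?I")
proof -
  define s q a \<alpha> where "s = r\<^sup>2" and "q = (norm x)\<^sup>2" and "a = 2 / (1 - s)" and "\<alpha> = 2 * (1 + s) / (1 - s)"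
  have s: "0 < s" "s < 1" using r by (simp_all add: s_def power_less_one_iff)
  have xy: "norm x < norm y" using r y by simp
  define D where "D = dsq x y 0"
  have D: "D > 0" unfolding D_def by (rule dsq_pos) (use xy in auto)
  define w where "w = damped a 0 \<alpha> 0"
  define J where "J = (LINT v:{0<..}|lborel. w v * newton 1 x y v)"
  have a: "sqrt (max 0 0) < a - 2" "sqrt (max 0 0) < a - 1" "sqrt (max 0 0) < a" using s by (simp_all add: a_def field_simps)
  have iw: "set_integrable lborel {0<..} w" "set_integrable lborel {0<..} (\<lambda>v. exp (1 * v) * w v)"
    "set_integrable lborel {0<..} (\<lambda>v. exp (2 * v) * w v)"
    unfolding w_def damped_exp by (rule damped_integral(1)[OF a(3)] damped_integral(1)[OF a(2)] damped_integral(1)[OF a(1)])+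
  have I0: "(LINT v:{0<..}|lborel. w v) = 1 + s"
  proof -
    have "\<alpha> = a * (1 + s)" by (simp add: a_def \<alpha>_def)
    then show ?thesis unfolding w_def damped_integral(2)[OF a(3)] using a(3) by (simp add: power2_eq_square)
  qed
  have I1: "(LINT v:{0<..}|lborel. exp (1 * v) * w v) = 2"
  proof -
    have "a - 1 = (1 + s) / (1 - s)" using s by (simp add: a_def field_simps)
    then show ?thesis
      unfolding w_def damped_exp damped_integral(2)[OF a(2)] using s by (simp add: \<alpha>_def power2_eq_square) (simp add: field_simps)
  qed
  have I2: "(LINT v:{0<..}|lborel. exp (2 * v) * w v) = (1 + s) / s"
  proof -
    have "a - 2 = 2 * s / (1 - s)" using s by (simp add: a_def field_simps)
    then show ?thesis
      unfolding w_def damped_exp damped_integral(2)[OF a(1)] using s by (simp add: \<alpha>_def power2_eq_square) (simp add: field_simps)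
  qed
  \<comment> \<open>\<open>(exp v)\<^sup>2 * dsq x y v\<close> is a quadratic polynomial in \<open>exp v\<close>, so no distance remains in the other terms\<close>
  have "?I = (LINT v:{0<..}|lborel. D\<^sup>2 * (w v * newton 1 x y v) - (D + s + q) * (exp (1 * v) * w v) + s * (exp (2 * v) * w v) + q * w v)"
  proof (rule set_lebesgue_integral_cong, simp, intro allI impI)
    fix v :: real assume "v \<in> {0<..}"
    then have v: "0 < v" by simp
    have T: "dsq x y v > 0" using dsq_pos[OF _ xy, of v] v by simp
    have "w v = 2 * (1 + r\<^sup>2) / (1 - r\<^sup>2) * exp (- (2 * v / (1 - r\<^sup>2)))"
      by (simp add: w_def damped_def \<alpha>_def a_def s_def)
    then have "((norm x)\<^sup>2 * (exp (- v) - 1) + r\<^sup>2 * (exp v - 1))\<^sup>2 * (2 * (1 + r\<^sup>2) / (1 - r\<^sup>2) * exp (- (2 * v / (1 - r\<^sup>2))))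
        / (norm (exp (- v) *\<^sub>R x - y))\<^sup>2 = (exp v * dsq x y v - D)\<^sup>2 * w v / dsq x y v"
      using scaled_distance_increment(1)[of x v y] unfolding D_def y by (simp add: dsq_def)
    also have "\<dots> = w v * ((exp v)\<^sup>2 * dsq x y v - 2 * exp v * D + D\<^sup>2 * newton 1 x y v)"
      unfolding newton_def using T by (simp add: field_simps power2_eq_square)
    also have "\<dots> = D\<^sup>2 * (w v * newton 1 x y v) - (D + s + q) * (exp v * w v) + s * (exp (2 * v) * w v) + q * w v"
      unfolding scaled_distance_increment(2) y exp_double D_def[symmetric] s_def[symmetric] q_def[symmetric] by algebra
    finally show "((norm x)\<^sup>2 * (exp (- v) - 1) + r\<^sup>2 * (exp v - 1))\<^sup>2 * (2 * (1 + r\<^sup>2) / (1 - r\<^sup>2) * exp (- (2 * v / (1 - r\<^sup>2))))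
        / (norm (exp (- v) *\<^sub>R x - y))\<^sup>2 = D\<^sup>2 * (w v * newton 1 x y v) - (D + s + q) * (exp (1 * v) * w v) + s * (exp (2 * v) * w v) + q * w v"
      by simp
  qed
  also have "\<dots> = D\<^sup>2 * J - (D + s + q) * 2 + s * ((1 + s) / s) + q * (1 + s)"
  proof -
    note iN = damped_newton_integrable[OF xy a(3), of \<alpha> 0 1, folded w_def]
    show ?thesis
      unfolding J_def set_integral_combination[OF iN iw(2,3,1)] I0 I1 I2 ..
  qed
  finally have I: "?I = D\<^sup>2 * J - (D + s + q) * 2 + (1 + s) + q * (1 + s)" using s by simp
  have kernel: "(LINT v:{0<..}|lborel. damped a 0 (2 - a * (1 - q)) 0 v * newton 1 x y v) = (q - s) / (1 + s) * J"
  proof -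
    have "1 + s \<noteq> 0" "1 - s \<noteq> 0" using s by simp_all
    then have "2 - a * (1 - q) = (q - s) / (1 + s) * \<alpha>"
      unfolding a_def \<alpha>_def by (simp add: divide_simps) algebra
    then have "damped a 0 (2 - a * (1 - q)) 0 v = (q - s) / (1 + s) * w v" for v
      by (simp add: w_def damped_scale)
    then show ?thesis by (simp add: J_def mult.assoc)
  qed
  have xx: "x \<bullet> x = q" "y \<bullet> y = s" "norm (x - y) ^ 4 = D\<^sup>2" using y by (simp_all add: q_def s_def D_def dsq_0 power2_norm_eq_inner[symmetric])
  have "poisson4 r x y = (2 / D - (1 - q) * (- (s - q - D) / D\<^sup>2) - (1 + s) / (1 - s) * ((1 - q) / D + (q - s) / (1 + s) * J)) / (1 - s)"
    unfolding poisson4_def s_def[symmetric] xx a_def[symmetric] kernel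
    by (simp add: newton_def newton1_def D_def[symmetric] xx power2_eq_square)
  also have "\<dots> = (s - q) / ((1 - s)\<^sup>2 * D\<^sup>2) * (D\<^sup>2 * J - (D + s + q) * 2 + (1 + s) + q * (1 + s))"
    using s D by (simp add: divide_simps) algebra
  finally show ?thesis unfolding I[symmetric] by (simp only: s_def q_def xx(3))
qed

text \<open>With the notation of the preceding lemma and \<open>T = exp v * D\<^sub>v\<close>, the bracket times the second factor of \<open>L6\<close> is
\<open>(T - D)\<^sup>2 (2 T + D) = 2 T\<^sup>3 - 3 T\<^sup>2 D + D\<^sup>3\<close>.  Division by \<open>D\<^sub>v\<^sup>2\<close> leaves \<open>D\<^sup>3 w / D\<^sub>v\<^sup>2\<close> and multiples of
\<open>exp (k * v) * w\<close> for \<open>k = 1, 2, 3\<close>.\<close>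

lemma poisson6_on_sphere:
  fixes x y :: "real ^ 'n"
  assumes r: "0 < r" "r < 1" "norm x < r" and y: "norm y = r"
  shows "poisson6 r x y = (r\<^sup>2 - (norm x)\<^sup>2) / ((1 - r\<^sup>2) ^ 4 * norm (x - y) ^ 6) *
    (LINT v:{0<..}|lborel. L6 r x y v * w6 ((norm x)\<^sup>2) r v / norm (exp (- v) *\<^sub>R x - y) ^ 4)"
    (is "_ = _ * ?I")
proof -
  define s q b d where "s = r\<^sup>2" and "q = (norm x)\<^sup>2" and "b = b6 r" and "d = d6 r"
  define u where "u = 1 - s"
  have s: "0 < s" "s < 1" and r1: "r\<^sup>2 < 1" using r by (simp_all add: s_def power_less_one_iff)
  have u: "u > 0" "u < 1" using s by (simp_all add: u_def)
  have xy: "norm x < norm y" using r y by simp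
  define D where "D = dsq x y 0"
  have D: "D > 0" unfolding D_def by (rule dsq_pos) (use xy in auto)
  define \<alpha> \<beta> where "\<alpha> = 3 * (1 - s * q + 3 * (s - q))" and "\<beta> = 3 / 2 * (1 + s * q + 5 * (s + q))"
  define w where "w = damped b d \<alpha> \<beta>"
  have w6: "w6 q r v = w v" for v by (simp add: w6_damped w_def b_def d_def \<alpha>_def \<beta>_def s_def)
  define J where "J = (LINT v:{0<..}|lborel. w v * newton 2 x y v)"
  have a: "sqrt (max d 0) < b - 3" "sqrt (max d 0) < b - 2" "sqrt (max d 0) < b - 1" "sqrt (max d 0) < b"
    using sqrt_d6_less[OF r(1,2)] by (simp_all add: b_def d_def)
  have iw: "set_integrable lborel {0<..} (\<lambda>v. exp (1 * v) * w v)" "set_integrable lborel {0<..} (\<lambda>v. exp (2 * v) * w v)"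
    "set_integrable lborel {0<..} (\<lambda>v. exp (3 * v) * w v)"
    unfolding w_def damped_exp by (rule damped_integral(1)[OF a(3)] damped_integral(1)[OF a(2)] damped_integral(1)[OF a(1)])+
  define I1 I2 I3 where "I1 = (LINT v:{0<..}|lborel. exp (1 * v) * w v)" and "I2 = (LINT v:{0<..}|lborel. exp (2 * v) * w v)"
    and "I3 = (LINT v:{0<..}|lborel. exp (3 * v) * w v)"
  have "?I = (LINT v:{0<..}|lborel. D ^ 3 * (w v * newton 2 x y v) - (D + 2 * (s + q)) * (exp (2 * v) * w v)
      + 2 * s * (exp (3 * v) * w v) + 2 * q * (exp (1 * v) * w v))"
  proof (rule set_lebesgue_integral_cong, simp, intro allI impI)
    fix v :: real assume "v \<in> {0<..}"
    then have v: "0 < v" by simp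
    have T: "dsq x y v > 0" using dsq_pos[OF _ xy, of v] v by simp
    have "exp (- v / 2) *\<^sub>R x - exp (v / 2) *\<^sub>R y = exp (v / 2) *\<^sub>R (exp (- v) *\<^sub>R x - y)"
      by (simp add: scaleR_diff_right mult_exp_exp)
    then have "(norm (exp (- v / 2) *\<^sub>R x - exp (v / 2) *\<^sub>R y))\<^sup>2 = exp v * dsq x y v"
      by (simp add: dsq_def power_mult_distrib exp_double[symmetric])
    then have L: "L6 r x y v = (exp v * dsq x y v - D)\<^sup>2 * (2 * (exp v * dsq x y v) + D)"
      using scaled_distance_increment(1)[of x v y] unfolding L6_def D_def y by (simp add: dsq_0)
    have "norm (exp (- v) *\<^sub>R x - y) ^ 4 = (dsq x y v)\<^sup>2" by (simp add: dsq_def)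
    then have "L6 r x y v * w6 ((norm x)\<^sup>2) r v / norm (exp (- v) *\<^sub>R x - y) ^ 4
       = (exp v * dsq x y v - D)\<^sup>2 * (2 * (exp v * dsq x y v) + D) * w v / (dsq x y v)\<^sup>2"
      by (simp only: L q_def[symmetric] w6)
    also have "\<dots> = w v * (D ^ 3 * newton 2 x y v - 3 * D * (exp v)\<^sup>2 + 2 * exp v * ((exp v)\<^sup>2 * dsq x y v))"
      unfolding newton_def using T by (simp add: divide_simps) algebra
    also have "\<dots> = D ^ 3 * (w v * newton 2 x y v) - (D + 2 * (s + q)) * ((exp v)\<^sup>2 * w v)
      + 2 * s * ((exp v) ^ 3 * w v) + 2 * q * (exp v * w v)"
      unfolding scaled_distance_increment(2) y D_def[symmetric] s_def[symmetric] q_def[symmetric] by algebra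
    finally show "L6 r x y v * w6 ((norm x)\<^sup>2) r v / norm (exp (- v) *\<^sub>R x - y) ^ 4 = D ^ 3 * (w v * newton 2 x y v) - (D + 2 * (s + q)) * (exp (2 * v) * w v)
      + 2 * s * (exp (3 * v) * w v) + 2 * q * (exp (1 * v) * w v)"
      by (simp only: mult_1 exp_of_nat_mult[of 2 v, symmetric] exp_of_nat_mult[of 3 v, symmetric] of_nat_numeral)
  qed
  also have "\<dots> = D ^ 3 * J - (D + 2 * (s + q)) * I2 + 2 * s * I3 + 2 * q * I1"
  proof -
    note iN = damped_newton_integrable[OF xy a(4), of \<alpha> \<beta> 2, folded w_def]
    show ?thesis
      unfolding J_def I1_def I2_def I3_def
      by (rule set_integral_combination[OF iN iw(2,3,1)])
  qed
  finally have I: "?I = \<dots>" .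
  have s_u: "s = 1 - u" by (simp add: u_def)
  have b: "b = 3 / u + 1 / 2" "b\<^sup>2 - d = 12 / u\<^sup>2" using b6_d6[OF r1] unfolding b_def d_def u_def s_def by blast+
  have sq: "(b - k)\<^sup>2 - d = 12 / u\<^sup>2 - 6 * k / u - k + k\<^sup>2" for k
  proof -
    have "(b - k)\<^sup>2 - d = (b\<^sup>2 - d) - 2 * k * b + k\<^sup>2" by (simp add: power2_eq_square algebra_simps)
    then show ?thesis unfolding b(2) unfolding b(1) by (simp add: algebra_simps)
  qed
  have "I1 = u * (12 * (1 - q) - 8 * (1 - q) * u - u\<^sup>2 * (1 + q)) / (2 * (2 - u))"
  proof -
    have "12 / u\<^sup>2 - 6 * 1 / u - 1 + 1\<^sup>2 = 6 * (2 - u) / u\<^sup>2" using u by (simp add: field_simps power2_eq_square)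
    moreover have "\<alpha> * (b - 1) + \<beta> = (36 * (1 - q) - 24 * (1 - q) * u - 3 * u\<^sup>2 * (1 + q)) / u"
      unfolding b(1) \<alpha>_def \<beta>_def s_u using u by (simp add: field_simps power2_eq_square)
    ultimately show ?thesis
      unfolding I1_def w_def damped_exp damped_integral(2)[OF a(3)] sq using u by (simp add: divide_simps) algebra
  qed
  moreover have "s * I3 = u * (12 * (1 - q) - 16 * (1 - q) * u + u\<^sup>2 * (5 - 3 * q)) / (2 * (2 - u))"
  proof -
    have "12 / u\<^sup>2 - 6 * 3 / u - 3 + 3\<^sup>2 = 6 * (1 - u) * (2 - u) / u\<^sup>2" using u by (simp add: field_simps power2_eq_square)
    moreover have "\<alpha> * (b - 3) + \<beta> = (36 * (1 - q) - 48 * (1 - q) * u + u\<^sup>2 * (15 - 9 * q)) / u"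
      unfolding b(1) \<alpha>_def \<beta>_def s_u using u by (simp add: field_simps power2_eq_square)
    ultimately show ?thesis
      unfolding I3_def w_def damped_exp damped_integral(2)[OF a(1)] sq s_u using u by (simp add: divide_simps) algebra
  qed
  moreover have I2: "I2 = 3 * u * (1 - q)"
  proof -
    have "12 / u\<^sup>2 - 6 * 2 / u - 2 + 2\<^sup>2 = 2 * (6 - 6 * u + u\<^sup>2) / u\<^sup>2" using u by (simp add: field_simps power2_eq_square)
    moreover have "\<alpha> * (b - 2) + \<beta> = 6 * (6 - 6 * u + u\<^sup>2) * (1 - q) / u"
      unfolding b(1) \<alpha>_def \<beta>_def s_u using u by (simp add: field_simps power2_eq_square)
    moreover have "6 - 6 * u + u\<^sup>2 > 0"
    proof -
      have "0 < 6 * (1 - u) + u\<^sup>2" using u by (intro add_pos_pos) auto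
      then show ?thesis by (simp add: algebra_simps)
    qed
    ultimately show ?thesis
      unfolding I2_def w_def damped_exp damped_integral(2)[OF a(2)] sq using u by (simp add: divide_simps power2_eq_square)
  qed
  ultimately have I123: "2 * (s * I3 + q * I1 - (s + q) * I2) = u\<^sup>2 * (1 - q)\<^sup>2"
    unfolding s_u using u by (simp add: divide_simps) algebra
  have xx: "x \<bullet> x = q" "y \<bullet> y = s" "norm (x - y) ^ 6 = D ^ 3" using y
    by (simp_all add: q_def s_def D_def dsq_0 power2_norm_eq_inner[symmetric])
  have "poisson6 r x y = (1 - q)\<^sup>2 * (2 * (1 - b) / D\<^sup>2 - (- 2 * (s - q - D) / D ^ 3)) / (2 * u\<^sup>2) + (1 - q) * (7 - q) / D\<^sup>2 / (2 * u\<^sup>2)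
      + (s - q) / u ^ 4 * J"
    unfolding poisson6_def s_def[symmetric] xx b_def[symmetric] u_def[symmetric] w6 J_def
    by (simp add: newton_def newton1_def D_def[symmetric] xx)
  also have "\<dots> = (s - q) / (u ^ 4 * D ^ 3) * (D ^ 3 * J - D * (3 * u * (1 - q)) + u\<^sup>2 * (1 - q)\<^sup>2)"
    unfolding b(1) s_u using u D by (simp add: divide_simps) algebra
  also have "\<dots> = (s - q) / (u ^ 4 * D ^ 3) * (D ^ 3 * J - (D + 2 * (s + q)) * I2 + 2 * s * I3 + 2 * q * I1)"
    unfolding I123[symmetric] I2[symmetric] by (simp add: algebra_simps)
  finally show ?thesis unfolding I[symmetric] by (simp only: s_def q_def u_def xx(3))
qed

theorem corollary5p2:
  fixes P :: "real ^ 'n \<Rightarrow> 'w measure"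
    and X :: "real \<Rightarrow> 'w \<Rightarrow> real ^ 'n"
    and x y :: "real ^ 'n"
    and r :: real
  assumes "hyperbolic_Brownian_motion P X"
    and "0 < r" and "r < 1"
    and "norm x < r"
    and "norm y = r"
  shows "(CARD('n) = 4 \<longrightarrow>
      (\<forall>v>0. w_n 4 ((norm x)\<^sup>2) (r\<^sup>2) v
          = 2 * (1 + r\<^sup>2) / (1 - r\<^sup>2) * exp (- (2 * v / (1 - r\<^sup>2)))) \<and>
      poisson_kernel P X r x y
        = 1 / (2 * pi\<^sup>2 * r * (1 - r\<^sup>2)\<^sup>2) * ((r\<^sup>2 - (norm x)\<^sup>2) / norm (x - y) ^ 4)
          * (LINT v:{0<..}|lborel.
               ((norm x)\<^sup>2 * (exp (- v) - 1) + r\<^sup>2 * (exp v - 1))\<^sup>2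
               * w_n 4 ((norm x)\<^sup>2) (r\<^sup>2) v / (norm (exp (- v) *\<^sub>R x - y))\<^sup>2))
    \<and> (CARD('n) = 6 \<longrightarrow>
      (\<forall>v>0. complex_of_real (w_n 6 ((norm x)\<^sup>2) (r\<^sup>2) v) = w6_1 x r v + w6_2 x r v) \<and>
      poisson_kernel P X r x y
        = 1 / (pi ^ 3 * r * (1 - r\<^sup>2) ^ 4) * ((r\<^sup>2 - (norm x)\<^sup>2) / norm (x - y) ^ 6)
          * (LINT v:{0<..}|lborel.
               L6 r x y v * w_n 6 ((norm x)\<^sup>2) (r\<^sup>2) v / norm (exp (- v) *\<^sub>R x - y) ^ 4))"
proof -
  note X = assms(1) and r = assms(2-4) and y = assms(5)
  have s: "0 < r\<^sup>2" "r\<^sup>2 < 1" using r by (simp_all add: power_less_one_iff)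
  have q: "(norm x)\<^sup>2 < r\<^sup>2" using r by (intro power_strict_mono) auto
  note w4 = w_n_4[OF q s] and w6 = w_n_6[OF r(1,2) q]
  have motion: "hyperbolic_motion (P x) X x" if "norm x < r" for x
    by (rule hyperbolic_motionI[OF X]) (use that r in simp)
  have four: "poisson_kernel P X r x y
        = 1 / (2 * pi\<^sup>2 * r * (1 - r\<^sup>2)\<^sup>2) * ((r\<^sup>2 - (norm x)\<^sup>2) / norm (x - y) ^ 4)
          * (LINT v:{0<..}|lborel.
               ((norm x)\<^sup>2 * (exp (- v) - 1) + r\<^sup>2 * (exp v - 1))\<^sup>2
               * w_n 4 ((norm x)\<^sup>2) (r\<^sup>2) v / (norm (exp (- v) *\<^sub>R x - y))\<^sup>2)" (is "_ = _ * ?I") if n: "CARD('n) = 4"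
  proof -
    have "poisson_kernel P X r x y = poisson4 r x y / (real CARD('n) * unit_ball_vol (real CARD('n)) * r)"
    proof (rule poisson_kernel_from_integrals[OF X _ r y])
      show "(\<integral>y. ((norm z)\<^sup>2 - (norm y)\<^sup>2) / norm (y - z) ^ CARD('n) \<partial>exit_law (P x) X r) = poisson4 r x z"
        if "norm x < r" "r < norm z" for x z
        unfolding n by (rule hyperbolic_motion.exit_poisson4[OF motion n r(1,2)]) (use that in auto)
      show "poisson4 r 0 z = 1 / norm z ^ (CARD('n) - 2)" if "r < norm z" for z :: "real ^ 'n"
      proof -
        have "z \<noteq> 0" using that r by auto
        then show ?thesis using poisson4_centre[OF r(1,2), of z] by (simp add: n)
      qed
    qed (use n r in \<open>auto intro: continuous_on_poisson4\<close>)
    also have "real CARD('n) * unit_ball_vol (real CARD('n)) = 2 * pi\<^sup>2"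
      unfolding n by (simp add: unit_ball_vol_numeral)
    also have "poisson4 r x y = (r\<^sup>2 - (norm x)\<^sup>2) / ((1 - r\<^sup>2)\<^sup>2 * norm (x - y) ^ 4) * ?I"
      unfolding poisson4_on_sphere[OF r y]
      by (rule arg_cong[where f = "(*) _"], rule set_lebesgue_integral_cong) (simp_all add: w4)
    finally show ?thesis by simp
  qed
  have six: "poisson_kernel P X r x y
        = 1 / (pi ^ 3 * r * (1 - r\<^sup>2) ^ 4) * ((r\<^sup>2 - (norm x)\<^sup>2) / norm (x - y) ^ 6)
          * (LINT v:{0<..}|lborel.
               L6 r x y v * w_n 6 ((norm x)\<^sup>2) (r\<^sup>2) v / norm (exp (- v) *\<^sub>R x - y) ^ 4)" (is "_ = _ * ?I") if n: "CARD('n) = 6"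
  proof -
    have "poisson_kernel P X r x y = poisson6 r x y / (real CARD('n) * unit_ball_vol (real CARD('n)) * r)"
    proof (rule poisson_kernel_from_integrals[OF X _ r y])
      show "(\<integral>y. ((norm z)\<^sup>2 - (norm y)\<^sup>2) / norm (y - z) ^ CARD('n) \<partial>exit_law (P x) X r) = poisson6 r x z"
        if "norm x < r" "r < norm z" for x z
        unfolding n by (rule hyperbolic_motion.exit_poisson6[OF motion n r(1,2)]) (use that in auto)
      show "poisson6 r 0 z = 1 / norm z ^ (CARD('n) - 2)" if "r < norm z" for z :: "real ^ 'n"
      proof -
        have "z \<noteq> 0" using that r by auto
        then show ?thesis using poisson6_centre[OF r(1,2), of z] by (simp add: n)
      qed
    qed (use n r in \<open>auto intro: continuous_on_poisson6\<close>)
    also have "real CARD('n) * unit_ball_vol (real CARD('n)) = pi ^ 3"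
      unfolding n by (simp add: unit_ball_vol_numeral fact_numeral)
    also have "poisson6 r x y = (r\<^sup>2 - (norm x)\<^sup>2) / ((1 - r\<^sup>2) ^ 4 * norm (x - y) ^ 6) * ?I"
      unfolding poisson6_on_sphere[OF r y]
      by (rule arg_cong[where f = "(*) _"], rule set_lebesgue_integral_cong) (simp_all add: w6)
    finally show ?thesis by simp
  qed
  show ?thesis
    using w4 w6 w6_eq_w6_1_w6_2[OF s(2), of x] four six by auto
qed

end
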